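(* For $\vec{x}=(a,b,c,d,e,f,g)^T\in V$, $$A(1-a,e-a,f-a,g-a)\,B_4(b,a,c,d,e,f,g)\,K_{p_0}(\vec{x})-A(1-b,e-b,f-b,g-b)\,B_4(\vec{x})\,K_{p_1}(\vec{x})$$ $$-\,S(b-a)\,A(f-a,f-b,f-c,f-d)\,A(g-a,g-b,g-c,g-d)\,A(a,b,c,d)\,L_{\overline{6}}(\vec{x})=0.$$
   Context: $V=\{(a,b,c,d,e,f,g)^T\in\mathbb{C}^7: e+f+g-a-b-c-d=1\}$. ${}_4F_3\left[\begin{smallmatrix}a,b,c,d\\ e,f,g\end{smallmatrix};1\right]=\sum_{n\ge0}\frac{(a)_n(b)_n(c)_n(d)_n}{n!(e)_n(f)_n(g)_n}$, with $(a)_n$ the rising factorial. For $(a,b,c,d,e,f,g)^T\in V$, $$K(a;b,c,d;e,f,g)=\frac{{}_4F_3\left[\begin{smallmatrix}a,b,c,d\\ e,f,g\end{smallmatrix};1\right]}{\sin\pi a\,\Gamma(a)\Gamma(1+a-e)\Gamma(1+a-f)\Gamma(1+a-g)\Gamma(e)\Gamma(f)\Gamma(g)}+\frac{{}_4F_3\left[\begin{smallmatrix}a,1+a-e,1+a-f,1+a-g\\ 1+a-b,1+a-c,1+a-d\end{smallmatrix};1\right]}{\sin\pi a\,\Gamma(a)\Gamma(b)\Gamma(c)\Gamma(d)\Gamma(1+a-b)\Gamma(1+a-c)\Gamma(1+a-d)},$$ $$L(a,b,c,d;e;f,g)=\frac{{}_4F_3\left[\begin{smallmatrix}a,b,c,d\\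 e,f,g\end{smallmatrix};1\right]}{\sin\pi e\,\Gamma(1+a-e)\Gamma(1+b-e)\Gamma(1+c-e)\Gamma(1+d-e)\Gamma(e)\Gamma(f)\Gamma(g)}-\frac{{}_4F_3\left[\begin{smallmatrix}1+a-e,1+b-e,1+c-e,1+d-e\\ 2-e,1+f-e,1+g-e\end{smallmatrix};1\right]}{\sin\pi e\,\Gamma(a)\Gamma(b)\Gamma(c)\Gamma(d)\Gamma(2-e)\Gamma(1+f-e)\Gamma(1+g-e)}.$$ Notation: $S(a_1,\dots,a_n)=\sin\pi a_1\cdots\sin\pi a_n$; $A(x,y,z,w)=\frac{1}{\Gamma(x)\Gamma(y)\Gamma(z)\Gamma(w)}$ (with $1/\Gamma=0$ at nonpositive integers). The relation is asserted for those $\vec{x}\in V$ at which the $K$ and $L$ functions occurring are defined (no lower parameter of an occurring series is a nonpositive integer, no sine in an occurring denominator vanishes). Here $K_{p_0}(\vec{x})=K(a;b,c,d;e,f,g)$, $K_{p_1}(\vec{x})=K(b;c,d,a;e,f,g)$, $L_{\overline{6}}(\vec{x})=L(1-a,1-b,1-c,1-d;2-e;2-f,2-g)$, and $B_4(\vec{x})=B_4(a,b,c,d,e,f,g)=\pi^{-4}S(f-a,g-a)\,[S(b,c,d)+S(e-a,f,g)]$. *)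

theory Defs
  imports "HOL-Analysis.Analysis"
begin

type_synonym complex7 =
  "complex \<times> complex \<times> complex \<times> complex \<times> complex \<times> complex \<times> complex"

definition V_set :: "complex7 set" where
  "V_set = {(a, b, c, d, e, f, g). e + f + g - a - b - c - d = 1}"

(* The value at 1 of the series 4F3 with upper parameters a, b, c, d and lower parameters
   e, f, g.  The sum is meaningful when no lower parameter is a nonpositive integer and
   Re (e + f + g - a - b - c - d) > 0; for parameters in V_set, this excess is 1 for each of
   the series occurring in K_fun and L_fun. *)
definition hyp4F3 ::
  "complex \<Rightarrow> complex \<Rightarrow> complex \<Rightarrow> complex \<Rightarrow> complex \<Rightarrow> complex \<Rightarrow> complex \<Rightarrow> complex" where
  "hyp4F3 a b c d e f g =
     (\<Sum>n. (pochhammer a n * pochhammer b n * pochhammer c n * pochhammer d n) /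
          (fact n * pochhammer e n * pochhammer f n * pochhammer g n))"

definition sinpi :: "complex \<Rightarrow> complex" where
  "sinpi z = sin (of_real pi * z)"

definition S_prod :: "complex list \<Rightarrow> complex" where
  "S_prod zs = (\<Prod>z\<leftarrow>zs. sinpi z)"

(* rGamma is the entire reciprocal Gamma function, zero at the nonpositive integers; it is
   used for every 1 / Gamma below. *)
definition A_prod :: "complex \<Rightarrow> complex \<Rightarrow> complex \<Rightarrow> complex \<Rightarrow> complex" where
  "A_prod x y z w = rGamma x * rGamma y * rGamma z * rGamma w"

(* K_fun a b c d e f g is K(a; b, c, d; e, f, g). *)
definition K_fun ::
  "complex \<Rightarrow> complex \<Rightarrow> complex \<Rightarrow> complex \<Rightarrow> complex \<Rightarrow> complex \<Rightarrow> complex \<Rightarrow> complex" where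
  "K_fun a b c d e f g =
     hyp4F3 a b c d e f g / sinpi a
       * (rGamma a * rGamma (1 + a - e) * rGamma (1 + a - f) * rGamma (1 + a - g)
          * rGamma e * rGamma f * rGamma g)
   + hyp4F3 a (1 + a - e) (1 + a - f) (1 + a - g) (1 + a - b) (1 + a - c) (1 + a - d) / sinpi a
       * (rGamma a * rGamma b * rGamma c * rGamma d
          * rGamma (1 + a - b) * rGamma (1 + a - c) * rGamma (1 + a - d))"

definition K_defined ::
  "complex \<Rightarrow> complex \<Rightarrow> complex \<Rightarrow> complex \<Rightarrow> complex \<Rightarrow> complex \<Rightarrow> complex \<Rightarrow> bool" where
  "K_defined a b c d e f g \<longleftrightarrow>
     sinpi a \<noteq> 0 \<and> e \<notin> \<int>\<^sub>\<le>\<^sub>0 \<and> f \<notin> \<int>\<^sub>\<le>\<^sub>0 \<and> g \<notin> \<int>\<^sub>\<le>\<^sub>0 \<and>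
     1 + a - b \<notin> \<int>\<^sub>\<le>\<^sub>0 \<and> 1 + a - c \<notin> \<int>\<^sub>\<le>\<^sub>0 \<and> 1 + a - d \<notin> \<int>\<^sub>\<le>\<^sub>0"

(* L_fun a b c d e f g is L(a, b, c, d; e; f, g). *)
definition L_fun ::
  "complex \<Rightarrow> complex \<Rightarrow> complex \<Rightarrow> complex \<Rightarrow> complex \<Rightarrow> complex \<Rightarrow> complex \<Rightarrow> complex" where
  "L_fun a b c d e f g =
     hyp4F3 a b c d e f g / sinpi e
       * (rGamma (1 + a - e) * rGamma (1 + b - e) * rGamma (1 + c - e) * rGamma (1 + d - e)
          * rGamma e * rGamma f * rGamma g)
   - hyp4F3 (1 + a - e) (1 + b - e) (1 + c - e) (1 + d - e) (2 - e) (1 + f - e) (1 + g - e) / sinpi e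
       * (rGamma a * rGamma b * rGamma c * rGamma d
          * rGamma (2 - e) * rGamma (1 + f - e) * rGamma (1 + g - e))"

definition L_defined ::
  "complex \<Rightarrow> complex \<Rightarrow> complex \<Rightarrow> complex \<Rightarrow> complex \<Rightarrow> complex \<Rightarrow> complex \<Rightarrow> bool" where
  "L_defined a b c d e f g \<longleftrightarrow>
     sinpi e \<noteq> 0 \<and> e \<notin> \<int>\<^sub>\<le>\<^sub>0 \<and> f \<notin> \<int>\<^sub>\<le>\<^sub>0 \<and> g \<notin> \<int>\<^sub>\<le>\<^sub>0 \<and>
     2 - e \<notin> \<int>\<^sub>\<le>\<^sub>0 \<and> 1 + f - e \<notin> \<int>\<^sub>\<le>\<^sub>0 \<and> 1 + g - e \<notin> \<int>\<^sub>\<le>\<^sub>0"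

fun K_p0 :: "complex7 \<Rightarrow> complex" where
  "K_p0 (a, b, c, d, e, f, g) = K_fun a b c d e f g"

fun K_p0_defined :: "complex7 \<Rightarrow> bool" where
  "K_p0_defined (a, b, c, d, e, f, g) \<longleftrightarrow> K_defined a b c d e f g"

fun K_p1 :: "complex7 \<Rightarrow> complex" where
  "K_p1 (a, b, c, d, e, f, g) = K_fun b c d a e f g"

fun K_p1_defined :: "complex7 \<Rightarrow> bool" where
  "K_p1_defined (a, b, c, d, e, f, g) \<longleftrightarrow> K_defined b c d a e f g"

fun L_6bar :: "complex7 \<Rightarrow> complex" where
  "L_6bar (a, b, c, d, e, f, g) =
     L_fun (1 - a) (1 - b) (1 - c) (1 - d) (2 - e) (2 - f) (2 - g)"

fun L_6bar_defined :: "complex7 \<Rightarrow> bool" where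
  "L_6bar_defined (a, b, c, d, e, f, g) \<longleftrightarrow>
     L_defined (1 - a) (1 - b) (1 - c) (1 - d) (2 - e) (2 - f) (2 - g)"

fun B4 :: "complex7 \<Rightarrow> complex" where
  "B4 (a, b, c, d, e, f, g) =
     S_prod [f - a, g - a] * (S_prod [b, c, d] + S_prod [e - a, f, g]) / of_real pi ^ 4"

end

(* Fix the parameters and consider the entire function T(s), the sum over all integers n of
   Prod_i 1/(Gamma(b_i + s + n) Gamma(1 - a_i - s - n)), where (a_i) = (a, b, c, d) and (b_i) = (1, e, f, g).
   It is 1-periodic and o(exp(4 pi |Im s|)), so it is a linear combination of 1 and exp(+-2 pi i s).
   Hence its values at 0, -a, -b, 1 - f, 1 - g, which are multiples of Saalschuetzian 4F3 series, satisfy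
   linear relations with trigonometric coefficients.  One of them links K_p0 and K_p1 to
   L' = L(1+a-f, 1+b-f, 1+c-f, 1+d-f; 1+g-f; 1+e-f, 2-f).

   It remains to see that L' = L_6bar.  This follows from three applications of the two-term relation
   L(a,b,c,d;e;f,g) = L(f-a,f-b,c,d;e-nu;f,g-nu), nu = a + b - f, which comes from interchanging a double
   sum built from Euler's transformation of 2F1 coefficients and the nonterminating Saalschuetz theorem.

   All of this requires generic parameters; the general case follows by continuity, since the relation,
   multiplied by the sines in its denominators, is continuous on V. *)

theory Submission
  imports Defs "HOL-Complex_Analysis.Complex_Analysis"
begin

subsection \<open>Growth of Gamma quotients along the integers\<close>

text \<open>Every series absorbs the reciprocal Gammas of its lower parameters (\<open>F32\<close>,
  \<open>F43\<close>), so that it has no poles and the final limit can be taken in all parameters at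
  once. T becomes a one-sided series at a point where one of its eight reciprocal Gammas vanishes on
  a half-line of integers. The trigonometric space has dimension three, so T(1-f) and T(1-g) are
  both determined by T(0), T(-a), T(-b); the bracket S(b,c,d) + S(e-a,f,g) of \<open>B4\<close> is
  what the elimination leaves. The excess 1 is the source of the n^-2 decay of the 3F2 and 4F3
  series and of the strict growth bound that excludes exp(+-4 pi i s). The obstacle is that none of
  these points yields a series with upper parameters 1-a, 1-b, 1-c, 1-d, which forces the detour
  through the two-term relation. Its double sum is controlled only for Re \<nu> > 0, up to an
  inversion for Re \<nu> < 0, so the locus Re \<nu> = 0 joins the exceptional set that the final
  limit removes.\<close>

text \<open>\<open>npow z n\<close> is \<open>n powr z\<close> for positive \<open>n\<close>; at \<open>n = 0\<close> it is \<open>1\<close> (as \<open>ln 0 = 0\<close>), which keeps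
  \<open>npow_add\<close> unconditional.\<close>

definition npow :: "complex \<Rightarrow> nat \<Rightarrow> complex" where
  "npow z n = exp (z * of_real (ln (real n)))"

lemma npow_add: "npow (z + w) n = npow z n * npow w n"
  by (simp add: npow_def ring_distribs exp_add)

lemma npow_0 [simp]: "npow 0 n = 1"
  by (simp add: npow_def)

lemma npow_1: "n > 0 \<Longrightarrow> npow 1 n = of_nat n"
  by (simp add: npow_def exp_of_real)

lemma norm_npow: "n > 0 \<Longrightarrow> norm (npow z n) = real n powr Re z"
  by (simp add: npow_def powr_def)

lemma add_of_nat_over_of_nat_tendsto:
  "(\<lambda>n. (z + of_nat n) / of_nat n :: complex) \<longlonglongrightarrow> 1"
proof -
  have "(\<lambda>n. 1 + z / of_nat n) \<longlonglongrightarrow> 1 + 0"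
    by (intro tendsto_intros lim_const_over_n)
  moreover have "\<forall>\<^sub>F n in sequentially. 1 + z / of_nat n = (z + of_nat n) / of_nat n"
    by (auto intro!: eventually_mono[OF eventually_gt_at_top[of 0]] simp: field_simps)
  ultimately show ?thesis by (simp add: tendsto_cong)
qed

text \<open>This is the Gauss limit for 1/Gamma: \<open>rGamma_series\<close> contains one more
  factor z + n, whose quotient by n tends to 1.\<close>

lemma pochhammer_asymp:
  "(\<lambda>n. pochhammer z n / fact n * npow (1 - z) n) \<longlonglongrightarrow> rGamma z"
proof -
  have "(\<lambda>n. rGamma_series z n / ((z + of_nat n) / of_nat n)) \<longlonglongrightarrow> rGamma z / 1"
    by (intro tendsto_intros add_of_nat_over_of_nat_tendsto) simp
  moreover have "\<forall>\<^sub>F n in sequentially. rGamma_series z n / ((z + of_nat n) / of_nat n) =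
      pochhammer z n / fact n * npow (1 - z) n"
  proof -
    obtain N where N: "real N > norm z" using reals_Archimedean2 by blast
    show ?thesis
    proof (rule eventually_mono[OF eventually_ge_at_top[of "Suc N"]])
      fix n assume n: "Suc N \<le> n"
      have nz: "z + of_nat n \<noteq> 0"
      proof
        assume "z + of_nat n = 0"
        hence "z = - of_nat n" by (simp add: eq_neg_iff_add_eq_0)
        hence "norm z = real n" by simp
        with N n show False by simp
      qed
      have "npow 1 n = npow (1 - z) n * npow z n" by (simp flip: npow_add)
      with n have "of_nat n = npow (1 - z) n * npow z n" by (simp add: npow_1)
      moreover have "rGamma_series z n = pochhammer z n * (z + of_nat n) / (fact n * npow z n)"
        by (simp add: rGamma_series_def pochhammer_Suc npow_def)
      moreover have "npow z n \<noteq> 0" by (simp add: npow_def)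
      ultimately show "rGamma_series z n / ((z + of_nat n) / of_nat n) =
          pochhammer z n / fact n * npow (1 - z) n"
        using nz n by simp
    qed
  qed
  ultimately show ?thesis by (simp add: tendsto_cong)
qed

text \<open>For Re w > 0 this is the reciprocal of \<open>pochhammer_asymp\<close>. Elsewhere
  \<open>rGamma w\<close> may vanish and cannot be divided by, so w is moved to the right in unit
  steps, each costing a factor (w + n) / n that tends to 1.\<close>

lemma rGamma_asymp:
  "(\<lambda>n. fact n * rGamma (w + of_nat n) * npow (w - 1) n) \<longlonglongrightarrow> (1::complex)"
proof -
  have *: "(\<lambda>n. fact n * rGamma (w + of_nat n) * npow (w - 1) n) \<longlonglongrightarrow> 1" if w: "Re w > 0" for w
  proof -
    have nz: "w \<notin> \<int>\<^sub>\<le>\<^sub>0" using w by (auto elim!: nonpos_Ints_cases)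
    hence r: "rGamma w \<noteq> 0" by (simp add: rGamma_eq_zero_iff)
    have "(\<lambda>n. rGamma w / (pochhammer w n / fact n * npow (1 - w) n)) \<longlonglongrightarrow> rGamma w / rGamma w"
      using r by (intro tendsto_intros pochhammer_asymp)
    moreover have "rGamma w / (pochhammer w n / fact n * npow (1 - w) n) =
        fact n * rGamma (w + of_nat n) * npow (w - 1) n" for n
    proof -
      have "pochhammer w n \<noteq> 0" using nz pochhammer_eq_0_imp_nonpos_Int by blast
      moreover have "npow (1 - w) n * npow (w - 1) n = 1" by (simp flip: npow_add)
      moreover have "npow (1 - w) n \<noteq> 0" by (simp add: npow_def)
      ultimately show ?thesis by (simp add: pochhammer_rGamma[of w n] field_simps)
    qed
    ultimately show ?thesis using r by simp
  qed
  have shift: "(\<lambda>n. fact n * rGamma (w + of_nat n) * npow (w - 1) n) \<longlonglongrightarrow> 1" if "Re w + real m > 0" for m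
    using that
  proof (induction m arbitrary: w)
    case 0
    then show ?case using * by simp
  next
    case (Suc m)
    have "(\<lambda>n. fact n * rGamma (w + 1 + of_nat n) * npow (w + 1 - 1) n * ((w + of_nat n) / of_nat n)) \<longlonglongrightarrow> 1 * 1"
      using Suc.prems by (intro tendsto_mult Suc.IH add_of_nat_over_of_nat_tendsto) simp
    moreover have "\<forall>\<^sub>F n in sequentially. fact n * rGamma (w + 1 + of_nat n) * npow (w + 1 - 1) n * ((w + of_nat n) / of_nat n)
         = fact n * rGamma (w + of_nat n) * npow (w - 1) n"
    proof (rule eventually_mono[OF eventually_gt_at_top[of 0]])
      fix n :: nat assume n: "0 < n"
      have "npow w n = npow (w - 1) n * of_nat n"
        using npow_add[of "w - 1" 1 n] n by (simp add: npow_1)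
      thus "fact n * rGamma (w + 1 + of_nat n) * npow (w + 1 - 1) n * ((w + of_nat n) / of_nat n)
         = fact n * rGamma (w + of_nat n) * npow (w - 1) n"
        using rGamma_plus1[of "w + of_nat n", symmetric] n by (simp add: add_ac)
    qed
    ultimately show ?case by (simp add: tendsto_cong)
  qed
  obtain m where "real m > - Re w" using reals_Archimedean2 by blast
  thus ?thesis by (intro shift[of m]) linarith
qed

text \<open>Pairing a Pochhammer symbol with a reciprocal Gamma cancels the factorials and leaves no
  condition on z or w. Term bounds and limits of shifted series are read off from this form.\<close>

lemma pochhammer_rGamma_asymp:
  "(\<lambda>n. pochhammer z n * rGamma (w + of_nat n) * npow (w - z) n) \<longlonglongrightarrow> rGamma z"
proof -
  have "(\<lambda>n. (pochhammer z n / fact n * npow (1 - z) n) * (fact n * rGamma (w + of_nat n) * npow (w - 1) n))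
      \<longlonglongrightarrow> rGamma z * 1"
    by (intro tendsto_mult pochhammer_asymp rGamma_asymp)
  moreover have "(pochhammer z n / fact n * npow (1 - z) n) * (fact n * rGamma (w + of_nat n) * npow (w - 1) n) =
      pochhammer z n * rGamma (w + of_nat n) * npow (w - z) n" for n
    using npow_add[of "1 - z" "w - 1" n] by simp
  ultimately show ?thesis by (simp only: mult_1_right)
qed

section \<open>Polynomial growth bounds for sequences\<close>

definition polybd :: "(nat \<Rightarrow> complex) \<Rightarrow> real \<Rightarrow> bool" where
  "polybd X r \<longleftrightarrow> (\<exists>C. \<forall>n. norm (X n) \<le> C * (1 + real n) powr r)"

lemma polybdE:
  assumes "polybd X r"
  obtains C where "C \<ge> 0" "\<And>n. norm (X n) \<le> C * (1 + real n) powr r"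
proof -
  from assms obtain C where C: "\<And>n. norm (X n) \<le> C * (1 + real n) powr r"
    by (auto simp: polybd_def)
  have "0 \<le> norm (X 0)" by simp
  also have "\<dots> \<le> C" using C[of 0] by simp
  finally show ?thesis using that C by blast
qed

lemma polybd_mult:
  assumes "polybd X r" "polybd Y s"
  shows "polybd (\<lambda>n. X n * Y n) (r + s)"
proof -
  obtain C where C: "C \<ge> 0" "\<And>n. norm (X n) \<le> C * (1 + real n) powr r" using polybdE[OF assms(1)] by blast
  obtain D where D: "D \<ge> 0" "\<And>n. norm (Y n) \<le> D * (1 + real n) powr s" using polybdE[OF assms(2)] by blast
  have "norm (X n * Y n) \<le> (C * D) * (1 + real n) powr (r + s)" for n
  proof -
    have "norm (X n * Y n) \<le> (C * (1 + real n) powr r) * (D * (1 + real n) powr s)"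
      unfolding norm_mult using C D by (intro mult_mono) auto
    thus ?thesis by (simp add: powr_add mult_ac)
  qed
  thus ?thesis unfolding polybd_def by blast
qed

lemma polybd_cmult: "polybd X r \<Longrightarrow> polybd (\<lambda>n. c * X n) r"
  using polybd_mult[of "\<lambda>_. c" 0 X r] by (force simp: polybd_def)

lemma summable_one_plus_powr: "r < -1 \<Longrightarrow> summable (\<lambda>n. (1 + real n) powr r)"
  using summable_real_powr_iff[of r] by (subst (asm) summable_Suc_iff[symmetric]) (simp add: add_ac)

lemma polybd_summable:
  assumes "polybd X r" "r < -1"
  shows "summable (\<lambda>n. norm (X n))"
proof -
  obtain C where C: "C \<ge> 0" "\<And>n. norm (X n) \<le> C * (1 + real n) powr r" using polybdE[OF assms(1)] by blast
  show ?thesis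
    by (rule summable_comparison_test'[OF summable_mult[OF summable_one_plus_powr[OF assms(2)], of C], of 0])
      (use C in auto)
qed

text \<open>A convergent sequence is bounded; the factor (1 + 1/n)^Re c converts n^Re c into (1 +
  n)^Re c, so that the bound covers n = 0 as well.\<close>

lemma polybd_of_tendsto:
  assumes "(\<lambda>n. X n * npow c n) \<longlonglongrightarrow> L"
  shows "polybd X (- Re c)"
proof -
  have 1: "(\<lambda>n. (1 + 1 / real n) powr Re c) \<longlonglongrightarrow> (1 + 0) powr Re c"
    by (intro tendsto_intros lim_const_over_n) auto
  have "(\<lambda>n. norm (X n * npow c n) * (1 + 1 / real n) powr Re c) \<longlonglongrightarrow> norm L * (1 + 0) powr Re c"
    by (intro tendsto_mult tendsto_norm assms 1)
  moreover have "\<forall>\<^sub>F n in sequentially. norm (X n * npow c n) * (1 + 1 / real n) powr Re c = norm (X n) * (1 + real n) powr Re c"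
  proof (rule eventually_mono[OF eventually_gt_at_top[of 0]])
    fix n :: nat assume n: "n > 0"
    have "real n powr Re c * (1 + 1 / real n) powr Re c = (real n * (1 + 1 / real n)) powr Re c"
      by (rule powr_mult[symmetric])
    also have "real n * (1 + 1 / real n) = 1 + real n" using n by (simp add: field_simps)
    finally show "norm (X n * npow c n) * (1 + 1 / real n) powr Re c = norm (X n) * (1 + real n) powr Re c"
      using n by (simp add: norm_mult norm_npow)
  qed
  ultimately have "(\<lambda>n. norm (X n) * (1 + real n) powr Re c) \<longlonglongrightarrow> norm L * (1 + 0) powr Re c"
    by (simp add: tendsto_cong)
  hence "Bseq (\<lambda>n. norm (X n) * (1 + real n) powr Re c)"
    by (intro convergent_imp_Bseq) (auto simp: convergent_def)
  then obtain C where C: "\<And>n. norm (norm (X n) * (1 + real n) powr Re c) \<le> C"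
    by (auto simp: Bseq_def)
  have "norm (X n) \<le> C * (1 + real n) powr (- Re c)" for n
    using C[of n] by (simp add: powr_minus field_simps)
  thus ?thesis unfolding polybd_def by blast
qed

lemma polybd_pochhammer: "polybd (\<lambda>n. pochhammer z n / fact n) (Re z - 1)"
  using polybd_of_tendsto[OF pochhammer_asymp[of z]] by simp

lemma polybd_pochhammer_rGamma: "polybd (\<lambda>n. pochhammer z n * rGamma (w + of_nat n)) (Re z - Re w)"
  using polybd_of_tendsto[OF pochhammer_rGamma_asymp[of z w]] by simp

subsection \<open>The summation theorem of Gauss\<close>

text \<open>Putting \<open>rGamma (e + n)\<close> in place of 1 / (e)_n divides the 2F1 series by
  Gamma(e) and makes its terms meaningful for every e.\<close>

definition gauss_term :: "complex \<Rightarrow> complex \<Rightarrow> complex \<Rightarrow> nat \<Rightarrow> complex" where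
  "gauss_term b c e n = pochhammer b n * pochhammer c n / fact n * rGamma (e + of_nat n)"

lemma polybd_gauss_term: "polybd (gauss_term b c e) (Re (b + c - e) - 1)"
proof -
  have "polybd (\<lambda>n. pochhammer b n / fact n * (pochhammer c n * rGamma (e + of_nat n))) (Re b - 1 + (Re c - Re e))"
    by (intro polybd_mult polybd_pochhammer polybd_pochhammer_rGamma)
  thus ?thesis by (simp add: gauss_term_def[abs_def] algebra_simps)
qed

lemma summable_gauss_term: "Re (e - b - c) > 0 \<Longrightarrow> summable (gauss_term b c e)"
  by (rule summable_norm_cancel, rule polybd_summable[OF polybd_gauss_term]) simp

text \<open>Contiguous relation in e, proved by telescoping: the certificate is n times the nth
  term, and it tends to 0 because Re (e - b - c) > 0.\<close>

lemma gauss_step: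
  assumes "Re (e - b - c) > 0"
  shows "(e - b - c) * suminf (gauss_term b c e) = (e - b) * (e - c) * suminf (gauss_term b c (e + 1))"
proof -
  define G where "G n = gauss_term b c e n * of_nat n" for n
  have Gdiff: "G (Suc n) - G n = (e - b) * (e - c) * gauss_term b c (e + 1) n - (e - b - c) * gauss_term b c e n" for n
  proof -
    have r: "rGamma (e + of_nat n) = (e + of_nat n) * rGamma (e + 1 + of_nat n)"
      using rGamma_plus1[of "e + of_nat n"] by (simp add: add_ac)
    have 1: "G (Suc n) = pochhammer b n * pochhammer c n * (b + of_nat n) * (c + of_nat n) / fact n * rGamma (e + 1 + of_nat n)"
      by (simp add: G_def gauss_term_def pochhammer_Suc add_ac divide_simps del: of_nat_Suc) (simp add: algebra_simps)
    show ?thesis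
      unfolding 1 unfolding G_def gauss_term_def r by (simp add: field_simps)
  qed
  have pG: "polybd G (Re (b + c - e))"
  proof -
    have "polybd (\<lambda>n. of_nat n) 1" unfolding polybd_def by (auto intro!: exI[of _ 1])
    from polybd_mult[OF polybd_gauss_term this, of b c e] show ?thesis by (simp add: G_def[abs_def])
  qed
  have "G \<longlonglongrightarrow> 0"
  proof -
    obtain C where C: "\<And>n. norm (G n) \<le> C * (1 + real n) powr (Re (b + c - e))" using polybdE[OF pG] by blast
    have "((\<lambda>n. C * (1 + real n) powr (Re (b + c - e))) \<longlonglongrightarrow> C * 0)"
      using assms by (intro tendsto_intros tendsto_neg_powr filterlim_tendsto_add_at_top[OF tendsto_const] filterlim_real_sequentially) auto
    thus ?thesis using C by (intro Lim_null_comparison[of G]) auto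
  qed
  hence "(\<lambda>n. G (Suc n) - G n) sums (0 - G 0)" by (rule telescope_sums)
  moreover have "(\<lambda>n. G (Suc n) - G n) sums ((e - b) * (e - c) * suminf (gauss_term b c (e + 1)) - (e - b - c) * suminf (gauss_term b c e))"
    unfolding Gdiff using assms
    by (intro sums_diff sums_mult summable_sums summable_gauss_term) auto
  ultimately show ?thesis by (auto simp: G_def dest: sums_unique2)
qed

lemma norm_pochhammer_ge:
  assumes "Re z \<ge> x" "x \<ge> 0"
  shows "norm (pochhammer z n) \<ge> pochhammer x n"
proof (induction n)
  case (Suc n)
  have "x + real n \<le> Re (z + of_nat n)" using assms by simp
  also have "\<dots> \<le> norm (z + of_nat n)" by (rule complex_Re_le_cmod)
  finally show ?case using Suc assms by (auto simp: pochhammer_Suc norm_mult intro!: mult_mono pochhammer_nonneg)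
qed auto

lemma rGamma_eq_pochhammer_div:
  assumes "Re z > 0"
  shows "rGamma (z + of_nat n) = rGamma z / pochhammer z n"
proof -
  have "pochhammer z n \<noteq> 0"
    using norm_pochhammer_ge[of "Re z" z n] assms pochhammer_pos[of "Re z" n] by force
  thus ?thesis by (simp add: pochhammer_rGamma[of z n])
qed

lemma Gamma_rGamma:
  assumes "Re z > 0"
  shows "Gamma z * rGamma z = 1"
proof -
  have "z \<notin> \<int>\<^sub>\<le>\<^sub>0" using assms by (auto elim!: nonpos_Ints_cases)
  thus ?thesis by (simp add: rGamma_inverse_Gamma Gamma_eq_zero_iff)
qed

text \<open>As e moves to infinity the normalised series collapses to its first term; Tannery's
  theorem needs one majorant for all shifts.\<close>

lemma gauss_limit:
  "(\<lambda>N. Gamma (e + of_nat N) * suminf (gauss_term b c (e + of_nat N))) \<longlonglongrightarrow> 1"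
proof -
  \<comment> \<open>From \<open>N0\<close> on, the real part of e + N is at least x, hence |(e +
    N)_n| \<ge> (x)_n, and the series at the real parameter x is a majorant; x > Re (b + c) makes it
    converge.\<close>
  obtain N0 where N0: "real N0 > max (- Re e) (Re (b + c) - Re e)" using reals_Archimedean2 by blast
  define x where "x = Re e + real N0"
  have x: "x > 0" "x > Re (b + c)" using N0 by (auto simp: x_def)
  define M where "M n = norm (gauss_term b c (of_real x) n) * Gamma x" for n
  have sM: "summable M"
    unfolding M_def using x by (intro summable_mult2 polybd_summable[OF polybd_gauss_term]) auto
  have bd: "norm (Gamma (e + of_nat N) * gauss_term b c (e + of_nat N) n) \<le> M n" if N: "N \<ge> N0" for N n
  proof -
    have re: "Re (e + of_nat N) \<ge> x" using N by (simp add: x_def)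
    hence "Gamma (e + of_nat N) * rGamma (e + of_nat N + of_nat n) = 1 / pochhammer (e + of_nat N) n"
      using x Gamma_rGamma[of "e + of_nat N"] by (subst rGamma_eq_pochhammer_div) auto
    hence 1: "norm (Gamma (e + of_nat N) * gauss_term b c (e + of_nat N) n) =
       norm (pochhammer b n * pochhammer c n / fact n) * (1 / norm (pochhammer (e + of_nat N) n))"
      by (simp add: gauss_term_def norm_mult norm_divide mult_ac)
    have 2: "M n = norm (pochhammer b n * pochhammer c n / fact n) * (1 / pochhammer x n)"
    proof -
      have "norm (rGamma (complex_of_real x)) * Gamma x = 1"
        using Gamma_real_pos[OF x(1)] by (simp add: rGamma_inverse_Gamma norm_inverse Gamma_complex_of_real)
      moreover have "norm (rGamma (complex_of_real x + of_nat n)) = norm (rGamma (complex_of_real x)) / pochhammer x n"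
        using rGamma_eq_pochhammer_div[of "of_real x" n] x pochhammer_pos[of x n]
        by (simp add: norm_divide pochhammer_of_real)
      ultimately have "norm (rGamma (complex_of_real x + of_nat n)) * Gamma x = 1 / pochhammer x n"
        by simp
      moreover have "M n = norm (pochhammer b n * pochhammer c n / fact n) *
          (norm (rGamma (complex_of_real x + of_nat n)) * Gamma x)"
        by (simp add: M_def gauss_term_def norm_mult norm_divide)
      ultimately show ?thesis by simp
    qed
    show ?thesis unfolding 1 2
      using norm_pochhammer_ge[OF re, of n] x pochhammer_pos[of x n]
      by (intro mult_left_mono divide_left_mono mult_pos_pos) (auto intro: order.strict_trans2)
  qed
  have lim: "(\<lambda>N. Gamma (e + of_nat N) * gauss_term b c (e + of_nat N) n) \<longlonglongrightarrow> (if n = 0 then 1 else 0)" for n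
  proof -
    have ev: "\<forall>\<^sub>F N in sequentially. pochhammer b n * pochhammer c n / fact n * (1 / pochhammer (e + of_nat N) n)
         = Gamma (e + of_nat N) * gauss_term b c (e + of_nat N) n"
    proof (rule eventually_mono[OF eventually_ge_at_top[of N0]])
      fix N assume N: "N \<ge> N0"
      hence re: "Re (e + of_nat N) > 0" using N x by (simp add: x_def)
      thus "pochhammer b n * pochhammer c n / fact n * (1 / pochhammer (e + of_nat N) n)
         = Gamma (e + of_nat N) * gauss_term b c (e + of_nat N) n"
        using Gamma_rGamma[OF re] by (simp add: gauss_term_def rGamma_eq_pochhammer_div[OF re])
    qed
    have "(\<lambda>N. 1 / pochhammer (e + of_nat N) n) \<longlonglongrightarrow> (if n = 0 then 1 else 0)"
    proof (cases n)
      case (Suc m)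
      have "(\<lambda>N. 1 / pochhammer (e + of_nat N) n) \<longlonglongrightarrow> 0"
      proof (rule Lim_null_comparison)
        \<comment> \<open>Only the first factor of (e + N)_n has to be large; the others are at
          least 1 in absolute value.\<close>
        have "norm (1 / pochhammer (e + of_nat N) n) \<le> 1 / (Re e + real N)" if "real N \<ge> 1 - Re e" for N
        proof -
          define y where "y = Re e + real N"
          have y: "y \<ge> 1" using that by (simp add: y_def)
          have "y * 1 \<le> y * pochhammer (y + 1) m"
          proof (rule mult_left_mono)
            have "pochhammer (y + 1) m \<ge> 1 ^ m"
            proof (induction m)
              case (Suc m)
              hence "1 * 1 \<le> pochhammer (y + 1) m * (y + 1 + real m)"
                using y by (intro mult_mono) auto
              thus ?case by (simp add: pochhammer_Suc)
            qed auto
            thus "1 \<le> pochhammer (y + 1) m" by simp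
          qed (use y in auto)
          also have "\<dots> = pochhammer y n" by (simp add: Suc pochhammer_rec)
          also have "\<dots> \<le> norm (pochhammer (e + of_nat N) n)"
            using y by (intro norm_pochhammer_ge) (auto simp: y_def)
          finally show ?thesis using y by (auto simp: norm_divide y_def[symmetric] intro!: divide_left_mono mult_pos_pos intro: less_le_trans[of 0 y])
        qed
        note bd1 = this
        show "\<forall>\<^sub>F N in sequentially. norm (1 / pochhammer (e + of_nat N) n) \<le> 1 / (Re e + real N)"
          by (intro eventually_mono[OF eventually_ge_at_top[of "nat \<lceil>1 - Re e\<rceil>"]] bd1) linarith
        show "(\<lambda>N. 1 / (Re e + real N)) \<longlonglongrightarrow> 0"
          by (rule tendsto_divide_0[OF tendsto_const filterlim_at_top_imp_at_infinity[OF
            filterlim_tendsto_add_at_top[OF tendsto_const filterlim_real_sequentially]]])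
      qed
      thus ?thesis by (simp add: Suc)
    qed auto
    hence "(\<lambda>N. pochhammer b n * pochhammer c n / fact n * (1 / pochhammer (e + of_nat N) n)) \<longlonglongrightarrow>
        pochhammer b n * pochhammer c n / fact n * (if n = 0 then 1 else 0)"
      by (intro tendsto_intros)
    also have "pochhammer b n * pochhammer c n / fact n * (if n = 0 then 1 else 0) = (if n = 0 then 1 else 0)" by auto
    finally show ?thesis by (rule Lim_transform_eventually[OF _ ev])
  qed
  have "\<forall>\<^sub>F (n, N) in at_top \<times>\<^sub>F sequentially. norm (Gamma (e + of_nat N) * gauss_term b c (e + of_nat N) n) \<le> M n"
    unfolding eventually_prod_filter using bd
    by (intro exI[of _ "\<lambda>_. True"] exI[of _ "\<lambda>N. N \<ge> N0"]) auto
  from tannerys_theorem[OF lim this sM]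
  have "(\<lambda>N. suminf (\<lambda>n. Gamma (e + of_nat N) * gauss_term b c (e + of_nat N) n)) \<longlonglongrightarrow> suminf (\<lambda>n. if n = 0 then 1 else 0 :: complex)"
    by simp
  also have "suminf (\<lambda>n. if n = 0 then 1 else 0 :: complex) = 1"
    using sums_single[of 0 "\<lambda>_. 1 :: complex"] by (simp add: sums_iff)
  finally have L: "(\<lambda>N. suminf (\<lambda>n. Gamma (e + of_nat N) * gauss_term b c (e + of_nat N) n)) \<longlonglongrightarrow> 1" .
  have ev: "\<forall>\<^sub>F N in sequentially. suminf (\<lambda>n. Gamma (e + of_nat N) * gauss_term b c (e + of_nat N) n) =
      Gamma (e + of_nat N) * suminf (gauss_term b c (e + of_nat N))"
  proof (rule eventually_mono[OF eventually_ge_at_top[of N0]])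
    fix N assume "N \<ge> N0"
    hence "Re (e + of_nat N) - Re b - Re c > 0" using x by (simp add: x_def)
    thus "suminf (\<lambda>n. Gamma (e + of_nat N) * gauss_term b c (e + of_nat N) n) =
      Gamma (e + of_nat N) * suminf (gauss_term b c (e + of_nat N))"
      by (intro suminf_mult summable_gauss_term) auto
  qed
  show ?thesis by (rule Lim_transform_eventually[OF L ev])
qed

theorem gauss_hypergeometric:
  assumes "Re (e - b - c) > 0"
  shows "suminf (gauss_term b c e) = Gamma (e - b - c) * rGamma (e - b) * rGamma (e - c)"
proof -
  have P: "pochhammer (e - b - c) N * suminf (gauss_term b c e) =
     pochhammer (e - b) N * pochhammer (e - c) N * suminf (gauss_term b c (e + of_nat N))" for N
  proof (induction N)
    case (Suc N)
    have "pochhammer (e - b - c) (Suc N) * suminf (gauss_term b c e) =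
      pochhammer (e - b) N * pochhammer (e - c) N * ((e + of_nat N - b - c) * suminf (gauss_term b c (e + of_nat N)))"
      using Suc by (simp add: pochhammer_Suc algebra_simps)
    also have "(e + of_nat N - b - c) * suminf (gauss_term b c (e + of_nat N)) =
       (e + of_nat N - b) * (e + of_nat N - c) * suminf (gauss_term b c (e + of_nat N + 1))"
      using assms by (intro gauss_step) auto
    finally show ?case by (simp add: pochhammer_Suc algebra_simps)
  qed simp
  \<comment> \<open>Each factor has a known limit, while the sequence itself is eventually constant:
    the exponents b and -b of the two powers cancel, and \<open>P\<close> undoes the shift.\<close>
  let ?x = "\<lambda>N. (pochhammer (e - b) N * rGamma (e + of_nat N) * npow (e - (e - b)) N) *
            (pochhammer (e - c) N * rGamma (e - b - c + of_nat N) * npow (e - b - c - (e - c)) N) *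
            (Gamma (e + of_nat N) * suminf (gauss_term b c (e + of_nat N)))"
  have "?x \<longlonglongrightarrow> rGamma (e - b) * rGamma (e - c) * 1"
    by (intro tendsto_mult pochhammer_rGamma_asymp gauss_limit)
  moreover have "\<forall>\<^sub>F N in sequentially. ?x N = suminf (gauss_term b c e) * rGamma (e - b - c)"
  proof -
    obtain N0 where N0: "real N0 > - Re e" using reals_Archimedean2 by blast
    show ?thesis
    proof (rule eventually_mono[OF eventually_ge_at_top[of N0]])
      fix N assume "N \<ge> N0"
      hence re: "Re (e + of_nat N) > 0" using N0 by simp
      have np: "npow (e - (e - b)) N * npow (e - b - c - (e - c)) N = 1" by (simp flip: npow_add)
      have "?x N
          = (npow (e - (e - b)) N * npow (e - b - c - (e - c)) N) * (Gamma (e + of_nat N) * rGamma (e + of_nat N)) *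
            (pochhammer (e - b) N * pochhammer (e - c) N * suminf (gauss_term b c (e + of_nat N))) * rGamma (e - b - c + of_nat N)"
        by (simp only: mult_ac)
      also have "\<dots> = suminf (gauss_term b c e) * (pochhammer (e - b - c) N * rGamma (e - b - c + of_nat N))"
        unfolding np Gamma_rGamma[OF re] P[symmetric] by (simp only: mult_ac mult_1_left)
      also have "\<dots> = suminf (gauss_term b c e) * rGamma (e - b - c)" by (simp only: pochhammer_rGamma[of "e - b - c" N, symmetric])
      finally show "?x N = suminf (gauss_term b c e) * rGamma (e - b - c)" .
    qed
  qed
  ultimately have "(\<lambda>N::nat. suminf (gauss_term b c e) * rGamma (e - b - c)) \<longlonglongrightarrow> rGamma (e - b) * rGamma (e - c)"
    by (simp add: tendsto_cong)
  hence "suminf (gauss_term b c e) * rGamma (e - b - c) = rGamma (e - b) * rGamma (e - c)"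
    by (simp add: LIMSEQ_const_iff)
  moreover have "suminf (gauss_term b c e) = Gamma (e - b - c) * (suminf (gauss_term b c e) * rGamma (e - b - c))"
    using Gamma_rGamma[OF assms] by (simp add: mult_ac)
  ultimately show ?thesis by (simp add: mult_ac)
qed

subsection \<open>The nonterminating Saalschuetz theorem\<close>

definition saal_term :: "complex \<Rightarrow> complex \<Rightarrow> complex \<Rightarrow> complex \<Rightarrow> complex \<Rightarrow> nat \<Rightarrow> complex" where
  "saal_term a b c d e n = pochhammer a n * pochhammer b n * pochhammer c n / fact n *
     rGamma (d + of_nat n) * rGamma (e + of_nat n)"

definition F32 where
  "F32 a b c d e = suminf (saal_term a b c d e)"

lemma F32_swap: "F32 a b c d e = F32 b a c d e"
  by (simp add: F32_def saal_term_def[abs_def] mult_ac)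

lemma summable_norm_saal_term:
  assumes "d + e = a + b + c + 1"
  shows "summable (\<lambda>n. norm (saal_term a b c d e n))"
proof (rule polybd_summable)
  have "polybd (\<lambda>n. (pochhammer a n / fact n) * ((pochhammer b n * rGamma (d + of_nat n)) * (pochhammer c n * rGamma (e + of_nat n))))
     (Re a - 1 + ((Re b - Re d) + (Re c - Re e)))"
    by (intro polybd_mult polybd_pochhammer polybd_pochhammer_rGamma)
  also have "Re a - 1 + ((Re b - Re d) + (Re c - Re e)) = - 2"
    using arg_cong[OF assms, of Re] by simp
  finally show "polybd (saal_term a b c d e) (- 2)"
    by (simp add: saal_term_def[abs_def] mult_ac)
qed auto

lemma summable_saal_term: "d + e = a + b + c + 1 \<Longrightarrow> summable (saal_term a b c d e)"
  by (rule summable_norm_cancel) (rule summable_norm_saal_term)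

text \<open>With excess 1 the terms decay like n^-2; the constant found here is the boundary value
  of the certificate in \<open>saal_contiguous\<close>.\<close>

lemma saal_term_asymp:
  assumes "d + e = a + b + c + 1"
  shows "(\<lambda>n. saal_term a b c d e n * of_nat n * (e - 1 + of_nat n)) \<longlonglongrightarrow> rGamma a * rGamma b * rGamma c"
proof -
  let ?x = "\<lambda>n. (pochhammer a n / fact n * npow (1 - a) n) * (pochhammer b n * rGamma (d + of_nat n) * npow (d - b) n)
        * (pochhammer c n * rGamma (e + of_nat n) * npow (e - c) n) * ((e - 1 + of_nat n) / of_nat n)"
  have "?x \<longlonglongrightarrow> rGamma a * rGamma b * rGamma c * 1"
    by (intro tendsto_mult pochhammer_asymp pochhammer_rGamma_asymp add_of_nat_over_of_nat_tendsto)
  moreover have "\<forall>\<^sub>F n in sequentially. ?x n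
      = saal_term a b c d e n * of_nat n * (e - 1 + of_nat n)"
  proof (rule eventually_mono[OF eventually_gt_at_top[of 0]])
    fix n :: nat assume n: "n > 0"
    have "npow (1 - a) n * npow (d - b) n * npow (e - c) n = npow ((1 - a) + (d - b) + (e - c)) n"
      by (simp only: npow_add)
    also have "(1 - a) + (d - b) + (e - c) = 1 + 1" using assms by algebra
    finally have np: "npow (1 - a) n * npow (d - b) n * npow (e - c) n = of_nat n * of_nat n"
      using n by (simp only: npow_add npow_1)
    have "?x n
      = saal_term a b c d e n * (npow (1 - a) n * npow (d - b) n * npow (e - c) n) * ((e - 1 + of_nat n) / of_nat n)"
      by (simp add: saal_term_def mult_ac)
    thus "?x n
      = saal_term a b c d e n * of_nat n * (e - 1 + of_nat n)"
      unfolding np using n by simp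
  qed
  ultimately show ?thesis by (simp only: mult_1_right Lim_transform_eventually)
qed

text \<open>The relation telescopes with certificate \<open>- n (e + n - 1)\<close>; because the excess is 1, the certificate
  has a nonzero limit, which is the right-hand side.\<close>

lemma saal_contiguous:
  assumes "d + e = a + b + c + 1"
  shows "a * (1 + a - e) * F32 a b c d e - a * (d - b) * (d - c) * F32 (a + 1) b c (d + 1) e =
     - (rGamma a * rGamma b * rGamma c)"
proof -
  define G where "G n = - (saal_term a b c d e n * of_nat n * (e - 1 + of_nat n))" for n
  have Gdiff: "G (Suc n) - G n = a * (1 + a - e) * saal_term a b c d e n -
      a * (d - b) * (d - c) * saal_term (a + 1) b c (d + 1) e n" for n
  proof -
    define m :: complex where "m = of_nat n"
    define u where "u = pochhammer a n * pochhammer b n * pochhammer c n / fact n"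
    define R where "R = rGamma (d + 1 + m)"
    define Q where "Q = rGamma (e + 1 + m)"
    have d: "rGamma (d + m) = (d + m) * R"
      using rGamma_plus1[of "d + m"] by (simp add: add_ac R_def)
    have e: "rGamma (e + m) = (e + m) * Q"
      using rGamma_plus1[of "e + m"] by (simp add: add_ac Q_def)
    have t: "saal_term a b c d e n = u * ((d + m) * R) * ((e + m) * Q)"
      by (simp add: saal_term_def u_def m_def[symmetric] d e)
    have S: "saal_term a b c d e (Suc n) * of_nat (Suc n) = u * (a + m) * (b + m) * (c + m) * R * Q"
    proof -
      have "of_nat (Suc n) = 1 + m" by (simp add: m_def)
      moreover from this have "1 + m \<noteq> 0" by (metis of_nat_neq_0)
      ultimately show ?thesis
        by (simp add: saal_term_def u_def pochhammer_Suc R_def Q_def add.assoc flip: m_def del: of_nat_Suc)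
    qed
    have "a * pochhammer (a + 1) n = pochhammer a n * (a + m)"
      by (metis m_def pochhammer_Suc pochhammer_rec)
    hence p: "a * saal_term (a + 1) b c (d + 1) e n = u * (a + m) * R * ((e + m) * Q)"
      by (simp add: saal_term_def u_def e R_def flip: m_def)
    have 1: "G (Suc n) = - (u * (a + m) * (b + m) * (c + m) * R * Q) * (e + m)"
      unfolding G_def S[symmetric] by (simp add: m_def)
    have "G (Suc n) - G n = u * R * Q * (e + m) * ((d + m) * m * (e - 1 + m) - (a + m) * (b + m) * (c + m))"
      unfolding 1 unfolding G_def t m_def[symmetric] by algebra
    \<comment> \<open>The cubic terms in m cancel, and because of the excess 1 so do the quadratic
      ones; hence a combination of d + m and a + m suffices.\<close>
    also have "(d + m) * m * (e - 1 + m) - (a + m) * (b + m) * (c + m) =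
       a * (1 + a - e) * (d + m) - (d - b) * (d - c) * (a + m)"
      using assms by algebra
    also have "u * R * Q * (e + m) * (a * (1 + a - e) * (d + m) - (d - b) * (d - c) * (a + m)) =
       a * (1 + a - e) * saal_term a b c d e n - (d - b) * (d - c) * (a * saal_term (a + 1) b c (d + 1) e n)"
      unfolding t p by algebra
    finally show ?thesis by (simp add: mult_ac)
  qed
  have "G \<longlonglongrightarrow> - (rGamma a * rGamma b * rGamma c)"
    unfolding G_def by (intro tendsto_minus saal_term_asymp assms)
  hence "(\<lambda>n. G (Suc n) - G n) sums (- (rGamma a * rGamma b * rGamma c) - G 0)" by (rule telescope_sums)
  moreover have "(\<lambda>n. G (Suc n) - G n) sums (a * (1 + a - e) * F32 a b c d e -
      a * (d - b) * (d - c) * F32 (a + 1) b c (d + 1) e)"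
    unfolding Gdiff F32_def
  proof (intro sums_diff sums_mult summable_sums summable_saal_term assms)
    show "d + 1 + e = a + 1 + b + c + 1" using assms by algebra
  qed
  ultimately show ?thesis by (auto simp: G_def dest: sums_unique2)
qed

text \<open>The two series are weighted so that the inhomogeneous terms of their contiguous
  relations coincide and cancel in the difference.\<close>

definition saal_pair where
  "saal_pair a b c d e = F32 a b c d e * (rGamma (1 + a - e) * rGamma (1 + b - e) * rGamma (1 + c - e)) -
     F32 (1 + a - e) (1 + b - e) (1 + c - e) (1 + d - e) (2 - e) * (rGamma a * rGamma b * rGamma c)"

lemma saal_pair_swap: "saal_pair a b c d e = saal_pair b a c d e"
  by (simp add: saal_pair_def F32_swap[of a b] F32_swap[of "1 + a - e" "1 + b - e"] mult_ac)

text \<open>The second series has the same Saalschuetzian form with 1 + a - e in the role of a, so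
  one shift of a and d moves both series. The relation comes out multiplied by a (1 + a - e), whence
  the two nonvanishing conditions.\<close>

lemma saal_pair_shift:
  assumes "d + e = a + b + c + 1" "a \<noteq> 0" "1 + a - e \<noteq> 0"
  shows "saal_pair a b c d e = (d - b) * (d - c) * saal_pair (a + 1) b c (d + 1) e"
proof -
  define E where "E = 1 + a - e"
  have W1: "a * E * F32 a b c d e - a * (d - b) * (d - c) * F32 (a + 1) b c (d + 1) e =
     - (rGamma a * rGamma b * rGamma c)" unfolding E_def by (rule saal_contiguous) fact
  have "(1 + d - e) + (2 - e) = E + (1 + b - e) + (1 + c - e) + 1" unfolding E_def using assms(1) by algebra
  from saal_contiguous[OF this]
  have W2: "E * a * F32 E (1 + b - e) (1 + c - e) (1 + d - e) (2 - e) -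
      E * (d - b) * (d - c) * F32 (E + 1) (1 + b - e) (1 + c - e) (1 + d - e + 1) (2 - e) =
     - (rGamma E * rGamma (1 + b - e) * rGamma (1 + c - e))" by (simp add: E_def)
  have r: "rGamma a = a * rGamma (a + 1)" "rGamma E = E * rGamma (E + 1)" by (simp_all add: rGamma_plus1)
  have e: "1 + (a + 1) - e = E + 1" "1 + (d + 1) - e = 1 + d - e + 1" by (simp_all add: E_def)
  have "a * E * (saal_pair a b c d e - (d - b) * (d - c) * saal_pair (a + 1) b c (d + 1) e) = 0"
    using W1 W2 unfolding saal_pair_def e E_def[symmetric] r by algebra
  thus ?thesis using assms by (simp add: E_def)
qed

lemma add_of_nat_ratio_tendsto:
  "(\<lambda>N. (z + of_nat N) / (w + of_nat N) :: complex) \<longlonglongrightarrow> 1"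
proof -
  have "(\<lambda>N. ((z + of_nat N) / of_nat N) / ((w + of_nat N) / of_nat N)) \<longlonglongrightarrow> 1 / 1"
    by (intro tendsto_divide add_of_nat_over_of_nat_tendsto) simp
  moreover have "\<forall>\<^sub>F N in sequentially. ((z + of_nat N) / of_nat N) / ((w + of_nat N) / of_nat N) = (z + of_nat N) / (w + of_nat N)"
    by (rule eventually_mono[OF eventually_gt_at_top[of 0]]) auto
  ultimately show ?thesis by (simp only: div_by_1 Lim_transform_eventually)
qed

lemma pochhammer_ratio_tendsto:
  "(\<lambda>N. pochhammer (z + of_nat N) n / pochhammer (w + of_nat N) n :: complex) \<longlonglongrightarrow> 1"
proof (induction n)
  case (Suc n)
  have "(\<lambda>N. (pochhammer (z + of_nat N) n / pochhammer (w + of_nat N) n) *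
      (((z + of_nat n) + of_nat N) / ((w + of_nat n) + of_nat N))) \<longlonglongrightarrow> 1 * 1"
    by (intro tendsto_mult Suc add_of_nat_ratio_tendsto)
  thus ?case by (simp add: pochhammer_Suc add_ac)
qed auto

text \<open>Shifting a and d together makes (a)_n / (d)_n tend to 1, which leaves the series of
  Gauss in b, c; e. Since e - b - c = 1 + a - d, the condition Re d \<le> Re a secures its
  convergence; it also makes the exponent r of the majorant nonnegative.\<close>

lemma F32_limit:
  assumes s: "d + e = a + b + c + 1" and pos: "Re a > 0" "Re d > 0" and le: "Re d \<le> Re a"
  shows "(\<lambda>N. Gamma (d + of_nat N) * F32 (a + of_nat N) b c (d + of_nat N) e) \<longlonglongrightarrow>
     Gamma (e - b - c) * rGamma (e - b) * rGamma (e - c)"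
proof -
  define r where "r = Re a - Re d"
  have r: "r \<ge> 0" using le by (simp add: r_def)
  obtain C1 where C1: "C1 \<ge> 0" "\<And>n. norm (pochhammer a n * rGamma (d + of_nat n)) \<le> C1 * (1 + real n) powr (Re a - Re d)"
    using polybdE[OF polybd_pochhammer_rGamma] by blast
  obtain C2 where C2: "C2 \<ge> 0" "\<And>n. norm (pochhammer d n * rGamma (a + of_nat n)) \<le> C2 * (1 + real n) powr (Re d - Re a)"
    using polybdE[OF polybd_pochhammer_rGamma] by blast
  define C where "C = C1 * C2 / norm (rGamma a * rGamma d)"
  have eq: "Gamma (d + of_nat N) * saal_term (a + of_nat N) b c (d + of_nat N) e n =
     pochhammer (a + of_nat N) n / pochhammer (d + of_nat N) n * gauss_term b c e n" for N n
  proof -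
    have "Re (d + of_nat N) > 0" using pos by simp
    from rGamma_eq_pochhammer_div[OF this, of n] Gamma_rGamma[OF this]
    have "Gamma (d + of_nat N) * rGamma (d + of_nat N + of_nat n) = 1 / pochhammer (d + of_nat N) n" by simp
    moreover have "Gamma (d + of_nat N) * saal_term (a + of_nat N) b c (d + of_nat N) e n =
      (Gamma (d + of_nat N) * rGamma (d + of_nat N + of_nat n)) * pochhammer (a + of_nat N) n * gauss_term b c e n"
      by (simp add: saal_term_def gauss_term_def mult_ac)
    ultimately show ?thesis by simp
  qed
  have ratio: "norm (pochhammer (a + of_nat N) n / pochhammer (d + of_nat N) n) \<le> C * (1 + real n) powr r" for N n
  proof -
    have nz: "rGamma a \<noteq> 0" "rGamma d \<noteq> 0" using Gamma_rGamma[OF pos(1)] Gamma_rGamma[OF pos(2)] by auto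
    have pnz: "pochhammer a N \<noteq> 0" "pochhammer d N \<noteq> 0"
      using norm_pochhammer_ge[of "Re a" a N] norm_pochhammer_ge[of "Re d" d N] pos pochhammer_pos[of "Re a" N] pochhammer_pos[of "Re d" N] by force+
    \<comment> \<open>The quotient at shift N is expressed by unshifted products at N + n and at N;
      their powers combine to ((1 + N + n) / (1 + N))^r \<le> (1 + n)^r, uniformly in N.\<close>
    have "(pochhammer a (N + n) * rGamma (d + of_nat (N + n))) * (pochhammer d N * rGamma (a + of_nat N)) =
       pochhammer (a + of_nat N) n / pochhammer (d + of_nat N) n * (rGamma a * rGamma d)"
      using pnz unfolding rGamma_eq_pochhammer_div[OF pos(1)] rGamma_eq_pochhammer_div[OF pos(2)] pochhammer_product'
      by simp
    hence "norm (pochhammer (a + of_nat N) n / pochhammer (d + of_nat N) n) =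
      norm (pochhammer a (N + n) * rGamma (d + of_nat (N + n))) * norm (pochhammer d N * rGamma (a + of_nat N)) / norm (rGamma a * rGamma d)"
      using nz by (metis (no_types, lifting) mult_eq_0_iff nonzero_eq_divide_eq norm_divide norm_mult)
    also have "\<dots> \<le> (C1 * (1 + real (N + n)) powr r) * (C2 * (1 + real N) powr (- r)) / norm (rGamma a * rGamma d)"
      using C1(1) C1(2)[of "N + n"] C2(1) C2(2)[of N]
      by (intro divide_right_mono mult_mono) (auto simp: r_def)
    also have "\<dots> = C * ((1 + real (N + n)) powr r * (1 + real N) powr (- r))" by (simp add: C_def)
    also have "(1 + real (N + n)) powr r * (1 + real N) powr (- r) = ((1 + real (N + n)) / (1 + real N)) powr r"
      by (subst powr_divide) (auto simp: powr_minus divide_inverse)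
    also have "C * \<dots> \<le> C * (1 + real n) powr r"
      using r C1(1) C2(1) by (intro mult_left_mono powr_mono2) (auto simp: C_def field_simps)
    finally show ?thesis .
  qed
  have C0: "C \<ge> 0" using C1 C2 by (simp add: C_def)
  have "polybd (\<lambda>n. of_real (C * (1 + real n) powr r) * gauss_term b c e n) (r + (Re (b + c - e) - 1))"
  proof (intro polybd_mult polybd_gauss_term)
    show "polybd (\<lambda>n. complex_of_real (C * (1 + real n) powr r)) r"
      unfolding polybd_def using C0 by (intro exI[of _ C]) (auto simp: norm_mult simp del: of_real_mult)
  qed
  moreover have "r + (Re (b + c - e) - 1) < - 1" using arg_cong[OF s, of Re] by (simp add: r_def)
  ultimately have sM: "summable (\<lambda>n. norm (of_real (C * (1 + real n) powr r) * gauss_term b c e n))"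
    by (rule polybd_summable)
  have lim: "(\<lambda>N. Gamma (d + of_nat N) * saal_term (a + of_nat N) b c (d + of_nat N) e n) \<longlonglongrightarrow> gauss_term b c e n" for n
    unfolding eq using tendsto_mult[OF pochhammer_ratio_tendsto tendsto_const] by fastforce
  have "\<forall>\<^sub>F (n, N) in at_top \<times>\<^sub>F sequentially. norm (Gamma (d + of_nat N) * saal_term (a + of_nat N) b c (d + of_nat N) e n)
     \<le> norm (of_real (C * (1 + real n) powr r) * gauss_term b c e n)"
  proof (rule always_eventually, safe)
    fix n N
    show "norm (Gamma (d + of_nat N) * saal_term (a + of_nat N) b c (d + of_nat N) e n)
     \<le> norm (of_real (C * (1 + real n) powr r) * gauss_term b c e n)"
      unfolding eq norm_mult[of _ "gauss_term b c e n"] using ratio[of N n] C0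
      by (intro mult_right_mono) (auto simp: norm_mult)
  qed
  from tannerys_theorem[OF lim this sM]
  have "(\<lambda>N. suminf (\<lambda>n. Gamma (d + of_nat N) * saal_term (a + of_nat N) b c (d + of_nat N) e n)) \<longlonglongrightarrow> suminf (gauss_term b c e)"
    by simp
  also have "(\<lambda>N. suminf (\<lambda>n. Gamma (d + of_nat N) * saal_term (a + of_nat N) b c (d + of_nat N) e n)) =
     (\<lambda>N. Gamma (d + of_nat N) * F32 (a + of_nat N) b c (d + of_nat N) e)"
    unfolding F32_def using s by (intro ext suminf_mult summable_saal_term) (simp add: algebra_simps)
  also have "suminf (gauss_term b c e) = Gamma (e - b - c) * rGamma (e - b) * rGamma (e - c)"
    using arg_cong[OF s, of Re] le by (intro gauss_hypergeometric) simp
  finally show ?thesis .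
qed

lemma rGamma_reflection_sinpi:
  assumes "z + w = 1"
  shows "rGamma z * rGamma w = sinpi z / of_real pi"
proof -
  have "w = 1 - z" using assms by (simp add: algebra_simps)
  thus ?thesis by (simp add: rGamma_reflection_complex sinpi_def)
qed

lemma sinpi_diff_diff: "sinpi (x - y) * sinpi (x - z) - sinpi y * sinpi z = sinpi x * sinpi (x - y - z)"
proof -
  define u v w where "u = of_real pi * x" "v = of_real pi * y" "w = of_real pi * z"
  have "sin (u - v) * sin (u - w) - sin v * sin w = sin u * sin (u - v - w)"
  proof -
    have "sin u * sin u + cos u * cos u = 1" using sin_cos_squared_add[of u] by (simp add: power2_eq_square)
    thus ?thesis unfolding sin_diff cos_diff by algebra
  qed
  thus ?thesis by (simp add: sinpi_def u_v_w_def ring_distribs)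
qed

definition saal_val :: "complex \<Rightarrow> complex \<Rightarrow> complex \<Rightarrow> complex \<Rightarrow> complex \<Rightarrow> complex" where
  "saal_val a b c d e = sinpi e / of_real pi * (rGamma (d - a) * rGamma (d - b) * rGamma (d - c))"

lemma saal_val_shift:
  "saal_val a b c d e = (d - b) * (d - c) * saal_val (a + 1) b c (d + 1) e"
proof -
  have "rGamma (d - b) = (d - b) * rGamma (d + 1 - b)" "rGamma (d - c) = (d - c) * rGamma (d + 1 - c)"
    using rGamma_plus1[of "d - b"] rGamma_plus1[of "d - c"] by (simp_all add: algebra_simps)
  thus ?thesis by (simp add: saal_val_def)
qed

text \<open>After N shifts both series have Gauss limits, and the accumulated Pochhammer factors are
  balanced by reciprocal Gammas. The resulting sequence is constant in N, so its limit is the pair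
  itself; \<open>sinpi_diff_diff\<close> merges the two limiting products.\<close>

lemma saalschuetz_pos:
  assumes s: "d + e = a + b + c + 1" and pos: "Re a > 0" "Re d > 0" "Re (1 + a - e) > 0" "Re (1 + d - e) > 0"
    and le: "Re d \<le> Re a"
  shows "saal_pair a b c d e = saal_val a b c d e"
proof -
  define E where "E = 1 + a - e"
  define D where "D = 1 + d - e"
  define b1 where "b1 = rGamma (1 + b - e) * rGamma (1 + c - e)"
  define b2 where "b2 = rGamma b * rGamma c"
  define K where "K = Gamma (e - b - c)"
  have P: "saal_pair a b c d e = pochhammer (d - b) N * pochhammer (d - c) N * saal_pair (a + of_nat N) b c (d + of_nat N) e" for N
  proof (induction N)
    case (Suc N)
    have "Re (a + of_nat N) > 0" "Re (1 + (a + of_nat N) - e) > 0" using pos by auto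
    hence nz: "a + of_nat N \<noteq> 0" "1 + (a + of_nat N) - e \<noteq> 0" by (metis less_irrefl zero_complex.sel(1))+
    have "(d + of_nat N) + e = (a + of_nat N) + b + c + 1" using s by algebra
    from saal_pair_shift[OF this nz]
    have "saal_pair (a + of_nat N) b c (d + of_nat N) e = (d - b + of_nat N) * (d - c + of_nat N) * saal_pair (a + of_nat (Suc N)) b c (d + of_nat (Suc N)) e"
      by (simp add: algebra_simps)
    thus ?case using Suc by (simp add: pochhammer_Suc mult_ac)
  qed simp
  have s': "D + (2 - e) = E + (1 + b - e) + (1 + c - e) + 1" unfolding D_def E_def using s by algebra
  have L1: "(\<lambda>N. Gamma (d + of_nat N) * F32 (a + of_nat N) b c (d + of_nat N) e) \<longlonglongrightarrow>
     K * rGamma (e - b) * rGamma (e - c)"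
    unfolding K_def by (rule F32_limit[OF s pos(1,2) le])
  have L2: "(\<lambda>N. Gamma (D + of_nat N) * F32 (E + of_nat N) (1 + b - e) (1 + c - e) (D + of_nat N) (2 - e)) \<longlonglongrightarrow>
     K * rGamma (1 - b) * rGamma (1 - c)"
    using F32_limit[OF s'] pos le by (simp add: K_def E_def D_def algebra_simps)
  let ?x = "\<lambda>N. (pochhammer (d - b) N * rGamma (d + of_nat N) * npow (d - (d - b)) N) *
      (pochhammer (d - c) N * rGamma (E + of_nat N) * npow (E - (d - c)) N) *
      (Gamma (d + of_nat N) * F32 (a + of_nat N) b c (d + of_nat N) e) * b1 -
      (pochhammer (d - b) N * rGamma (D + of_nat N) * npow (D - (d - b)) N) *
      (pochhammer (d - c) N * rGamma (a + of_nat N) * npow (a - (d - c)) N) *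
      (Gamma (D + of_nat N) * F32 (E + of_nat N) (1 + b - e) (1 + c - e) (D + of_nat N) (2 - e)) * b2"
  have A: "?x \<longlonglongrightarrow>
     rGamma (d - b) * rGamma (d - c) * (K * rGamma (e - b) * rGamma (e - c)) * b1 -
     rGamma (d - b) * rGamma (d - c) * (K * rGamma (1 - b) * rGamma (1 - c)) * b2"
    by (intro tendsto_diff tendsto_mult pochhammer_rGamma_asymp L1 L2 tendsto_const)
  have B: "?x N
      = saal_pair a b c d e" for N
  proof -
    have n1: "npow (d - (d - b)) N * npow (E - (d - c)) N = 1"
    proof -
      have "d - (d - b) + (E - (d - c)) = 0" unfolding E_def using s by algebra
      thus ?thesis by (simp flip: npow_add)
    qed
    have n2: "npow (D - (d - b)) N * npow (a - (d - c)) N = 1"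
    proof -
      have "D - (d - b) + (a - (d - c)) = 0" unfolding D_def using s by algebra
      thus ?thesis by (simp flip: npow_add)
    qed
    have g1: "Gamma (d + of_nat N) * rGamma (d + of_nat N) = 1" using pos by (intro Gamma_rGamma) auto
    have g2: "Gamma (D + of_nat N) * rGamma (D + of_nat N) = 1" using pos by (intro Gamma_rGamma) (auto simp: D_def)
    have "?x N = (npow (d - (d - b)) N * npow (E - (d - c)) N) * (Gamma (d + of_nat N) * rGamma (d + of_nat N)) *
         (pochhammer (d - b) N * pochhammer (d - c) N * (F32 (a + of_nat N) b c (d + of_nat N) e * (rGamma (E + of_nat N) * b1))) -
        (npow (D - (d - b)) N * npow (a - (d - c)) N) * (Gamma (D + of_nat N) * rGamma (D + of_nat N)) *
         (pochhammer (d - b) N * pochhammer (d - c) N * (F32 (E + of_nat N) (1 + b - e) (1 + c - e) (D + of_nat N) (2 - e) * (rGamma (a + of_nat N) * b2)))"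
      by (simp only: mult_ac)
    also have "\<dots> = pochhammer (d - b) N * pochhammer (d - c) N *
       (F32 (a + of_nat N) b c (d + of_nat N) e * (rGamma (E + of_nat N) * b1) -
        F32 (E + of_nat N) (1 + b - e) (1 + c - e) (D + of_nat N) (2 - e) * (rGamma (a + of_nat N) * b2))"
      unfolding n1 n2 g1 g2 by (simp add: right_diff_distrib)
    also have "F32 (a + of_nat N) b c (d + of_nat N) e * (rGamma (E + of_nat N) * b1) -
        F32 (E + of_nat N) (1 + b - e) (1 + c - e) (D + of_nat N) (2 - e) * (rGamma (a + of_nat N) * b2)
      = saal_pair (a + of_nat N) b c (d + of_nat N) e"
    proof -
      have e: "1 + (a + of_nat N) - e = E + of_nat N" "1 + (d + of_nat N) - e = D + of_nat N"
        by (simp_all add: E_def D_def)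
      show ?thesis unfolding saal_pair_def e by (simp add: b1_def b2_def mult_ac)
    qed
    finally show ?thesis by (simp only: P[of N, symmetric])
  qed
  have "saal_pair a b c d e = rGamma (d - b) * rGamma (d - c) * (K * rGamma (e - b) * rGamma (e - c)) * b1 -
     rGamma (d - b) * rGamma (d - c) * (K * rGamma (1 - b) * rGamma (1 - c)) * b2"
    using A unfolding B by (simp add: LIMSEQ_const_iff)
  also have "\<dots> = rGamma (d - b) * rGamma (d - c) * K *
     ((rGamma (e - b) * rGamma (1 + b - e)) * (rGamma (e - c) * rGamma (1 + c - e)) -
      (rGamma b * rGamma (1 - b)) * (rGamma c * rGamma (1 - c)))"
    unfolding b1_def b2_def by algebra
  also have "(rGamma (e - b) * rGamma (1 + b - e)) * (rGamma (e - c) * rGamma (1 + c - e)) -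
      (rGamma b * rGamma (1 - b)) * (rGamma c * rGamma (1 - c)) =
      (sinpi (e - b) * sinpi (e - c) - sinpi b * sinpi c) / of_real pi ^ 2"
    by (simp add: rGamma_reflection_sinpi power2_eq_square diff_divide_distrib)
  also have "\<dots> = sinpi e / of_real pi * (sinpi (e - b - c) / of_real pi)"
    by (simp add: sinpi_diff_diff power2_eq_square)
  also have "sinpi (e - b - c) / of_real pi = rGamma (e - b - c) * rGamma (d - a)"
    using s by (intro rGamma_reflection_sinpi[symmetric]) algebra
  also have "rGamma (d - b) * rGamma (d - c) * K * (sinpi e / of_real pi * (rGamma (e - b - c) * rGamma (d - a))) =
     (K * rGamma (e - b - c)) * saal_val a b c d e"
    by (simp add: saal_val_def mult_ac)
  also have "K * rGamma (e - b - c) = 1"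
    unfolding K_def using arg_cong[OF s, of Re] le by (intro Gamma_rGamma) simp
  finally show ?thesis by simp
qed

lemma not_nonpos_Int_add_of_nat: "z \<notin> \<int>\<^sub>\<le>\<^sub>0 \<Longrightarrow> z + of_nat n \<noteq> (0::complex)"
  using nonpos_IntsI[of "- int n"] by (auto simp: add_eq_0_iff2)

text \<open>Both sides obey the same recurrence under a joint shift of a and d, so these may be
  moved to the right until \<open>saalschuetz_pos\<close> applies; Re (a - d) does not change on the
  way.\<close>

lemma saalschuetz_le:
  assumes s: "d + e = a + b + c + 1" and a: "a \<notin> \<int>\<^sub>\<le>\<^sub>0" and ae: "1 + a - e \<notin> \<int>\<^sub>\<le>\<^sub>0" and le: "Re d \<le> Re a"
  shows "saal_pair a b c d e = saal_val a b c d e"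
proof -
  obtain N where N: "real N > Max {- Re a, - Re d, - Re (1 + a - e), - Re (1 + d - e)}"
    using reals_Archimedean2 by blast
  have "saal_pair a b c d e = saal_val a b c d e" if "Re a + real m > 0" "Re d + real m > 0" "Re (1 + a - e) + real m > 0" "Re (1 + d - e) + real m > 0" for m
    using that s a ae le
  proof (induction m arbitrary: a d)
    case 0
    thus ?case by (intro saalschuetz_pos) auto
  next
    case (Suc m)
    have "a \<noteq> 0" "1 + a - e \<noteq> 0"
      using not_nonpos_Int_add_of_nat[OF Suc.prems(6), of 0] not_nonpos_Int_add_of_nat[OF Suc.prems(7), of 0] by auto
    moreover have "a + 1 \<notin> \<int>\<^sub>\<le>\<^sub>0" "1 + (a + 1) - e \<notin> \<int>\<^sub>\<le>\<^sub>0"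
      using Suc.prems(6,7) plus_one_in_nonpos_Ints_imp[of a] plus_one_in_nonpos_Ints_imp[of "1 + a - e"] by (auto simp: algebra_simps)
    moreover have "saal_pair (a + 1) b c (d + 1) e = saal_val (a + 1) b c (d + 1) e"
      using Suc.prems calculation(3,4) by (intro Suc.IH) (auto simp: algebra_simps)
    ultimately show ?case
      using saal_pair_shift[OF Suc.prems(5)] saal_val_shift[of a b c d e] by simp
  qed
  from this[of N] N show ?thesis by auto
qed

text \<open>Shifting \<open>b\<close> and \<open>d\<close> down together leaves \<open>d + e - a - b - c\<close> unchanged and makes \<open>Re (d - a)\<close> as
  small as required by \<open>saalschuetz_le\<close>.\<close>

theorem nonterminating_saalschuetz:
  assumes s: "d + e = a + b + c + 1" and a: "a \<notin> \<int>" and ae: "a - e \<notin> \<int>"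
    and b: "b \<notin> \<int>" and be: "b - e \<notin> \<int>" and da: "d - a \<notin> \<int>" and dc: "d - c \<notin> \<int>"
  shows "saal_pair a b c d e = saal_val a b c d e"
proof -
  have ae': "1 + a - e \<notin> \<int>" using ae Ints_diff[of "1 + a - e" 1] by (auto simp: algebra_simps)
  have "saal_pair a b c d e = saal_val a b c d e" if "Re d \<le> Re a + real m" for m
    using that s b be da dc
  proof (induction m arbitrary: b d)
    case 0
    thus ?case using a ae' nonpos_Ints_subset_Ints by (intro saalschuetz_le) auto
  next
    case (Suc m)
    have i: "x - 1 \<notin> \<int>" if "x \<notin> \<int>" for x :: complex
      using that Ints_add[of "x - 1" 1] by auto
    have IH: "saal_pair a (b - 1) c (d - 1) e = saal_val a (b - 1) c (d - 1) e"
    proof (rule Suc.IH)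
      show "d - 1 + e = a + (b - 1) + c + 1" using Suc.prems(2) by algebra
      show "b - 1 \<notin> \<int>" "b - 1 - e \<notin> \<int>" "d - 1 - a \<notin> \<int>" "d - 1 - c \<notin> \<int>"
        using i[OF Suc.prems(3)] i[OF Suc.prems(4)] i[OF Suc.prems(5)] i[OF Suc.prems(6)] by (simp_all add: algebra_simps)
    qed (use Suc.prems(1) in auto)
    have nz: "b - 1 \<noteq> 0" "1 + (b - 1) - e \<noteq> 0" "d - 1 - a \<noteq> 0" "d - 1 - c \<noteq> 0"
      using Suc.prems(3-6) by (auto simp: algebra_simps)
    have s': "(d - 1) + e = (b - 1) + a + c + 1" using Suc.prems(2) by algebra
    \<comment> \<open>Here b takes the role of a in the shift, which the symmetry of the pair
      permits.\<close>
    have "(d - 1 - a) * (d - 1 - c) * saal_pair a b c d e = saal_pair a (b - 1) c (d - 1) e"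
      using saal_pair_shift[OF s' nz(1,2)] by (simp add: saal_pair_swap[of a])
    also have "\<dots> = (d - 1 - a) * (d - 1 - c) * saal_val a b c d e"
      unfolding IH using saal_val_shift[of "b - 1" a c "d - 1" e] by (simp add: saal_val_def mult_ac)
    finally show ?case using nz by simp
  qed
  moreover obtain m where "Re d - Re a < real m" using reals_Archimedean2 by blast
  ultimately show ?thesis by (metis add.commute less_diff_eq less_le diff_less_eq)
qed

text \<open>The majorant is a product, so the family is absolutely summable over all pairs; rows,
  columns and diagonals are three ways of summing it. The diagonals serve the Cauchy product in
  \<open>F43_star\<close>, the columns the exchange of indices in
  \<open>starX_reflect\<close>.\<close>

lemma dominated_double_sum:
  fixes u :: "nat \<Rightarrow> nat \<Rightarrow> complex"
  assumes bd: "\<And>k m. norm (u k m) \<le> p k * q m"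
    and p: "summable p" "\<And>k. p k \<ge> 0" and q: "summable q" "\<And>m. q m \<ge> 0"
  obtains S where "(\<lambda>k. \<Sum>m. u k m) sums S" "(\<lambda>m. \<Sum>k. u k m) sums S"
    "(\<lambda>n. \<Sum>k\<le>n. u k (n - k)) sums S"
proof -
  define f where "f = (\<lambda>(k, m). u k m)"
  have hs: "(r has_sum suminf r) UNIV" if "summable r" "\<And>k. r k \<ge> 0" for r :: "nat \<Rightarrow> real"
    using that by (intro norm_summable_imp_has_sum) (auto intro: summable_sums)
  have "(\<lambda>(k, m). p k * q m) summable_on UNIV \<times> UNIV"
  proof (rule summable_on_SigmaI)
    show "((\<lambda>y. case (k, y) of (k, m) \<Rightarrow> p k * q m) has_sum p k * suminf q) UNIV" for k
      using has_sum_cmult_right[OF hs[OF q], of "p k"] by simp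
    show "(\<lambda>k. p k * suminf q) summable_on UNIV"
      using has_sum_cmult_left[OF hs[OF p]] unfolding summable_on_def by blast
  qed (use p q in auto)
  hence "(\<lambda>x. norm (f x)) summable_on UNIV \<times> UNIV"
    by (rule Infinite_Sum.abs_summable_on_comparison_test') (use bd in \<open>auto simp: f_def\<close>)
  hence "f summable_on UNIV \<times> UNIV" by (rule abs_summable_summable)
  then obtain S where S: "(f has_sum S) (UNIV \<times> UNIV)" unfolding summable_on_def by blast
  have S': "((\<lambda>(x, y). f (y, x)) has_sum S) (UNIV \<times> UNIV)" using S by (subst (asm) has_sum_swap) simp
  have n1: "summable (\<lambda>m. norm (u k m))" for k
    by (rule summable_comparison_test'[OF summable_mult[OF q(1), of "p k"], of 0]) (use bd in auto)
  have n2: "summable (\<lambda>k. norm (u k m))" for m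
    by (rule summable_comparison_test'[OF summable_mult2[OF p(1), of "q m"], of 0]) (use bd in auto)
  have "((\<lambda>k. \<Sum>m. u k m) has_sum S) UNIV"
  proof (rule has_sum_SigmaD[OF S])
    show "((\<lambda>y. f (k, y)) has_sum (\<Sum>m. u k m)) UNIV" for k
      unfolding f_def using n1[of k] by (intro norm_summable_imp_has_sum) (auto intro!: summable_sums summable_norm_cancel)
  qed
  moreover have "((\<lambda>m. \<Sum>k. u k m) has_sum S) UNIV"
  proof (rule has_sum_SigmaD[OF S'])
    show "((\<lambda>y. case (m, y) of (x, y) \<Rightarrow> f (y, x)) has_sum (\<Sum>k. u k m)) UNIV" for m
      unfolding f_def using n2[of m] by (auto intro!: norm_summable_imp_has_sum summable_sums summable_norm_cancel)
  qed
  moreover have "((\<lambda>n. \<Sum>k\<le>n. u k (n - k)) has_sum S) UNIV"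
  proof (rule has_sum_SigmaD)
    have "bij_betw (\<lambda>(n, k). (k, n - k)) (SIGMA n:UNIV. {..n}) (UNIV \<times> (UNIV :: nat set))"
      by (rule bij_betwI[of _ _ _ "\<lambda>(k, m). (k + m, k)"]) auto
    from has_sum_reindex_bij_betw[OF this, of f S] S
    show "((\<lambda>(n, k). u k (n - k)) has_sum S) (SIGMA n:UNIV. {..n})"
      by (simp add: f_def case_prod_unfold)
    show "((\<lambda>k. case (n, k) of (n, k) \<Rightarrow> u k (n - k)) has_sum (\<Sum>k\<le>n. u k (n - k))) {..n}" for n
      by simp
  qed
  ultimately show ?thesis using that has_sum_imp_sums by blast
qed

section \<open>Regularised Saalschuetzian 4F3 series\<close>

definition hyp_term :: "complex \<Rightarrow> complex \<Rightarrow> complex \<Rightarrow> complex \<Rightarrow> complex \<Rightarrow> complex \<Rightarrow> complex \<Rightarrow> nat \<Rightarrow> complex" where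
  "hyp_term a b c d e f g n = pochhammer a n * pochhammer b n * pochhammer c n * pochhammer d n / fact n *
     (rGamma (e + of_nat n) * rGamma (f + of_nat n) * rGamma (g + of_nat n))"

definition F43 where
  "F43 a b c d e f g = suminf (hyp_term a b c d e f g)"

lemma summable_hyp_term:
  assumes "e + f + g = a + b + c + d + 1"
  shows "summable (hyp_term a b c d e f g)"
proof (rule summable_norm_cancel, rule polybd_summable)
  have "polybd (\<lambda>n. (pochhammer a n / fact n) * ((pochhammer b n * rGamma (e + of_nat n)) *
     ((pochhammer c n * rGamma (f + of_nat n)) * (pochhammer d n * rGamma (g + of_nat n)))))
     (Re a - 1 + ((Re b - Re e) + ((Re c - Re f) + (Re d - Re g))))"
    by (intro polybd_mult polybd_pochhammer polybd_pochhammer_rGamma)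
  also have "Re a - 1 + ((Re b - Re e) + ((Re c - Re f) + (Re d - Re g))) = - 2"
    using arg_cong[OF assms, of Re] by simp
  finally show "polybd (hyp_term a b c d e f g) (- 2)"
    by (simp add: hyp_term_def[abs_def] mult_ac)
qed auto

subsection \<open>Euler's transformation in terms of coefficients\<close>

text \<open>Compare coefficients in 2F1(a,b;f;z) = (1-z)^-\<nu> 2F1(f-a,f-b;f;z) and multiply by
  (f)_n: the quotient (f)_n / (f)_k becomes a Pochhammer symbol at f + k, so no value of f is
  exceptional. The identity is the terminating Saalschuetz sum.\<close>

lemma euler_coefficient:
  fixes a b f :: complex
  defines "\<nu> \<equiv> a + b - f"
  shows "(\<Sum>k\<le>n. pochhammer \<nu> (n - k) / fact (n - k) * (pochhammer (f - a) k * pochhammer (f - b) k / fact k) *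
             pochhammer (f + of_nat k) (n - k)) = pochhammer a n * pochhammer b n / fact n"
proof (induction n)
  case (Suc n)
  define x where "x j = pochhammer \<nu> j / fact j" for j
  define A where "A k = pochhammer (f - a) k * pochhammer (f - b) k / fact k" for k
  \<comment> \<open>Certificate for the recurrence (n+1) S(n+1) = (a+n)(b+n) S(n); its factor k
    makes it vanish at k = 0.\<close>
  define G where "G k = - (A k * of_nat k * x (Suc n - k) * (f + of_nat k - 1) * pochhammer (f + of_nat k) (n - k))" for k
  define S where "S n = (\<Sum>k\<le>n. x (n - k) * A k * pochhammer (f + of_nat k) (n - k))" for n
  have x_Suc: "x (Suc j) * of_nat (Suc j) = x j * (\<nu> + of_nat j)" for j
    by (simp add: x_def pochhammer_Suc del: of_nat_Suc)
  have A_Suc: "A (Suc k) * of_nat (Suc k) = A k * (f - a + of_nat k) * (f - b + of_nat k)" for k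
    by (simp add: A_def pochhammer_Suc del: of_nat_Suc)
  \<comment> \<open>At k = n the difference \<open>n - Suc k\<close> would be truncated, so the
    telescoping is stated for k < n, and \<open>last\<close> treats the terms k = n and k = n + 1
    together.\<close>
  have step: "of_nat (Suc n) * (x (Suc n - k) * A k * pochhammer (f + of_nat k) (Suc n - k)) -
      (a + of_nat n) * (b + of_nat n) * (x (n - k) * A k * pochhammer (f + of_nat k) (n - k)) = G (Suc k) - G k"
    if k: "k < n" for k
  proof -
    define i where "i = n - Suc k"
    have n: "n = k + Suc i" using k by (simp add: i_def)
    define K I :: complex where "K = of_nat k" and "I = of_nat i"
    define P where "P = pochhammer (f + 1 + K) i"
    define y where "y = x (Suc i)"
    have p1: "pochhammer (f + K) (Suc i) = (f + K) * P"
      by (simp add: pochhammer_rec P_def add_ac)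
    have p2: "pochhammer (f + K) (Suc (Suc i)) = (f + K) * P * (f + K + I + 1)"
      unfolding pochhammer_Suc[of _ "Suc i"] p1 by (simp add: I_def K_def add_ac)
    have p3: "pochhammer (f + of_nat (Suc k)) i = P" by (simp add: P_def K_def add_ac)
    have x1: "x (Suc (Suc i)) * (I + 2) = y * (\<nu> + I + 1)"
      using x_Suc[of "Suc i"] by (simp add: I_def y_def add_ac)
    have A1: "A (Suc k) * (K + 1) = A k * (f - a + K) * (f - b + K)"
      using A_Suc[of k] by (simp add: K_def add_ac)
    have "I + 2 = of_nat (Suc (Suc i))" by (simp add: I_def)
    hence "I + 2 \<noteq> 0" by (simp only: of_nat_neq_0 not_False_eq_True)
    have nn: "of_nat n = K + I + 1" by (simp add: n K_def I_def)
    have "of_nat (Suc n) * (x (Suc n - k) * A k * pochhammer (f + of_nat k) (Suc n - k)) -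
      (a + of_nat n) * (b + of_nat n) * (x (n - k) * A k * pochhammer (f + of_nat k) (n - k)) - (G (Suc k) - G k) =
      (K + I + 2) * (x (Suc (Suc i)) * A k * ((f + K) * P * (f + K + I + 1))) -
      (a + (K + I + 1)) * (b + (K + I + 1)) * (y * A k * ((f + K) * P)) +
      (A (Suc k) * (K + 1)) * y * (f + K) * P - A k * K * x (Suc (Suc i)) * (f + K - 1) * ((f + K) * P)"
    proof -
      have e: "Suc n - k = Suc (Suc i)" "n - k = Suc i" "Suc n - Suc k = Suc i" "n - Suc k = i"
        "of_nat (Suc n) = K + I + 2" "of_nat (Suc k) = K + 1"
        by (simp_all add: n K_def I_def)
      have Gs: "G (Suc k) = - ((A (Suc k) * (K + 1)) * y * (f + K) * P)"
        unfolding G_def e p3 by (simp add: y_def P_def add_ac e(6))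
      have Gk: "G k = - (A k * K * x (Suc (Suc i)) * (f + K - 1) * ((f + K) * P))"
        unfolding G_def e K_def[symmetric] p1 by simp
      show ?thesis
        unfolding Gs Gk e K_def[symmetric] p1 p2 nn y_def[symmetric] by algebra
    qed
    also have "\<dots> = 0"
    proof -
      \<comment> \<open>The recurrence for x gives only the product of the next value with I + 2, so
        the identity is checked after multiplying by it.\<close>
      have "(I + 2) * ((K + I + 2) * (x (Suc (Suc i)) * A k * ((f + K) * P * (f + K + I + 1))) -
      (a + (K + I + 1)) * (b + (K + I + 1)) * (y * A k * ((f + K) * P)) +
      (A (Suc k) * (K + 1)) * y * (f + K) * P - A k * K * x (Suc (Suc i)) * (f + K - 1) * ((f + K) * P)) = 0"
        using x1 unfolding A1 \<nu>_def by algebra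
      thus ?thesis using \<open>I + 2 \<noteq> 0\<close> by simp
    qed
    finally show ?thesis by simp
  qed
  have last: "of_nat (Suc n) * (x (Suc n - n) * A n * pochhammer (f + of_nat n) (Suc n - n)) -
      (a + of_nat n) * (b + of_nat n) * (x (n - n) * A n * pochhammer (f + of_nat n) (n - n)) +
      of_nat (Suc n) * A (Suc n) = - G n"
    unfolding mult.commute[of "of_nat (Suc n)" "A (Suc n)"] A_Suc
    by (simp add: G_def x_def \<nu>_def algebra_simps)
  have "of_nat (Suc n) * S (Suc n) - (a + of_nat n) * (b + of_nat n) * S n =
     (\<Sum>k\<le>n. of_nat (Suc n) * (x (Suc n - k) * A k * pochhammer (f + of_nat k) (Suc n - k)) -
      (a + of_nat n) * (b + of_nat n) * (x (n - k) * A k * pochhammer (f + of_nat k) (n - k))) + of_nat (Suc n) * A (Suc n)"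
    unfolding S_def by (simp add: sum_subtractf sum_distrib_left ring_distribs x_def del: of_nat_Suc)
  also have "\<dots> = (\<Sum>k<n. G (Suc k) - G k) - G n"
    using last step unfolding lessThan_Suc_atMost[symmetric] sum.lessThan_Suc by (simp add: add.assoc)
  also have "\<dots> = 0" unfolding sum_lessThan_telescope by (simp add: G_def)
  finally have "of_nat (Suc n) * S (Suc n) = (a + of_nat n) * (b + of_nat n) * S n" by simp
  also have "S n = pochhammer a n * pochhammer b n / fact n" using Suc by (simp add: S_def x_def A_def)
  finally have "S (Suc n) = pochhammer a (Suc n) * pochhammer b (Suc n) / fact (Suc n)"
    by (simp add: pochhammer_Suc field_simps del: of_nat_Suc)
  thus ?case by (simp add: S_def x_def A_def)
qed simp

definition star_term :: "complex \<Rightarrow> complex \<Rightarrow> complex \<Rightarrow> nat \<Rightarrow> complex" where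
  "star_term p q f k = pochhammer p k * pochhammer q k / fact k * rGamma (f + of_nat k)"

text \<open>The factor \<open>rGamma (f + n)\<close> absorbs the Pochhammer symbol at f + k and
  leaves \<open>rGamma (f + k)\<close>. Apart from k, only n - k remains, so the right-hand side is
  a Cauchy product.\<close>

lemma star_term_expand:
  assumes "\<nu> = a + b - f"
  shows "pochhammer a n * pochhammer b n / fact n * rGamma (f + of_nat n) =
    (\<Sum>k\<le>n. pochhammer \<nu> (n - k) / fact (n - k) * star_term (f - a) (f - b) f k)"
proof -
  have "pochhammer a n * pochhammer b n / fact n * rGamma (f + of_nat n) =
    (\<Sum>k\<le>n. pochhammer \<nu> (n - k) / fact (n - k) * (pochhammer (f - a) k * pochhammer (f - b) k / fact k) *
             (pochhammer (f + of_nat k) (n - k) * rGamma (f + of_nat n)))"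
    unfolding euler_coefficient[of a b f n, symmetric] assms sum_distrib_right by (simp add: mult_ac)
  also have "\<dots> = (\<Sum>k\<le>n. pochhammer \<nu> (n - k) / fact (n - k) * star_term (f - a) (f - b) f k)"
  proof (rule sum.cong)
    fix k assume "k \<in> {..n}"
    hence "f + of_nat n = f + of_nat k + of_nat (n - k)" by (simp add: add.assoc flip: of_nat_add)
    hence "pochhammer (f + of_nat k) (n - k) * rGamma (f + of_nat n) = rGamma (f + of_nat k)"
      using pochhammer_rGamma[of "f + of_nat k" "n - k"] by (simp only:)
    thus "pochhammer \<nu> (n - k) / fact (n - k) * (pochhammer (f - a) k * pochhammer (f - b) k / fact k) *
             (pochhammer (f + of_nat k) (n - k) * rGamma (f + of_nat n)) = pochhammer \<nu> (n - k) / fact (n - k) * star_term (f - a) (f - b) f k"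
      by (simp add: star_term_def)
  qed simp
  finally show ?thesis .
qed

lemma polybd_star_term: "polybd (star_term p q f) (Re (p + q - f) - 1)"
proof -
  have "polybd (\<lambda>n. pochhammer p n / fact n * (pochhammer q n * rGamma (f + of_nat n))) (Re p - 1 + (Re q - Re f))"
    by (intro polybd_mult polybd_pochhammer polybd_pochhammer_rGamma)
  thus ?thesis by (simp add: star_term_def[abs_def] algebra_simps)
qed

section \<open>Zeros and shifts of the sine, and parameters off the integers\<close>

lemma sinpi_eq_0_iff: "sinpi z = 0 \<longleftrightarrow> z \<in> \<int>"
proof
  assume "sinpi z = 0"
  then obtain n :: int where "of_real pi * z = of_real (of_int n * pi)"
    by (auto simp: sinpi_def sin_eq_0)
  hence "z = of_int n" by (simp add: field_simps)
  thus "z \<in> \<int>" by simp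
next
  assume "z \<in> \<int>"
  then obtain n :: int where "z = of_int n" by (auto elim: Ints_cases)
  thus "sinpi z = 0" by (auto simp: sinpi_def sin_eq_0 intro!: exI[of _ n])
qed

lemma sinpi_add_Ints: "j \<in> \<int> \<Longrightarrow> sinpi (z + j) = sinpi z * cos (of_real pi * j)"
  using sinpi_eq_0_iff[of j] by (simp add: sinpi_def ring_distribs sin_add)

lemma sinpi_add_of_nat: "sinpi (z + of_nat n) = (-1) ^ n * sinpi z"
proof (induction n)
  case (Suc n)
  have "sinpi ((z + of_nat n) + 1) = - sinpi (z + of_nat n)"
    using sinpi_add_Ints[of 1 "z + of_nat n"] by (simp flip: cos_of_real)
  thus ?case using Suc by (simp add: add_ac)
qed simp

lemma sinpi_minus: "sinpi (- z) = - sinpi z"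
  by (simp add: sinpi_def)

lemma not_Ints_shift: "z \<notin> \<int> \<Longrightarrow> n \<in> \<int> \<Longrightarrow> z + n \<notin> \<int>" for z :: complex
  using Ints_diff[of "z + n" n] by auto

lemma not_Ints_flip: "z \<notin> \<int> \<Longrightarrow> n \<in> \<int> \<Longrightarrow> n - z \<notin> \<int>" for z :: complex
  using Ints_diff[of n "n - z"] by auto

lemma not_Ints_nonpos: "z \<notin> \<int> \<Longrightarrow> z \<notin> \<int>\<^sub>\<le>\<^sub>0" for z :: complex
  using nonpos_Ints_subset_Ints by blast

lemma Gamma_rGamma': "z \<notin> \<int> \<Longrightarrow> Gamma z * rGamma z = (1::complex)"
  by (simp add: rGamma_inverse_Gamma Gamma_eq_zero_iff not_Ints_nonpos)

text \<open>The Gamma quotient that remains of the second Saalschuetz series when its parameters are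
  shifted by k. The difference m - k is formed in the complex numbers because it may be
  negative.\<close>

definition star_kernel :: "complex \<Rightarrow> complex \<Rightarrow> nat \<Rightarrow> nat \<Rightarrow> complex" where
  "star_kernel u w k m = Gamma (u + (of_nat m - of_nat k)) * rGamma (w + (of_nat m - of_nat k))"

text \<open>Reflecting both Gammas turns m - k into k - m, and the signs (-1)^(m-k) of the two sines
  cancel. This lets the summation indices of \<open>starX\<close> change roles.\<close>

lemma star_kernel_reflect:
  assumes "u \<notin> \<int>" "w \<notin> \<int>"
  shows "sinpi w * star_kernel (1 - w) (1 - u) m k = sinpi u * star_kernel u w k m"
proof -
  define j :: complex where "j = of_nat m - of_nat k"
  have j: "j \<in> \<int>" by (simp add: j_def)
  define C where "C = cos (of_real pi * j)"
  have j': "of_nat k - of_nat m = - j" by (simp add: j_def)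
  have u: "u + j \<notin> \<int>" "1 - w - j \<notin> \<int>"
    using not_Ints_shift[OF assms(1) j] not_Ints_flip[OF not_Ints_shift[OF assms(2) j], of 1] by (simp_all add: algebra_simps)
  have 1: "rGamma (u + j) * rGamma (1 - u - j) = sinpi u * C / of_real pi"
    using rGamma_reflection_sinpi[of "u + j" "1 - u - j"] by (simp add: sinpi_add_Ints j C_def)
  have 2: "rGamma (w + j) * rGamma (1 - w - j) = sinpi w * C / of_real pi"
    using rGamma_reflection_sinpi[of "w + j" "1 - w - j"] by (simp add: sinpi_add_Ints j C_def)
  have "C \<noteq> 0"
    using sinpi_add_Ints[OF j, of u] sinpi_eq_0_iff[of "u + j"] u(1) by (auto simp: C_def)
  have "rGamma (1 - u - j) = sinpi u * C / of_real pi * Gamma (u + j)"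
    using 1 Gamma_rGamma'[OF u(1)] by algebra
  moreover have "rGamma (w + j) = sinpi w * C / of_real pi * Gamma (1 - w - j)"
    using 2 Gamma_rGamma'[OF u(2)] by algebra
  ultimately show ?thesis
    unfolding star_kernel_def j' j_def[symmetric] by (simp add: mult_ac)
qed

lemma pochhammer_reflect: "pochhammer (z - of_nat i) i = (-1) ^ i * pochhammer (1 - z) i" for z :: complex
  using pochhammer_minus[of "z - 1" i] by (simp add: field_simps flip: power_mult_distrib)

text \<open>On either side of k = m the kernel is a Pochhammer symbol times a reciprocal Gamma, of
  order Re u - Re w in |m - k|; for m < k this takes a reflection. The maximum with 0 makes the
  exponent nonnegative, so that 1 + |m - k| \<le> (1 + k)(1 + m) splits the bound into a
  product.\<close>

lemma star_kernel_bound: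
  assumes u: "u \<notin> \<int>" and r: "r = max 0 (Re u - Re w)"
  obtains C where "C \<ge> 0" "\<And>k m. norm (star_kernel u w k m) \<le> C * ((1 + real k) powr r * (1 + real m) powr r)"
proof -
  obtain C1 where C1: "C1 \<ge> 0" "\<And>n. norm (Gamma u * (pochhammer u n * rGamma (w + of_nat n))) \<le> C1 * (1 + real n) powr (Re u - Re w)"
    using polybdE[OF polybd_cmult[OF polybd_pochhammer_rGamma, of "Gamma u" u w]] by auto
  obtain C2 where C2: "C2 \<ge> 0" "\<And>n. norm (Gamma u * Gamma (1 - u) * rGamma w * (pochhammer (1 - w) n * rGamma (1 - u + of_nat n))) \<le> C2 * (1 + real n) powr (Re (1 - w) - Re (1 - u))"
    by (rule polybdE[OF polybd_cmult[OF polybd_pochhammer_rGamma, of "Gamma u * Gamma (1 - u) * rGamma w" "1 - w" "1 - u"]]) auto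
  have pw: "C * (1 + real n) powr (Re u - Re w) \<le> (C1 + C2) * ((1 + real k) powr r * (1 + real m) powr r)"
    if "C \<le> C1 + C2" "C \<ge> 0" "n \<le> k + m" for C n k m
  proof -
    have "1 + real n \<le> 1 + real k + real m" using that by linarith
    also have "\<dots> \<le> (1 + real k) * (1 + real m)" by (simp add: algebra_simps)
    finally have *: "1 + real n \<le> (1 + real k) * (1 + real m)" .
    have "(1 + real n) powr (Re u - Re w) \<le> (1 + real n) powr r"
      by (intro powr_mono) (auto simp: r)
    also have "\<dots> \<le> ((1 + real k) * (1 + real m)) powr r" using * by (intro powr_mono2) (auto simp: r)
    also have "\<dots> = (1 + real k) powr r * (1 + real m) powr r" by (simp add: powr_mult)
    finally show ?thesis using that by (intro mult_mono) auto
  qed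
  have "norm (star_kernel u w k m) \<le> (C1 + C2) * ((1 + real k) powr r * (1 + real m) powr r)" for k m
  proof (cases "k \<le> m")
    case True
    have "star_kernel u w k m = Gamma u * (pochhammer u (m - k) * rGamma (w + of_nat (m - k)))"
      using True pochhammer_Gamma[OF not_Ints_nonpos[OF u], of "m - k"] not_Ints_nonpos[OF u]
      by (simp add: star_kernel_def of_nat_diff Gamma_eq_zero_iff)
    also have "norm \<dots> \<le> C1 * (1 + real (m - k)) powr (Re u - Re w)" by (rule C1)
    also have "\<dots> \<le> (C1 + C2) * ((1 + real k) powr r * (1 + real m) powr r)"
      using C1(1) C2(1) by (intro pw) auto
    finally show ?thesis .
  next
    case False
    define i where "i = k - m"
    have e: "of_nat m - of_nat k = - (of_nat i :: complex)" using False by (simp add: i_def of_nat_diff)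
    have ui: "u - of_nat i \<notin> \<int>" using not_Ints_shift[OF u, of "- of_nat i"] by simp
    have u1: "1 - u \<notin> \<int>" using not_Ints_flip[OF u, of 1] by simp
    have "pochhammer (u - of_nat i) i = Gamma u * rGamma (u - of_nat i)"
      using pochhammer_Gamma[OF not_Ints_nonpos[OF ui], of i]
      by (simp add: rGamma_inverse_Gamma divide_inverse)
    hence g1: "(-1) ^ i * pochhammer (1 - u) i = Gamma u * rGamma (u - of_nat i)"
      by (simp only: pochhammer_reflect)
    have g2: "pochhammer (1 - u) i * rGamma (1 - u + of_nat i) = rGamma (1 - u)"
      by (rule pochhammer_rGamma[symmetric])
    have g3: "Gamma (u - of_nat i) * rGamma (u - of_nat i) = 1" by (rule Gamma_rGamma'[OF ui])
    have g4: "Gamma (1 - u) * rGamma (1 - u) = 1" by (rule Gamma_rGamma'[OF u1])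
    have s: "(-1) ^ i * (-1) ^ i = (1 :: complex)" by (simp flip: power_mult_distrib)
    have "Gamma (u - of_nat i) = (-1) ^ i * Gamma u * Gamma (1 - u) * rGamma (1 - u + of_nat i)"
    proof -
      have "X = \<sigma> * x * G * Q" if "\<sigma> * p = x * R" "p * Q = y" "X * R = 1" "G * y = 1" "\<sigma> * \<sigma> = 1"
        for X \<sigma> x G Q p R y :: complex
        using that by algebra
      from this[OF g1 g2 g3 g4 s] show ?thesis .
    qed
    moreover have "rGamma (w - of_nat i) = (-1) ^ i * pochhammer (1 - w) i * rGamma w"
      using pochhammer_rGamma[of "w - of_nat i" i] by (simp add: pochhammer_reflect)
    ultimately have "star_kernel u w k m = Gamma u * Gamma (1 - u) * rGamma w * (pochhammer (1 - w) i * rGamma (1 - u + of_nat i))"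
      unfolding star_kernel_def e using s by simp
    also have "norm \<dots> \<le> C2 * (1 + real i) powr (Re (1 - w) - Re (1 - u))" by (rule C2)
    also have "\<dots> = C2 * (1 + real i) powr (Re u - Re w)" by simp
    also have "\<dots> \<le> (C1 + C2) * ((1 + real k) powr r * (1 + real m) powr r)"
      using C1(1) C2(1) by (intro pw) (auto simp: i_def)
    finally show ?thesis .
  qed
  moreover have "C1 + C2 \<ge> 0" using C1 C2 by simp
  ultimately show ?thesis using that by blast
qed

definition starX where
  "starX p q f p' q' f' u w =
     (\<Sum>k. \<Sum>m. star_term p q f k * star_term p' q' f' m * star_kernel u w k m)"

text \<open>In each index the star terms have order -Re \<nu> - 1 and the kernel order max 0 (Re
  \<nu> - 1); the total lies below -1 exactly when Re \<nu> > 0.\<close>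

lemma starX_double_sum:
  assumes u: "u \<notin> \<int>" and \<nu>: "Re \<nu> > 0" "p + q - f = - \<nu>" "p' + q' - f' = - \<nu>" "u - w = \<nu> - 1"
  shows "(\<lambda>k. \<Sum>m. star_term p q f k * star_term p' q' f' m * star_kernel u w k m) sums starX p q f p' q' f' u w"
    and "(\<lambda>m. \<Sum>k. star_term p q f k * star_term p' q' f' m * star_kernel u w k m) sums starX p q f p' q' f' u w"
    and "summable (\<lambda>m. star_term p' q' f' m * star_kernel u w k m)"
proof -
  let ?u = "\<lambda>k m. star_term p q f k * star_term p' q' f' m * star_kernel u w k m"
  define r where "r = max 0 (Re u - Re w)"
  define t where "t = - Re \<nu> - 1"
  have uw: "Re u - Re w = Re \<nu> - 1" using arg_cong[OF \<nu>(4), of Re] by simp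
  have tr: "t + r < -1" using \<nu>(1) by (auto simp: t_def r_def uw)
  obtain C0 where C0: "C0 \<ge> 0" "\<And>k m. norm (star_kernel u w k m) \<le> C0 * ((1 + real k) powr r * (1 + real m) powr r)"
    using star_kernel_bound[OF u r_def] by blast
  obtain C1 where C1: "C1 \<ge> 0" "\<And>n. norm (star_term p q f n) \<le> C1 * (1 + real n) powr t"
    using polybdE[OF polybd_star_term[of p q f]] unfolding \<nu>(2) t_def by auto
  obtain C2 where C2: "C2 \<ge> 0" "\<And>n. norm (star_term p' q' f' n) \<le> C2 * (1 + real n) powr t"
    using polybdE[OF polybd_star_term[of p' q' f']] unfolding \<nu>(3) t_def by auto
  define P where "P k = C0 * C1 * (1 + real k) powr (t + r)" for k
  define Q where "Q m = C2 * (1 + real m) powr (t + r)" for m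
  have bd: "norm (?u k m) \<le> P k * Q m" for k m
  proof -
    have "norm (?u k m) \<le>
       (C1 * (1 + real k) powr t) * (C2 * (1 + real m) powr t) * (C0 * ((1 + real k) powr r * (1 + real m) powr r))"
      unfolding norm_mult using C0 C1 C2 by (intro mult_mono) auto
    also have "\<dots> = P k * Q m" by (simp add: P_def Q_def powr_add mult_ac)
    finally show ?thesis .
  qed
  have sP: "summable P" unfolding P_def by (intro summable_mult summable_one_plus_powr tr)
  have sQ: "summable Q" unfolding Q_def by (intro summable_mult summable_one_plus_powr tr)
  obtain S where S: "(\<lambda>k. \<Sum>m. ?u k m) sums S"
    "(\<lambda>m. \<Sum>k. ?u k m) sums S"
    by (rule dominated_double_sum[OF bd sP _ sQ]) (use C0 C1 C2 in \<open>auto simp: P_def Q_def\<close>)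
  moreover from S(1) have "starX p q f p' q' f' u w = S" by (simp add: starX_def sums_iff)
  ultimately show "(\<lambda>k. \<Sum>m. ?u k m) sums starX p q f p' q' f' u w"
    and "(\<lambda>m. \<Sum>k. ?u k m) sums starX p q f p' q' f' u w" by simp_all
  have "norm (star_term p' q' f' m * star_kernel u w k m) \<le> C0 * (1 + real k) powr r * Q m" for m
  proof -
    have "norm (star_term p' q' f' m * star_kernel u w k m) \<le>
       (C2 * (1 + real m) powr t) * (C0 * ((1 + real k) powr r * (1 + real m) powr r))"
      unfolding norm_mult using C0 C2 by (intro mult_mono) auto
    thus ?thesis by (simp add: Q_def powr_add mult_ac)
  qed
  thus "summable (\<lambda>m. star_term p' q' f' m * star_kernel u w k m)"
    by (intro summable_comparison_test'[OF summable_mult[OF sQ], of 0]) auto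
qed

lemma starX_reflect:
  assumes u: "u \<notin> \<int>" "w \<notin> \<int>" and \<nu>: "Re \<nu> > 0" "p + q - f = - \<nu>" "p' + q' - f' = - \<nu>" "u - w = \<nu> - 1"
  shows "sinpi w * starX p' q' f' p q f (1 - w) (1 - u) = sinpi u * starX p q f p' q' f' u w"
proof -
  have w0: "sinpi w \<noteq> 0" using u by (simp add: sinpi_eq_0_iff)
  have k: "star_kernel (1 - w) (1 - u) m k = sinpi u / sinpi w * star_kernel u w k m" for k m
    using star_kernel_reflect[OF u, of m k] w0 by (simp add: field_simps)
  note ds = starX_double_sum[OF u(1) \<nu>]
  have "(\<lambda>m. sinpi u / sinpi w * (\<Sum>k. star_term p q f k * star_term p' q' f' m * star_kernel u w k m)) sums
      (sinpi u / sinpi w * starX p q f p' q' f' u w)"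
    by (intro sums_mult ds)
  also have "(\<lambda>m. sinpi u / sinpi w * (\<Sum>k. star_term p q f k * star_term p' q' f' m * star_kernel u w k m)) =
     (\<lambda>m. \<Sum>k. star_term p' q' f' m * star_term p q f k * star_kernel (1 - w) (1 - u) m k)"
  proof
    fix m
    have u': "1 - w \<notin> \<int>" using not_Ints_flip[OF u(2), of 1] by simp
    have "summable (\<lambda>k. star_term p q f k * star_kernel (1 - w) (1 - u) m k)"
      using \<nu> by (intro starX_double_sum(3)[OF u' \<nu>(1,3,2)]) (simp add: algebra_simps)
    hence "summable (\<lambda>k. sinpi w / sinpi u * star_term p' q' f' m * (star_term p q f k * star_kernel (1 - w) (1 - u) m k))"
      by (intro summable_mult)
    moreover have "sinpi u \<noteq> 0" using u by (simp add: sinpi_eq_0_iff)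
    ultimately have "summable (\<lambda>k. star_term p q f k * star_term p' q' f' m * star_kernel u w k m)"
      using w0 by (simp add: k mult_ac)
    thus "sinpi u / sinpi w * (\<Sum>k. star_term p q f k * star_term p' q' f' m * star_kernel u w k m) =
     (\<Sum>k. star_term p' q' f' m * star_term p q f k * star_kernel (1 - w) (1 - u) m k)"
      by (subst suminf_mult[symmetric]) (simp_all add: k mult_ac)
  qed
  finally have "starX p' q' f' p q f (1 - w) (1 - u) = sinpi u / sinpi w * starX p q f p' q' f' u w"
    by (simp add: starX_def sums_iff)
  thus ?thesis using w0 by simp
qed

subsection \<open>The two-term relation for L\<close>

text \<open>Euler's transformation in \<open>a, b; f\<close> turns the series into a double sum whose inner sum is evaluated by the
  nonterminating Saalschuetz theorem; its second series leaves the double sum \<open>starX\<close>.\<close>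

theorem F43_star:
  assumes s: "e + f + g = a + b + c + d + 1" and \<nu>: "\<nu> = a + b - f" "Re \<nu> > 0"
    and n: "c \<notin> \<int>" "c - e \<notin> \<int>" "\<nu> \<notin> \<int>" "e - \<nu> \<notin> \<int>" "g - c \<notin> \<int>" "g - d \<notin> \<int>"
  shows "sinpi (e - \<nu>) * (rGamma (1 + c - e) * rGamma (1 + d - e)) * F43 a b c d e f g =
     sinpi e * (rGamma (g - c) * rGamma (g - d)) * F43 (f - a) (f - b) c d (e - \<nu>) f (g - \<nu>) +
     sinpi (e - \<nu>) * (rGamma \<nu> * rGamma c * rGamma d) *
       starX (f - a) (f - b) f (1 + c - e) (1 + d - e) (1 + g - e) (1 - (e - \<nu>)) (2 - e)"
proof -
  define e' where "e' = e - \<nu>"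
  define A where "A = star_term (f - a) (f - b) f"
  define B where "B = star_term (1 + c - e) (1 + d - e) (1 + g - e)"
  define x where "x m = pochhammer \<nu> m / fact m" for m
  define W where "W n = (pochhammer c n * rGamma (e + of_nat n)) * (pochhammer d n * rGamma (g + of_nat n))" for n
  define r where "r = Re \<nu>"
  have r: "r > 0" using \<nu> by (simp add: r_def)
  have \<nu>': "c + d - e - g = - \<nu> - 1" using s \<nu>(1) by algebra
  have e': "e' \<notin> \<int>" using n by (simp add: e'_def)
  obtain CA where CA: "CA \<ge> 0" "\<And>n. norm (A n) \<le> CA * (1 + real n) powr (- r - 1)"
  proof -
    have "Re (f - a + (f - b) - f) - 1 = - r - 1" using \<nu>(1) by (simp add: r_def)
    thus ?thesis using that polybdE[OF polybd_star_term[of "f - a" "f - b" f]] unfolding A_def by metis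
  qed
  obtain CX where CX: "CX \<ge> 0" "\<And>n. norm (x n) \<le> CX * (1 + real n) powr (r - 1)"
    using polybdE[OF polybd_pochhammer[of \<nu>]] unfolding x_def r_def by blast
  have "polybd W ((Re c - Re e) + (Re d - Re g))"
    unfolding W_def by (intro polybd_mult polybd_pochhammer_rGamma)
  moreover have "(Re c - Re e) + (Re d - Re g) = - r - 1"
    using arg_cong[OF \<nu>', of Re] by (simp add: r_def)
  ultimately have "polybd W (- r - 1)" by simp
  then obtain CW where CW: "CW \<ge> 0" "\<And>n. norm (W n) \<le> CW * (1 + real n) powr (- r - 1)"
    by (rule polybdE) blast
  \<comment> \<open>The decay exponent r + 1 of W(k + m) is split as 1/2 for k and r + 1/2 for m.
    The factor x m, of order r - 1, then leaves -3/2 in m, and k retains -r - 3/2.\<close>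
  define P where "P k = CA * CX * CW * (1 + real k) powr (- r - 3 / 2)" for k
  define Q where "Q m = (1 + real m) powr (- 3 / 2)" for m
  have bd: "norm (A k * x m * W (k + m)) \<le> P k * Q m" for k m
  proof -
    have "norm (A k * x m * W (k + m)) \<le>
      (CA * (1 + real k) powr (- r - 1)) * (CX * (1 + real m) powr (r - 1)) * (CW * (1 + real (k + m)) powr (- r - 1))"
      unfolding norm_mult using CA CX CW by (intro mult_mono) (auto simp del: of_nat_add)
    also have "\<dots> \<le> (CA * (1 + real k) powr (- r - 1)) * (CX * (1 + real m) powr (r - 1)) *
       (CW * ((1 + real k) powr (- (1 / 2)) * (1 + real m) powr (- r - 1 / 2)))"
    proof (intro mult_left_mono)
      have "(1 + real (k + m)) powr (- r - 1) = (1 + real (k + m)) powr (- (1 / 2)) * (1 + real (k + m)) powr (- r - 1 / 2)"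
        by (simp add: algebra_simps flip: powr_add)
      also have "\<dots> \<le> (1 + real k) powr (- (1 / 2)) * (1 + real m) powr (- r - 1 / 2)"
        using r by (intro mult_mono powr_mono2') auto
      finally show "(1 + real (k + m)) powr (- r - 1) \<le> (1 + real k) powr (- (1 / 2)) * (1 + real m) powr (- r - 1 / 2)" .
    qed (use CA CX CW in auto)
    also have "\<dots> = CA * CX * CW * ((1 + real k) powr (- r - 1) * (1 + real k) powr (- (1 / 2))) *
        ((1 + real m) powr (r - 1) * (1 + real m) powr (- r - 1 / 2))"
      by (simp add: mult_ac)
    also have "\<dots> = P k * Q m"
      by (simp add: P_def Q_def algebra_simps flip: powr_add)
    finally show ?thesis .
  qed
  have sP: "summable P" unfolding P_def using r by (intro summable_mult summable_one_plus_powr) simp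
  have sQ: "summable Q" unfolding Q_def by (intro summable_one_plus_powr) simp
  obtain S where S: "(\<lambda>k. \<Sum>m. A k * x m * W (k + m)) sums S" "(\<lambda>n. \<Sum>k\<le>n. A k * x (n - k) * W (k + (n - k))) sums S"
    by (rule dominated_double_sum[OF bd sP _ sQ]) (use CA CX CW in \<open>auto simp: P_def Q_def\<close>)
  have "(\<lambda>n. \<Sum>k\<le>n. A k * x (n - k) * W (k + (n - k))) = hyp_term a b c d e f g"
  proof
    fix n
    have "hyp_term a b c d e f g n = (pochhammer a n * pochhammer b n / fact n * rGamma (f + of_nat n)) * W n"
      by (simp add: hyp_term_def W_def)
    also have "\<dots> = (\<Sum>k\<le>n. A k * x (n - k) * W (k + (n - k)))"
      unfolding star_term_expand[OF \<nu>(1)] sum_distrib_right by (intro sum.cong) (simp_all add: A_def x_def)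
    finally show "(\<Sum>k\<le>n. A k * x (n - k) * W (k + (n - k))) = hyp_term a b c d e f g n" ..
  qed
  with S(2) have SF: "S = F43 a b c d e f g" by (simp add: F43_def sums_iff)
  define M where "M k = F32 (c + of_nat k) \<nu> (d + of_nat k) (g + of_nat k) (e + of_nat k)" for k :: nat
  have sk: "(g + of_nat k) + (e + of_nat k) = (c + of_nat k) + \<nu> + (d + of_nat k) + 1" for k :: nat
    using \<nu>' by algebra
  have inner: "(\<Sum>m. A k * x m * W (k + m)) = A k * (pochhammer c k * pochhammer d k) * M k" for k
  proof -
    have "(\<Sum>m. A k * x m * W (k + m)) = (\<Sum>m. A k * (pochhammer c k * pochhammer d k) *
      saal_term (c + of_nat k) \<nu> (d + of_nat k) (g + of_nat k) (e + of_nat k) m)"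
      by (intro suminf_cong) (simp add: W_def x_def saal_term_def pochhammer_product' add.assoc)
    also have "\<dots> = A k * (pochhammer c k * pochhammer d k) * M k"
      unfolding M_def F32_def by (intro suminf_mult summable_saal_term sk)
    finally show ?thesis .
  qed
  have sin_e': "sinpi e' \<noteq> 0" using e' by (simp add: sinpi_eq_0_iff)
  \<comment> \<open>For fixed k the inner sum is a Saalschuetzian 3F2 with parameters c + k, \<nu>,
    d + k; g + k, e + k. The closed form of its pair supplies the kth term of the transformed 4F3,
    and the second series of the pair supplies a row of \<open>starX\<close>.\<close>
  have key: "sinpi e' * (rGamma (1 + c - e) * rGamma (1 + d - e)) * (A k * (pochhammer c k * pochhammer d k) * M k) =
      sinpi e * (rGamma (g - c) * rGamma (g - d)) * hyp_term (f - a) (f - b) c d e' f (g - \<nu>) k +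
      sinpi e' * (rGamma \<nu> * rGamma c * rGamma d) * (\<Sum>m. A k * B m * star_kernel (1 - e') (2 - e) k m)" for k
  proof -
    define K :: complex where "K = of_nat k"
    have K: "K \<in> \<int>" "- K \<in> \<int>" by (simp_all add: K_def)
    define M2 where "M2 = F32 (1 + c - e) (1 - e' - K) (1 + d - e) (1 + g - e) (2 - (e + K))"
    have NS: "M k * (rGamma (1 + c - e) * rGamma (1 - e' - K) * rGamma (1 + d - e)) -
       M2 * (rGamma (c + K) * rGamma \<nu> * rGamma (d + K)) =
       sinpi (e + K) / of_real pi * (rGamma (g - c) * rGamma (g - \<nu> + K) * rGamma (g - d))"
    proof -
      have "saal_pair (c + K) \<nu> (d + K) (g + K) (e + K) = saal_val (c + K) \<nu> (d + K) (g + K) (e + K)"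
      proof (rule nonterminating_saalschuetz)
        show "g + K + (e + K) = c + K + \<nu> + (d + K) + 1" unfolding K_def by (rule sk)
        show "c + K \<notin> \<int>" by (intro not_Ints_shift n K)
        show "\<nu> - (e + K) \<notin> \<int>"
          using not_Ints_flip[OF n(4) K(2)] by (simp add: algebra_simps)
      qed (use n in auto)
      thus ?thesis
        by (simp add: saal_pair_def saal_val_def M_def M2_def e'_def K_def[symmetric] algebra_simps)
    qed
    define sg :: complex where "sg = (-1) ^ k"
    have sg: "sg * sg = 1" by (simp add: sg_def flip: power_mult_distrib)
    have sin_sg: "sinpi (e + K) = sg * sinpi e" "sinpi (e' + K) = sg * sinpi e'"
      by (simp_all add: sg_def K_def sinpi_add_of_nat)
    have refl: "rGamma (e' + K) * rGamma (1 - e' - K) = sg * sinpi e' / of_real pi"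
      using rGamma_reflection_sinpi[of "e' + K" "1 - e' - K"] by (simp add: sin_sg)
    have u: "1 - e' \<notin> \<int>" using not_Ints_flip[OF e', of 1] by simp
    have uK: "1 - e' - K \<notin> \<int>" using not_Ints_shift[OF u K(2)] by simp
    have sumB: "summable (\<lambda>m. B m * star_kernel (1 - e') (2 - e) k m)"
      unfolding B_def using \<nu>' by (intro starX_double_sum(3)[OF u \<nu>(2), where p = "f - a" and q = "f - b" and f = f]) (auto simp: \<nu>(1) e'_def algebra_simps)
    have M2: "rGamma (e' + K) * M2 = sg * sinpi e' / of_real pi * (\<Sum>m. B m * star_kernel (1 - e') (2 - e) k m)"
    proof -
      have "saal_term (1 + c - e) (1 - e' - K) (1 + d - e) (1 + g - e) (2 - (e + K)) m =
        rGamma (1 - e' - K) * (B m * star_kernel (1 - e') (2 - e) k m)" for m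
      proof -
        have "pochhammer (1 - e' - K) m = rGamma (1 - e' - K) * Gamma (1 - e' - K + of_nat m)"
          using pochhammer_Gamma[OF not_Ints_nonpos[OF uK], of m]
          by (simp add: rGamma_inverse_Gamma divide_inverse)
        thus ?thesis
          by (simp add: saal_term_def B_def star_term_def star_kernel_def K_def algebra_simps)
      qed
      hence "M2 = rGamma (1 - e' - K) * (\<Sum>m. B m * star_kernel (1 - e') (2 - e) k m)"
      proof -
        assume "\<And>m. saal_term (1 + c - e) (1 - e' - K) (1 + d - e) (1 + g - e) (2 - (e + K)) m =
          rGamma (1 - e' - K) * (B m * star_kernel (1 - e') (2 - e) k m)"
        hence "saal_term (1 + c - e) (1 - e' - K) (1 + d - e) (1 + g - e) (2 - (e + K)) =
          (\<lambda>m. rGamma (1 - e' - K) * (B m * star_kernel (1 - e') (2 - e) k m))" by (rule ext)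
        thus ?thesis unfolding M2_def F32_def by (simp only: suminf_mult[OF sumB])
      qed
      hence "rGamma (e' + K) * M2 = (rGamma (e' + K) * rGamma (1 - e' - K)) * (\<Sum>m. B m * star_kernel (1 - e') (2 - e) k m)"
        by (simp only: mult.assoc)
      thus ?thesis unfolding refl .
    qed
    have pc: "pochhammer c k * rGamma (c + K) = rGamma c" "pochhammer d k * rGamma (d + K) = rGamma d"
      unfolding K_def by (rule pochhammer_rGamma[symmetric])+
    have H: "hyp_term (f - a) (f - b) c d e' f (g - \<nu>) k = A k * (pochhammer c k * pochhammer d k) * (rGamma (e' + K) * rGamma (g - \<nu> + K))"
      by (simp add: hyp_term_def A_def star_term_def K_def)
    have Bsum: "(\<Sum>m. A k * B m * star_kernel (1 - e') (2 - e) k m) = A k * (\<Sum>m. B m * star_kernel (1 - e') (2 - e) k m)"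
      using suminf_mult[OF sumB, of "A k"] by (simp add: mult.assoc)
    define Z where "Z = (\<Sum>m. B m * star_kernel (1 - e') (2 - e) k m)"
    define \<pi> :: complex where "\<pi> = of_real pi"
    have pi: "\<pi> * (1 / \<pi>) = 1" by (simp add: \<pi>_def)
    define i\<pi> where "i\<pi> = 1 / \<pi>"
    have N1: "M k * (rGamma (1 + c - e) * rGamma (1 - e' - K) * rGamma (1 + d - e)) -
       M2 * (rGamma (c + K) * rGamma \<nu> * rGamma (d + K)) =
       sg * sinpi e * i\<pi> * (rGamma (g - c) * rGamma (g - \<nu> + K) * rGamma (g - d))"
      using NS by (simp add: sin_sg i\<pi>_def \<pi>_def)
    have N2: "rGamma (e' + K) * rGamma (1 - e' - K) = sg * sinpi e' * i\<pi>"
      using refl by (simp add: i\<pi>_def \<pi>_def)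
    have N3: "rGamma (e' + K) * M2 = sg * sinpi e' * i\<pi> * Z"
      using M2 by (simp add: i\<pi>_def \<pi>_def Z_def)
    have N4: "\<pi> * i\<pi> = 1" using pi by (simp add: i\<pi>_def)
    \<comment> \<open>Multiplying the Saalschuetz relation by E = \<open>rGamma (e' + K)\<close>
      allows reflection in both terms on its left; every term then carries the nonzero factor (-1)^k
      / pi, which cancels.\<close>
    have alg: "s' * (rc * rd) * (Ak * (pc * pd) * Mk) = s * (gc * gd) * (Ak * (pc * pd) * (E * G)) + s' * (rn * rc0 * rd0) * (Ak * Z)"
      if "Mk * (rc * R * rd) - M2 * (rcK * rn * rdK) = \<sigma> * s * i * (gc * G * gd)"
        "E * R = \<sigma> * s' * i" "E * M2 = \<sigma> * s' * i * Z" "p * i = 1" "\<sigma> * \<sigma> = 1" "pc * rcK = rc0" "pd * rdK = rd0"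
      for s' rc rd Ak pc pd Mk s gc gd E G rn rc0 rd0 Z R M2 rcK rdK \<sigma> i p :: complex
    proof -
      have "\<sigma> * i * (s' * (rc * rd) * Mk) = \<sigma> * i * (s * (gc * gd) * (E * G) + s' * (rn * rcK * rdK) * Z)"
        using that(1-3) by algebra
      moreover have "\<sigma> * i \<noteq> 0" using that(4,5) by auto
      ultimately have "s' * (rc * rd) * Mk = s * (gc * gd) * (E * G) + s' * (rn * rcK * rdK) * Z" by simp
      thus ?thesis using that(6,7) by algebra
    qed
    show ?thesis unfolding H Bsum Z_def[symmetric]
      by (rule alg[OF N1 N2 N3 N4 sg pc])
  qed
  have "(\<lambda>k. sinpi e' * (rGamma (1 + c - e) * rGamma (1 + d - e)) * (A k * (pochhammer c k * pochhammer d k) * M k)) sums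
    (sinpi e' * (rGamma (1 + c - e) * rGamma (1 + d - e)) * F43 a b c d e f g)"
    using S(1) unfolding inner SF by (rule sums_mult)
  moreover have "(\<lambda>k. sinpi e' * (rGamma (1 + c - e) * rGamma (1 + d - e)) * (A k * (pochhammer c k * pochhammer d k) * M k)) sums
     (sinpi e * (rGamma (g - c) * rGamma (g - d)) * F43 (f - a) (f - b) c d e' f (g - \<nu>) +
      sinpi e' * (rGamma \<nu> * rGamma c * rGamma d) * starX (f - a) (f - b) f (1 + c - e) (1 + d - e) (1 + g - e) (1 - e') (2 - e))"
    unfolding key
  proof (intro sums_add sums_mult)
    show "hyp_term (f - a) (f - b) c d e' f (g - \<nu>) sums F43 (f - a) (f - b) c d e' f (g - \<nu>)"
      unfolding F43_def
    proof (intro summable_sums summable_hyp_term)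
      show "e' + f + (g - \<nu>) = f - a + (f - b) + c + d + 1" unfolding e'_def \<nu>(1) using s by algebra
    qed
    have u: "1 - e' \<notin> \<int>" using not_Ints_flip[OF e', of 1] by simp
    show "(\<lambda>k. \<Sum>m. A k * B m * star_kernel (1 - e') (2 - e) k m) sums
      starX (f - a) (f - b) f (1 + c - e) (1 + d - e) (1 + g - e) (1 - e') (2 - e)"
      unfolding A_def B_def using \<nu>' by (intro starX_double_sum(1)[OF u \<nu>(2)]) (auto simp: \<nu>(1) e'_def algebra_simps)
  qed
  ultimately show ?thesis unfolding e'_def by (rule sums_unique2)
qed

text \<open>This is \<open>L_fun\<close> times \<open>sinpi e\<close>, with the reciprocal Gammas of
  the lower parameters absorbed into \<open>F43\<close>; it has no denominators left.\<close>

definition L_pair where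
  "L_pair a b c d e f g =
     F43 a b c d e f g * (rGamma (1 + a - e) * rGamma (1 + b - e) * rGamma (1 + c - e) * rGamma (1 + d - e)) -
     F43 (1 + a - e) (1 + b - e) (1 + c - e) (1 + d - e) (2 - e) (1 + f - e) (1 + g - e) *
       (rGamma a * rGamma b * rGamma c * rGamma d)"

lemma L_pair_perm: "L_pair a b c d e f g = L_pair c d a b e g f" "L_pair a b c d e f g = L_pair a b c d e g f"
  by (simp_all add: L_pair_def F43_def hyp_term_def[abs_def] mult_ac)

text \<open>\<open>F43_star\<close> is applied to the given parameters and to those obtained by exchanging the two summation
  indices of \<open>starX\<close>; eliminating \<open>starX\<close> leaves two pairs of series.\<close>

lemma L_pair_transform_pos:
  assumes s: "e + f + g = a + b + c + d + 1" and \<nu>: "\<nu> = a + b - f" "Re \<nu> > 0"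
    and n: "a \<notin> \<int>" "b \<notin> \<int>" "c \<notin> \<int>" "b - e \<notin> \<int>" "c - e \<notin> \<int>" "f - a \<notin> \<int>" "g - c \<notin> \<int>" "g - d \<notin> \<int>"
      "e \<notin> \<int>" "\<nu> \<notin> \<int>" "e - \<nu> \<notin> \<int>"
  shows "sinpi (e - \<nu>) * L_pair a b c d e f g = sinpi e * L_pair (f - a) (f - b) c d (e - \<nu>) f (g - \<nu>)"
proof -
  define e' where "e' = e - \<nu>"
  define X where "X = starX (f - a) (f - b) f (1 + c - e) (1 + d - e) (1 + g - e) (1 - e') (2 - e)"
  define Y where "Y = starX (1 + c - e) (1 + d - e) (1 + g - e) (f - a) (f - b) f (1 - (2 - e)) (1 - (1 - e'))"
  have g: "g = 1 + a + b + c + d - e - f" using s by algebra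
  have E1: "sinpi e' * (rGamma (1 + c - e) * rGamma (1 + d - e)) * F43 a b c d e f g =
     sinpi e * (rGamma (g - c) * rGamma (g - d)) * F43 (f - a) (f - b) c d e' f (g - \<nu>) +
     sinpi e' * (rGamma \<nu> * rGamma c * rGamma d) * X"
    unfolding X_def e'_def by (intro F43_star s \<nu> n)
  \<comment> \<open>The second application starts from the second series of the transformed pair. It
    has the same \<nu>, and Euler's transformation carries it to the second series of the original
    pair.\<close>
  have sy: "(2 - e') + (1 + g - e) + (f + 1 - e') = (g - c) + (g - d) + (1 + b - e) + (1 + a - e) + 1"
    by (simp add: e'_def \<nu>(1) g)
  have \<nu>y: "\<nu> = (g - c) + (g - d) - (1 + g - e)" by (simp add: \<nu>(1) g)
  have eqs: "2 - e' - \<nu> = 2 - e" "1 + (1 + b - e) - (2 - e') = f - a" "1 + (1 + a - e) - (2 - e') = f - b"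
    "f + 1 - e' - (1 + b - e) = a" "f + 1 - e' - (1 + a - e) = b" "1 + g - e - (g - c) = 1 + c - e" "1 + g - e - (g - d) = 1 + d - e"
    "f + 1 - e' - \<nu> = 1 + f - e" "1 + (f + 1 - e') - (2 - e') = f" "2 - (2 - e') = 1 - (1 - e')"
    by (simp_all add: e'_def \<nu>(1))
  have s1: "sinpi (2 - e) = - sinpi e" "sinpi (2 - e') = - sinpi e'" "sinpi (1 - e') = sinpi e'"
    using sinpi_add_of_nat[of "- e" 2] sinpi_add_of_nat[of "- e'" 2] sinpi_add_of_nat[of "- e'" 1] by (simp_all add: sinpi_minus)
  have "sinpi (2 - e' - \<nu>) * (rGamma (1 + (1 + b - e) - (2 - e')) * rGamma (1 + (1 + a - e) - (2 - e'))) *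
      F43 (g - c) (g - d) (1 + b - e) (1 + a - e) (2 - e') (1 + g - e) (f + 1 - e') =
     sinpi (2 - e') * (rGamma (f + 1 - e' - (1 + b - e)) * rGamma (f + 1 - e' - (1 + a - e))) *
      F43 (1 + g - e - (g - c)) (1 + g - e - (g - d)) (1 + b - e) (1 + a - e) (2 - e' - \<nu>) (1 + g - e) (f + 1 - e' - \<nu>) +
     sinpi (2 - e' - \<nu>) * (rGamma \<nu> * rGamma (1 + b - e) * rGamma (1 + a - e)) *
      starX (1 + g - e - (g - c)) (1 + g - e - (g - d)) (1 + g - e) (1 + (1 + b - e) - (2 - e')) (1 + (1 + a - e) - (2 - e'))
        (1 + (f + 1 - e') - (2 - e')) (1 - (2 - e' - \<nu>)) (2 - (2 - e'))"
  proof (rule F43_star[OF sy \<nu>y \<nu>(2)])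
    show "1 + b - e \<notin> \<int>" using not_Ints_shift[OF n(4), of 1] by (simp add: algebra_simps)
    show "1 + b - e - (2 - e') \<notin> \<int>"
      using not_Ints_shift[OF n(6), of "-1"] by (simp add: e'_def \<nu>(1))
    show "2 - e' - \<nu> \<notin> \<int>" using not_Ints_flip[OF n(9), of 2] unfolding eqs by simp
    show "f + 1 - e' - (1 + b - e) \<notin> \<int>" "f + 1 - e' - (1 + a - e) \<notin> \<int>" unfolding eqs by (rule n)+
  qed (rule n)
  hence E2: "- sinpi e * (rGamma (f - a) * rGamma (f - b)) * F43 (g - c) (g - d) (1 + b - e) (1 + a - e) (2 - e') (1 + g - e) (f + 1 - e') =
     - sinpi e' * (rGamma a * rGamma b) * F43 (1 + c - e) (1 + d - e) (1 + b - e) (1 + a - e) (2 - e) (1 + g - e) (1 + f - e) +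
     - sinpi e * (rGamma \<nu> * rGamma (1 + b - e) * rGamma (1 + a - e)) * Y"
    unfolding eqs s1 Y_def .
  \<comment> \<open>The two double sums have their star terms in exchanged order; reflecting the
    kernel makes them proportional, so they drop out.\<close>
  have E3: "- sinpi e * Y = sinpi e' * X"
    unfolding Y_def X_def s1[symmetric]
  proof (rule starX_reflect[OF _ _ \<nu>(2)])
    show "1 - e' \<notin> \<int>" using not_Ints_flip[OF n(11), of 1] by (simp add: e'_def)
    show "2 - e \<notin> \<int>" using not_Ints_flip[OF n(9), of 2] by simp
  qed (simp_all add: \<nu>(1) e'_def g)
  have F1: "F43 (1 + a - e) (1 + b - e) (1 + c - e) (1 + d - e) (2 - e) (1 + f - e) (1 + g - e) =
     F43 (1 + c - e) (1 + d - e) (1 + b - e) (1 + a - e) (2 - e) (1 + g - e) (1 + f - e)"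
    by (simp add: F43_def hyp_term_def[abs_def] mult_ac)
  have eqs2: "1 + (f - a) - e' = 1 + b - e" "1 + (f - b) - e' = 1 + a - e" "1 + c - e' = g - d" "1 + d - e' = g - c"
    "1 + f - e' = f + 1 - e'" "1 + (g - \<nu>) - e' = 1 + g - e"
    by (simp_all add: e'_def \<nu>(1) g)
  have Fy: "F43 (1 + b - e) (1 + a - e) (g - d) (g - c) (2 - e') (f + 1 - e') (1 + g - e) =
     F43 (g - c) (g - d) (1 + b - e) (1 + a - e) (2 - e') (1 + g - e) (f + 1 - e')"
    by (simp add: F43_def hyp_term_def[abs_def] mult_ac)
  show ?thesis
    unfolding L_pair_def e'_def[symmetric] eqs2 F1 Fy using E1 E2 E3 by algebra
qed

text \<open>The parameter map is an involution that replaces \<nu> by -\<nu>, so for negative real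
  part the relation is read backwards from the transformed parameters. At real part 0 neither
  direction meets the convergence hypothesis.\<close>

lemma L_pair_transform:
  assumes s: "e + f + g = a + b + c + d + 1"
    and eq: "a' = f - a" "b' = f - b" "e' = e - (a + b - f)" "g' = g - (a + b - f)" and re: "Re (a + b - f) \<noteq> 0"
    and n: "a \<notin> \<int>" "b \<notin> \<int>" "c \<notin> \<int>" "d \<notin> \<int>" "a - e \<notin> \<int>" "b - e \<notin> \<int>" "c - e \<notin> \<int>" "d - e \<notin> \<int>"
      "f - a \<notin> \<int>" "f - b \<notin> \<int>" "g - c \<notin> \<int>" "g - d \<notin> \<int>"
      "e \<notin> \<int>" "a + b - f \<notin> \<int>" "e - (a + b - f) \<notin> \<int>"
  shows "sinpi e' * L_pair a b c d e f g = sinpi e * L_pair a' b' c d e' f g'"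
proof (cases "Re (a + b - f) > 0")
  case True
  show ?thesis unfolding eq by (rule L_pair_transform_pos[OF s refl True]) (use n in auto)
next
  case False
  define \<nu> where "\<nu> = a' + b' - f"
  have \<nu>: "\<nu> = - (a + b - f)" by (simp add: \<nu>_def eq)
  have g: "g = 1 + a + b + c + d - e - f" using s by algebra
  have i: "f - a' = a" "f - b' = b" "e' - \<nu> = e" "g' - \<nu> = g" by (simp_all add: eq \<nu>)
  have "sinpi (e' - \<nu>) * L_pair a' b' c d e' f g' = sinpi e' * L_pair (f - a') (f - b') c d (e' - \<nu>) f (g' - \<nu>)"
  proof (rule L_pair_transform_pos[OF _ \<nu>_def])
    show "e' + f + g' = a' + b' + c + d + 1" by (simp add: eq g)
    show "0 < Re \<nu>" using False re by (simp add: \<nu>)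
    show "b' - e' \<notin> \<int>" using n(5) by (simp add: eq)
    have "c - e' = (g - d) + - 1" by (simp add: eq g)
    thus "c - e' \<notin> \<int>" using not_Ints_shift[OF n(12), of "- 1"] by simp
    have "g' - c = 1 + (d - e)" "g' - d = 1 + (c - e)" by (simp_all add: eq g)
    thus "g' - c \<notin> \<int>" "g' - d \<notin> \<int>"
      using not_Ints_shift[OF n(8), of 1] not_Ints_shift[OF n(7), of 1] by (simp_all add: add.commute)
    show "\<nu> \<notin> \<int>" using not_Ints_flip[OF n(14), of 0] by (simp add: \<nu>)
    show "e' - \<nu> \<notin> \<int>" "f - a' \<notin> \<int>" unfolding i by (rule n)+
  qed (use n in \<open>auto simp: eq\<close>)
  thus ?thesis unfolding i by simp
qed

lemma not_Ints_eq: "z \<notin> \<int> \<Longrightarrow> y = z + of_int k \<Longrightarrow> y \<notin> \<int>" for z y :: complex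
  using not_Ints_shift[of z "of_int k"] by simp

lemma not_Ints_eq_neg: "z \<notin> \<int> \<Longrightarrow> y = of_int k - z \<Longrightarrow> y \<notin> \<int>" for z y :: complex
  using not_Ints_flip[of z "of_int k"] by simp

text \<open>The steps act on the upper pairs (1-a, 1-b), (1-c, 1-d), (e-d, e-c) with \<nu> equal to
  f - a - b, 1 - e, e + f - c - d - 1; the conditions on real parts say that none of these has real
  part 0. In between, upper parameters are permuted and two lower ones are swapped.\<close>

lemma L_pair_chain:
  fixes a b c d e f g :: complex
  assumes g: "g = 1 + a + b + c + d - e - f"
    and gen: "a \<notin> \<int>"
      "b \<notin> \<int>"
      "c \<notin> \<int>"
      "d \<notin> \<int>"
      "a - e \<notin> \<int>"
      "b - e \<notin> \<int>"
      "c - e \<notin> \<int>"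
      "d - e \<notin> \<int>"
      "a - f \<notin> \<int>"
      "b - f \<notin> \<int>"
      "a + b + d - e - f \<notin> \<int>"
      "a + b + c - e - f \<notin> \<int>"
      "e \<notin> \<int>"
      "a + b - f \<notin> \<int>"
      "a + b - e - f \<notin> \<int>"
      "d - f \<notin> \<int>"
      "c - f \<notin> \<int>"
      "a + c + d - e - f \<notin> \<int>"
      "b + c + d - e - f \<notin> \<int>"
      "c + d - e - f \<notin> \<int>"
      "a + b + c + d - e - 2 * f \<notin> \<int>"
      "a - b \<notin> \<int>"
    and re: "Re (a + b - f) \<noteq> 0" "Re e \<noteq> 1" "Re (e + f - c - d) \<noteq> 1"
  shows "sinpi (1 + g - f) * L_pair (1 - a) (1 - b) (1 - c) (1 - d) (2 - e) (2 - f) (2 - g) =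
     sinpi (2 - e) * L_pair (1 + a - f) (1 + b - f) (1 + c - f) (1 + d - f) (1 + g - f) (1 + e - f) (2 - f)"
proof -
  have st1: "sinpi (2 - e - f + a + b) * L_pair (1 - a) (1 - b) (1 - c) (1 - d) (2 - e) (2 - f) (2 - g) =
      sinpi (2 - e) * L_pair (1 + a - f) (1 + b - f) (1 - c) (1 - d) (2 - e - f + a + b) (2 - f) (1 - c - d + e)"
  proof (rule L_pair_transform)
    show "1 - a \<notin> \<int>" by (rule not_Ints_eq_neg[OF gen(1), where k = 1]) (simp add: g)
    show "1 - b \<notin> \<int>" by (rule not_Ints_eq_neg[OF gen(2), where k = 1]) (simp add: g)
    show "1 - c \<notin> \<int>" by (rule not_Ints_eq_neg[OF gen(3), where k = 1]) (simp add: g)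
    show "1 - d \<notin> \<int>" by (rule not_Ints_eq_neg[OF gen(4), where k = 1]) (simp add: g)
    show "1 - a - (2 - e) \<notin> \<int>" by (rule not_Ints_eq_neg[OF gen(5), where k = "-1"]) (simp add: g)
    show "1 - b - (2 - e) \<notin> \<int>" by (rule not_Ints_eq_neg[OF gen(6), where k = "-1"]) (simp add: g)
    show "1 - c - (2 - e) \<notin> \<int>" by (rule not_Ints_eq_neg[OF gen(7), where k = "-1"]) (simp add: g)
    show "1 - d - (2 - e) \<notin> \<int>" by (rule not_Ints_eq_neg[OF gen(8), where k = "-1"]) (simp add: g)
    show "2 - f - (1 - a) \<notin> \<int>" by (rule not_Ints_eq[OF gen(9), where k = 1]) (simp add: g)
    show "2 - f - (1 - b) \<notin> \<int>" by (rule not_Ints_eq[OF gen(10), where k = 1]) (simp add: g)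
    show "2 - g - (1 - c) \<notin> \<int>" by (rule not_Ints_eq_neg[OF gen(11), where k = 0]) (simp add: g)
    show "2 - g - (1 - d) \<notin> \<int>" by (rule not_Ints_eq_neg[OF gen(12), where k = 0]) (simp add: g)
    show "2 - e \<notin> \<int>" by (rule not_Ints_eq_neg[OF gen(13), where k = 2]) (simp add: g)
    show "1 - a + (1 - b) - (2 - f) \<notin> \<int>" by (rule not_Ints_eq_neg[OF gen(14), where k = 0]) (simp add: g)
    show "2 - e - (1 - a + (1 - b) - (2 - f)) \<notin> \<int>" by (rule not_Ints_eq[OF gen(15), where k = 2]) (simp add: g)
  qed (use re in \<open>auto simp: g\<close>)
  have st2: "sinpi (1 - f + a + b) * L_pair (1 - c) (1 - d) (1 + a - f) (1 + b - f) (2 - e - f + a + b) (1 - c - d + e) (2 - f) =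
      sinpi (2 - e - f + a + b) * L_pair (e - d) (e - c) (1 + a - f) (1 + b - f) (1 - f + a + b) (1 - c - d + e) (1 - f + e)"
  proof (rule L_pair_transform)
    show "1 - c \<notin> \<int>" by (rule not_Ints_eq_neg[OF gen(3), where k = 1]) (simp add: g)
    show "1 - d \<notin> \<int>" by (rule not_Ints_eq_neg[OF gen(4), where k = 1]) (simp add: g)
    show "1 + a - f \<notin> \<int>" by (rule not_Ints_eq[OF gen(9), where k = 1]) (simp add: g)
    show "1 + b - f \<notin> \<int>" by (rule not_Ints_eq[OF gen(10), where k = 1]) (simp add: g)
    show "1 - c - (2 - e - f + a + b) \<notin> \<int>" by (rule not_Ints_eq_neg[OF gen(12), where k = "-1"]) (simp add: g)
    show "1 - d - (2 - e - f + a + b) \<notin> \<int>" by (rule not_Ints_eq_neg[OF gen(11), where k = "-1"]) (simp add: g)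
    show "1 + a - f - (2 - e - f + a + b) \<notin> \<int>" by (rule not_Ints_eq_neg[OF gen(6), where k = "-1"]) (simp add: g)
    show "1 + b - f - (2 - e - f + a + b) \<notin> \<int>" by (rule not_Ints_eq_neg[OF gen(5), where k = "-1"]) (simp add: g)
    show "1 - c - d + e - (1 - c) \<notin> \<int>" by (rule not_Ints_eq_neg[OF gen(8), where k = 0]) (simp add: g)
    show "1 - c - d + e - (1 - d) \<notin> \<int>" by (rule not_Ints_eq_neg[OF gen(7), where k = 0]) (simp add: g)
    show "2 - f - (1 + a - f) \<notin> \<int>" by (rule not_Ints_eq_neg[OF gen(1), where k = 1]) (simp add: g)
    show "2 - f - (1 + b - f) \<notin> \<int>" by (rule not_Ints_eq_neg[OF gen(2), where k = 1]) (simp add: g)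
    show "2 - e - f + a + b \<notin> \<int>" by (rule not_Ints_eq[OF gen(15), where k = 2]) (simp add: g)
    show "1 - c + (1 - d) - (1 - c - d + e) \<notin> \<int>" by (rule not_Ints_eq_neg[OF gen(13), where k = 1]) (simp add: g)
    show "2 - e - f + a + b - (1 - c + (1 - d) - (1 - c - d + e)) \<notin> \<int>" by (rule not_Ints_eq[OF gen(14), where k = 1]) (simp add: g)
  qed (use re in \<open>auto simp: g\<close>)
  have st3: "sinpi (1 + g - f) * L_pair (e - d) (e - c) (1 + a - f) (1 + b - f) (1 - f + a + b) (1 - f + e) (1 - c - d + e) =
      sinpi (1 - f + a + b) * L_pair (1 + d - f) (1 + c - f) (1 + a - f) (1 + b - f) (1 + g - f) (1 - f + e) (2 - f)"
  proof (rule L_pair_transform)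
    show "e - d \<notin> \<int>" by (rule not_Ints_eq_neg[OF gen(8), where k = 0]) (simp add: g)
    show "e - c \<notin> \<int>" by (rule not_Ints_eq_neg[OF gen(7), where k = 0]) (simp add: g)
    show "1 + a - f \<notin> \<int>" by (rule not_Ints_eq[OF gen(9), where k = 1]) (simp add: g)
    show "1 + b - f \<notin> \<int>" by (rule not_Ints_eq[OF gen(10), where k = 1]) (simp add: g)
    show "e - d - (1 - f + a + b) \<notin> \<int>" by (rule not_Ints_eq_neg[OF gen(11), where k = "-1"]) (simp add: g)
    show "e - c - (1 - f + a + b) \<notin> \<int>" by (rule not_Ints_eq_neg[OF gen(12), where k = "-1"]) (simp add: g)
    show "1 + a - f - (1 - f + a + b) \<notin> \<int>" by (rule not_Ints_eq_neg[OF gen(2), where k = 0]) (simp add: g)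
    show "1 + b - f - (1 - f + a + b) \<notin> \<int>" by (rule not_Ints_eq_neg[OF gen(1), where k = 0]) (simp add: g)
    show "1 - f + e - (e - d) \<notin> \<int>" by (rule not_Ints_eq[OF gen(16), where k = 1]) (simp add: g)
    show "1 - f + e - (e - c) \<notin> \<int>" by (rule not_Ints_eq[OF gen(17), where k = 1]) (simp add: g)
    show "1 - c - d + e - (1 + a - f) \<notin> \<int>" by (rule not_Ints_eq_neg[OF gen(18), where k = 0]) (simp add: g)
    show "1 - c - d + e - (1 + b - f) \<notin> \<int>" by (rule not_Ints_eq_neg[OF gen(19), where k = 0]) (simp add: g)
    show "1 - f + a + b \<notin> \<int>" by (rule not_Ints_eq[OF gen(14), where k = 1]) (simp add: g)
    show "e - d + (e - c) - (1 - f + e) \<notin> \<int>" by (rule not_Ints_eq_neg[OF gen(20), where k = "-1"]) (simp add: g)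
    show "1 - f + a + b - (e - d + (e - c) - (1 - f + e)) \<notin> \<int>" by (rule not_Ints_eq[OF gen(21), where k = 2]) (simp add: g)
  qed (use re in \<open>auto simp: g\<close>)
  have nz: "sinpi (2 - e - f + a + b) \<noteq> 0" "sinpi (1 - f + a + b) \<noteq> 0"
  proof -
    have "2 - e - f + a + b \<notin> \<int>" by (rule not_Ints_eq[OF gen(15), where k = 2]) simp
    thus "sinpi (2 - e - f + a + b) \<noteq> 0" by (simp add: sinpi_eq_0_iff)
    have "1 - f + a + b \<notin> \<int>" by (rule not_Ints_eq[OF gen(14), where k = 1]) simp
    thus "sinpi (1 - f + a + b) \<noteq> 0" by (simp add: sinpi_eq_0_iff)
  qed
  have p1: "L_pair (1 + a - f) (1 + b - f) (1 - c) (1 - d) (2 - e - f + a + b) (2 - f) (1 - c - d + e) =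
     L_pair (1 - c) (1 - d) (1 + a - f) (1 + b - f) (2 - e - f + a + b) (1 - c - d + e) (2 - f)" by (rule L_pair_perm)
  have p2: "L_pair (e - d) (e - c) (1 + a - f) (1 + b - f) (1 - f + a + b) (1 - c - d + e) (1 - f + e) =
     L_pair (e - d) (e - c) (1 + a - f) (1 + b - f) (1 - f + a + b) (1 - f + e) (1 - c - d + e)" by (rule L_pair_perm)
  have p3: "L_pair (1 + d - f) (1 + c - f) (1 + a - f) (1 + b - f) (1 + g - f) (1 - f + e) (2 - f) =
     L_pair (1 + a - f) (1 + b - f) (1 + c - f) (1 + d - f) (1 + g - f) (1 + e - f) (2 - f)"
  proof -
    have "1 - f + e = 1 + e - f" by simp
    show ?thesis unfolding \<open>1 - f + e = 1 + e - f\<close> by (simp add: L_pair_def F43_def hyp_term_def[abs_def] mult_ac)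
  qed
  have alg: "s4 * L1 = s1 * L4" if "s2 * L1 = s1 * L2" "s3 * L2 = s2 * L3" "s4 * L3 = s3 * L4" "s2 \<noteq> 0" "s3 \<noteq> 0"
    for s1 s2 s3 s4 L1 L2 L3 L4 :: complex
  proof -
    have "s2 * s3 * (s4 * L1) = s2 * s3 * (s1 * L4)" using that(1-3) by algebra
    thus ?thesis using that by simp
  qed
  show ?thesis
    by (rule alg[OF st1[unfolded p1] st2[unfolded p2] st3[unfolded p3] nz])
qed

subsection \<open>Growth of Gamma quotients in the plane\<close>

text \<open>The expansion f = 1 + \<alpha> w + O(w^2) along a filter. Filter and coefficient are
  general because it serves twice: with w = 1/z at infinity, and with w = 1/n uniformly near a
  parameter value, where the coefficients of the factors vary with the parameter.\<close>

definition lin_asymp :: "'x filter \<Rightarrow> ('x \<Rightarrow> complex) \<Rightarrow> ('x \<Rightarrow> complex) \<Rightarrow> ('x \<Rightarrow> complex) \<Rightarrow> bool" where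
  "lin_asymp F w f \<alpha> \<longleftrightarrow> \<alpha> \<in> O[F](\<lambda>_. 1) \<and> (\<lambda>x. f x - 1 - \<alpha> x * w x) \<in> O[F](\<lambda>x. (w x)\<^sup>2)"

lemma lin_asymp_affine: "\<alpha> \<in> O[F](\<lambda>_. 1) \<Longrightarrow> lin_asymp F w (\<lambda>x. 1 + \<alpha> x * w x) \<alpha>"
  by (simp add: lin_asymp_def)

lemma lin_asymp_bounded:
  assumes "lin_asymp F w f \<alpha>" and w: "(w \<longlongrightarrow> 0) F"
  shows "(\<lambda>x. f x - 1) \<in> O[F](w)" "f \<in> O[F](\<lambda>_. 1)"
proof -
  have w1: "w \<in> O[F](\<lambda>_. 1)"
    using w by (intro bigoI_tendsto[of _ _ 0]) auto
  have ww: "w \<in> O[F](w)" by simp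
  have w2: "(\<lambda>x. (w x)\<^sup>2) \<in> O[F](w)"
    using landau_o.big.mult[OF w1 ww] by (simp add: power2_eq_square)
  have A: "(\<lambda>x. \<alpha> x * w x) \<in> O[F](w)"
    using landau_o.big.mult[OF assms(1)[unfolded lin_asymp_def, THEN conjunct1] ww] by simp
  have B: "(\<lambda>x. f x - 1 - \<alpha> x * w x) \<in> O[F](w)"
    using assms(1) w2 unfolding lin_asymp_def by (blast intro: landau_o.big_trans)
  from sum_in_bigo(1)[OF B A] show 1: "(\<lambda>x. f x - 1) \<in> O[F](w)" by simp
  hence C: "(\<lambda>x. f x - 1) \<in> O[F](\<lambda>_. 1)" using w1 by (rule landau_o.big_trans)
  have "(\<lambda>x. 1) \<in> O[F](\<lambda>_. 1 :: complex)" by simp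
  from sum_in_bigo(1)[OF C this] show "f \<in> O[F](\<lambda>_. 1)" by simp
qed

lemma lin_asymp_mult:
  assumes f: "lin_asymp F w f \<alpha>" and g: "lin_asymp F w g \<beta>" and w: "(w \<longlongrightarrow> 0) F"
  shows "lin_asymp F w (\<lambda>x. f x * g x) (\<lambda>x. \<alpha> x + \<beta> x)"
proof -
  have ab: "\<alpha> \<in> O[F](\<lambda>_. 1)" "\<beta> \<in> O[F](\<lambda>_. 1)" using f g by (auto simp: lin_asymp_def)
  have 1: "(\<lambda>x. (f x - 1 - \<alpha> x * w x) * g x) \<in> O[F](\<lambda>x. (w x)\<^sup>2 * 1)"
    using f lin_asymp_bounded(2)[OF g w] by (intro landau_o.big.mult) (auto simp: lin_asymp_def)
  have w1: "w \<in> O[F](\<lambda>_. 1)"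
    using w by (intro bigoI_tendsto[of _ _ 0]) auto
  have "(\<lambda>x. 1 + \<alpha> x * w x) \<in> O[F](\<lambda>_. 1)"
    using landau_o.big.mult[OF ab(1) w1] by (intro sum_in_bigo) auto
  hence 2: "(\<lambda>x. (1 + \<alpha> x * w x) * (g x - 1 - \<beta> x * w x)) \<in> O[F](\<lambda>x. 1 * (w x)\<^sup>2)"
    using g by (intro landau_o.big.mult) (auto simp: lin_asymp_def)
  have 3: "(\<lambda>x. (\<alpha> x * \<beta> x) * (w x)\<^sup>2) \<in> O[F](\<lambda>x. (1 * 1) * (w x)\<^sup>2)"
    by (intro landau_o.big.mult ab) auto
  have "(\<lambda>x. (f x - 1 - \<alpha> x * w x) * g x + (1 + \<alpha> x * w x) * (g x - 1 - \<beta> x * w x) + (\<alpha> x * \<beta> x) * (w x)\<^sup>2) \<in> O[F](\<lambda>x. (w x)\<^sup>2)"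
    using 1 2 3 by (intro sum_in_bigo) auto
  also have "(\<lambda>x. (f x - 1 - \<alpha> x * w x) * g x + (1 + \<alpha> x * w x) * (g x - 1 - \<beta> x * w x) + (\<alpha> x * \<beta> x) * (w x)\<^sup>2) =
     (\<lambda>x. f x * g x - 1 - (\<alpha> x + \<beta> x) * w x)"
    by (auto simp: algebra_simps power2_eq_square)
  finally show ?thesis using ab by (auto simp: lin_asymp_def intro: sum_in_bigo)
qed

lemma lin_asymp_inverse:
  assumes f: "lin_asymp F w f \<alpha>" and w: "(w \<longlongrightarrow> 0) F"
  shows "lin_asymp F w (\<lambda>x. inverse (f x)) (\<lambda>x. - \<alpha> x)"
proof -
  have a: "\<alpha> \<in> O[F](\<lambda>_. 1)" using f by (auto simp: lin_asymp_def)
  have f1: "(\<lambda>x. f x - 1) \<in> O[F](w)" by (rule lin_asymp_bounded[OF f w])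
  have "((\<lambda>x. f x - 1) \<longlongrightarrow> 0) F"
  proof -
    obtain C where C: "\<forall>\<^sub>F x in F. norm (f x - 1) \<le> C * norm (w x)" using f1 by (elim landau_o.bigE)
    have "((\<lambda>x. C * norm (w x)) \<longlongrightarrow> C * norm (0::complex)) F" using w by (intro tendsto_intros)
    thus ?thesis by (intro Lim_null_comparison[OF C]) simp
  qed
  hence lim: "(f \<longlongrightarrow> 1) F" by (rule LIM_zero_cancel)
  hence nz: "\<forall>\<^sub>F x in F. f x \<noteq> 0" using tendsto_imp_eventually_ne[OF lim, of 0] by simp
  have inv: "(\<lambda>x. inverse (f x)) \<in> O[F](\<lambda>_. 1)"
    using tendsto_inverse[OF lim] by (intro bigoI_tendsto[of _ _ 1]) auto
  have 1: "(\<lambda>x. (f x - 1 - \<alpha> x * w x) * inverse (f x)) \<in> O[F](\<lambda>x. (w x)\<^sup>2 * 1)"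
    using f inv by (intro landau_o.big.mult) (auto simp: lin_asymp_def)
  have 2: "(\<lambda>x. (\<alpha> x * w x) * (f x - 1) * inverse (f x)) \<in> O[F](\<lambda>x. (1 * w x) * w x * 1)"
    using a f1 inv by (intro landau_o.big.mult) auto
  have "(\<lambda>x. (\<alpha> x * w x) * (f x - 1) * inverse (f x) - (f x - 1 - \<alpha> x * w x) * inverse (f x)) \<in> O[F](\<lambda>x. (w x)\<^sup>2)"
    by (rule sum_in_bigo(2)) (use 1 2 in \<open>simp_all add: power2_eq_square\<close>)
  moreover have "\<forall>\<^sub>F x in F. (\<alpha> x * w x) * (f x - 1) * inverse (f x) - (f x - 1 - \<alpha> x * w x) * inverse (f x) =
      inverse (f x) - 1 - - \<alpha> x * w x"
    using nz by eventually_elim (simp add: field_simps)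
  ultimately have "(\<lambda>x. inverse (f x) - 1 - - \<alpha> x * w x) \<in> O[F](\<lambda>x. (w x)\<^sup>2)"
    by (subst (asm) landau_o.big.in_cong)
  thus ?thesis using a by (auto simp: lin_asymp_def)
qed

lemma lin_asymp_prod:
  assumes "finite I" "\<And>i. i \<in> I \<Longrightarrow> lin_asymp F w (f i) (\<alpha> i)" and w: "(w \<longlongrightarrow> 0) F"
  shows "lin_asymp F w (\<lambda>x. \<Prod>i\<in>I. f i x) (\<lambda>x. \<Sum>i\<in>I. \<alpha> i x)"
  using assms(1,2)
proof (induction I rule: finite_induct)
  case empty
  thus ?case by (simp add: lin_asymp_def)
next
  case (insert i I)
  thus ?case using lin_asymp_mult[OF _ _ w, of "f i" "\<alpha> i" "\<lambda>x. \<Prod>i\<in>I. f i x" "\<lambda>x. \<Sum>i\<in>I. \<alpha> i x"] by simp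
qed

lemma lin_asymp_ratio:
  fixes A B :: "'i \<Rightarrow> 'x \<Rightarrow> complex"
  assumes I: "finite I" and A: "\<And>i. i \<in> I \<Longrightarrow> A i \<in> O[F](\<lambda>_. 1)" and B: "\<And>i. i \<in> I \<Longrightarrow> B i \<in> O[F](\<lambda>_. 1)"
    and w: "(w \<longlongrightarrow> 0) F"
  shows "lin_asymp F w (\<lambda>x. \<Prod>i\<in>I. (1 + B i x * w x) * inverse (1 + A i x * w x)) (\<lambda>x. \<Sum>i\<in>I. B i x - A i x)"
  unfolding diff_conv_add_uminus
  by (intro lin_asymp_prod[OF I _ w] lin_asymp_mult[OF _ _ w] lin_asymp_inverse[OF _ w] lin_asymp_affine A B)

text \<open>The product is 1 + 2/z + O(1/z^2), and so is ((z + 1) / z)^2. The latter is chosen for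
  comparison because it telescopes along z, z + 1, z + 2, ..., while the factors 1 + K / |z|^2 have
  a convergent product there.\<close>

lemma ratio_bound_at_infinity:
  fixes a b :: "'i \<Rightarrow> complex"
  assumes I: "finite I" and s: "(\<Sum>i\<in>I. b i - a i) = 2"
  obtains K R where "K \<ge> 0" "R \<ge> 1"
    "\<And>z. norm z \<ge> R \<Longrightarrow> (\<forall>i\<in>I. a i + z \<noteq> 0) \<and>
       norm (\<Prod>i\<in>I. (b i + z) / (a i + z)) \<le> norm ((z + 1) / z) ^ 2 * (1 + K / norm z ^ 2)"
proof -
  define w where "w = (\<lambda>z::complex. inverse z)"
  have w: "(w \<longlongrightarrow> 0) at_infinity" unfolding w_def by (rule tendsto_inverse_0)
  define f where "f = (\<lambda>z. \<Prod>i\<in>I. (1 + b i * w z) * inverse (1 + a i * w z))"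
  have f: "lin_asymp at_infinity w f (\<lambda>_. 2)"
    using lin_asymp_ratio[OF I _ _ w, of "\<lambda>i _. a i" "\<lambda>i _. b i"] s by (simp add: f_def)
  have "lin_asymp at_infinity w (\<lambda>z. inverse (1 + 1 * w z)) (\<lambda>_. - 1)"
    by (intro lin_asymp_inverse[OF _ w] lin_asymp_affine) auto
  hence "lin_asymp at_infinity w (\<lambda>z. f z * (inverse (1 + 1 * w z) * inverse (1 + 1 * w z))) (\<lambda>_. 2 + (- 1 + - 1))"
    by (intro lin_asymp_mult[OF _ _ w] f)
  hence "(\<lambda>z. f z * (inverse (1 + w z) * inverse (1 + w z)) - 1) \<in> O[at_infinity](\<lambda>z. (w z)\<^sup>2)"
    by (simp add: lin_asymp_def)
  then obtain K where K: "K > 0"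
    "\<forall>\<^sub>F z in at_infinity. norm (f z * (inverse (1 + w z) * inverse (1 + w z)) - 1) \<le> K * norm ((w z)\<^sup>2)"
    by (elim landau_o.bigE) auto
  then obtain R0 where R0: "\<And>z. norm z \<ge> R0 \<Longrightarrow> norm (f z * (inverse (1 + w z) * inverse (1 + w z)) - 1) \<le> K * norm ((w z)\<^sup>2)"
    by (auto simp: eventually_at_infinity)
  define R where "R = max 2 (max R0 (1 + (\<Sum>i\<in>I. norm (a i))))"
  have "(\<forall>i\<in>I. a i + z \<noteq> 0) \<and> norm (\<Prod>i\<in>I. (b i + z) / (a i + z)) \<le> norm ((z + 1) / z) ^ 2 * (1 + K / norm z ^ 2)"
    if z: "norm z \<ge> R" for z
  proof
    have z0: "z \<noteq> 0" and z1: "z + 1 \<noteq> 0" using z by (auto simp: R_def add_eq_0_iff2)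
    show "\<forall>i\<in>I. a i + z \<noteq> 0"
    proof
      fix i assume "i \<in> I"
      hence "norm (a i) \<le> (\<Sum>i\<in>I. norm (a i))" using I by (intro member_le_sum) auto
      hence "norm (a i) < norm z" using z by (simp add: R_def)
      thus "a i + z \<noteq> 0" by (auto simp: add_eq_0_iff)
    qed
    have fz: "f z = (\<Prod>i\<in>I. (b i + z) / (a i + z))"
      unfolding f_def w_def
    proof (rule prod.cong)
      fix i
      have "1 + b i * inverse z = (b i + z) / z" "1 + a i * inverse z = (a i + z) / z" using z0 by (auto simp: field_simps)
      thus "(1 + b i * inverse z) * inverse (1 + a i * inverse z) = (b i + z) / (a i + z)" using z0 by simp
    qed simp
    define u where "u = f z * (inverse (1 + w z) * inverse (1 + w z))"
    have wz: "1 + w z = (z + 1) / z" using z0 by (simp add: w_def field_simps)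
    have "f z = ((z + 1) / z)^2 * u" unfolding u_def wz using z0 z1 by (simp add: power2_eq_square)
    hence "norm (f z) = norm ((z + 1) / z) ^ 2 * norm u" by (simp add: norm_mult norm_power)
    also have "norm u \<le> 1 + norm (u - 1)" using norm_triangle_ineq[of 1 "u - 1"] by simp
    also have "norm (u - 1) \<le> K / norm z ^ 2"
      using R0[of z] z unfolding u_def[symmetric] by (simp add: R_def w_def norm_power norm_inverse divide_inverse power_inverse)
    finally show "norm (\<Prod>i\<in>I. (b i + z) / (a i + z)) \<le> norm ((z + 1) / z) ^ 2 * (1 + K / norm z ^ 2)"
      by (simp add: fz mult_left_mono)
  qed
  moreover have "K \<ge> 0" "R \<ge> 1" using K by (auto simp: R_def)
  ultimately show ?thesis using that by blast
qed

lemma summable_inverse_squares_plus: "summable (\<lambda>k. 1 / (1 + real k ^ 2))"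
proof (rule summable_comparison_test'[of "\<lambda>k. 2 * (1 + real k) powr (- 2)" 0])
  show "summable (\<lambda>k. 2 * (1 + real k) powr - 2)" by (intro summable_mult summable_one_plus_powr) auto
  show "norm (1 / (1 + real k ^ 2)) \<le> 2 * (1 + real k) powr - 2" for k
  proof -
    have 1: "(1 + real k)^2 \<le> 2 * (1 + real k ^ 2)" using sum_squares_bound[of 1 "real k"] by (simp add: power2_eq_square algebra_simps)
    have 2: "(1 + real k) powr - 2 = 1 / (1 + real k)^2" by (simp add: powr_minus divide_inverse)
    have "0 < (1 + real k)^2" "0 < 1 + real k ^ 2" by (auto intro: add_pos_nonneg)
    with 1 have "1 / (1 + real k ^ 2) \<le> 2 * (1 / (1 + real k)^2)" by (simp add: divide_simps mult.commute)
    thus ?thesis unfolding 2 by (simp add: add_nonneg_nonneg)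
  qed
qed

text \<open>This takes the place of Stirling's formula in the right half-plane: the quotient of the
  two products is the limit of N^-2 times a quotient of Pochhammer symbols, whose factors telescope
  to |z + N|^2 / |z|^2 up to a bounded constant.\<close>

lemma rGamma_prod_bound:
  fixes a b :: "'i \<Rightarrow> complex"
  assumes I: "finite I" and s: "(\<Sum>i\<in>I. b i - a i) = 2"
  obtains E R where "E \<ge> 0" "R \<ge> 1"
    "\<And>z. Re z \<ge> 0 \<Longrightarrow> norm z \<ge> R \<Longrightarrow> norm (\<Prod>i\<in>I. rGamma (b i + z)) \<le> E / norm z ^ 2 * norm (\<Prod>i\<in>I. rGamma (a i + z))"
proof -
  obtain K R where KR: "K \<ge> 0" "R \<ge> 1"
    "\<And>z. norm z \<ge> R \<Longrightarrow> (\<forall>i\<in>I. a i + z \<noteq> 0) \<and>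
       norm (\<Prod>i\<in>I. (b i + z) / (a i + z)) \<le> norm ((z + 1) / z) ^ 2 * (1 + K / norm z ^ 2)"
    using ratio_bound_at_infinity[OF I s] by blast
  define Z where "Z = (\<Sum>k. 1 / (1 + real k ^ 2))"
  define E where "E = exp (K * Z)"
  have main: "norm (\<Prod>i\<in>I. rGamma (b i + z)) \<le> E / norm z ^ 2 * norm (\<Prod>i\<in>I. rGamma (a i + z))"
    if z: "Re z \<ge> 0" "norm z \<ge> R" for z
  proof -
    have z0: "z \<noteq> 0" using z KR(2) by auto
    \<comment> \<open>For Re z \<ge> 0 the points z + k move away from the origin, which bounds the
      sum of K / |z + k|^2 independently of z.\<close>
    have nk: "norm (z + of_nat k) ^ 2 \<ge> norm z ^ 2 + real k ^ 2" for k
    proof -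
      have "norm z ^ 2 + real k ^ 2 \<le> (Re z + real k)^2 + (Im z)^2"
        unfolding cmod_power2 using z(1) by (simp add: power2_eq_square algebra_simps)
      thus ?thesis by (simp add: cmod_power2)
    qed
    have nk1: "norm (z + of_nat k) ^ 2 \<ge> 1 + real k ^ 2" for k
    proof -
      have "1 \<le> norm z ^ 2" using z(2) KR(2) by (simp add: one_le_power)
      thus ?thesis using nk[of k] by linarith
    qed
    have nR: "norm (z + of_nat k) \<ge> R" for k
    proof -
      have "R ^ 2 \<le> norm z ^ 2" using z KR(2) by (intro power_mono) auto
      also have "\<dots> \<le> norm (z + of_nat k) ^ 2" using nk[of k] by (simp add: order_trans[OF _ nk])
      finally show ?thesis using KR(2) by (simp add: power2_le_iff_abs_le)
    qed
    define P where "P N = (\<Prod>i\<in>I. pochhammer (b i + z) N / pochhammer (a i + z) N)" for N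
    have nza: "a i + z + of_nat k \<noteq> 0" if "i \<in> I" for i k
      using KR(3)[OF nR[of k]] that by (simp add: add_ac)
    have pnz: "pochhammer (a i + z) N \<noteq> 0" if "i \<in> I" for i N
      using nza[OF that] by (auto simp: pochhammer_eq_0_iff add_eq_0_iff2)
    have P_Suc: "P (Suc N) = P N * (\<Prod>i\<in>I. (b i + (z + of_nat N)) / (a i + (z + of_nat N)))" for N
      by (simp add: P_def pochhammer_Suc add_ac flip: prod.distrib)
    have Pbd: "norm (P N) \<le> norm (z + of_nat N) ^ 2 / norm z ^ 2 * exp (\<Sum>k<N. K * (1 / (1 + real k ^ 2)))" for N
    proof (induction N)
      case 0
      thus ?case using z0 by (simp add: P_def)
    next
      case (Suc N)
      define y where "y = z + of_nat N"
      have "R \<le> norm y" using nR[of N] by (simp add: y_def)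
      hence y0: "norm y > 0" using KR(2) by linarith
      have "norm (\<Prod>i\<in>I. (b i + y) / (a i + y)) \<le> norm ((y + 1) / y) ^ 2 * (1 + K / norm y ^ 2)"
        using KR(3)[OF nR[of N]] by (simp add: y_def)
      also have "\<dots> \<le> norm ((y + 1) / y) ^ 2 * exp (K * (1 / (1 + real N ^ 2)))"
      proof (intro mult_left_mono)
        have "K / norm y ^ 2 \<le> K / (1 + real N ^ 2)"
          using KR(1) nk1[of N] by (intro frac_le) (auto simp: y_def intro: add_pos_nonneg)
        thus "1 + K / norm y ^ 2 \<le> exp (K * (1 / (1 + real N ^ 2)))"
          using exp_ge_add_one_self[of "K / (1 + real N ^ 2)"]
          by (simp only: times_divide_eq_right mult_1_right)
      qed auto
      finally have 1: "norm (\<Prod>i\<in>I. (b i + y) / (a i + y)) \<le> norm ((y + 1) / y) ^ 2 * exp (K * (1 / (1 + real N ^ 2)))" .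
      have "norm (P (Suc N)) = norm (P N) * norm (\<Prod>i\<in>I. (b i + y) / (a i + y))"
        unfolding P_Suc y_def by (rule norm_mult)
      also have "\<dots> \<le> (norm y ^ 2 / norm z ^ 2 * exp (\<Sum>k<N. K * (1 / (1 + real k ^ 2)))) * (norm ((y + 1) / y) ^ 2 * exp (K * (1 / (1 + real N ^ 2))))"
        using Suc 1 by (intro mult_mono) (auto simp: y_def)
      also have "\<dots> = (norm y ^ 2 * norm ((y + 1) / y) ^ 2) / norm z ^ 2 * exp (\<Sum>k<Suc N. K * (1 / (1 + real k ^ 2)))"
        by (simp add: exp_add)
      also have "norm y ^ 2 * norm ((y + 1) / y) ^ 2 = norm (z + of_nat (Suc N)) ^ 2"
        using y0 by (simp add: norm_divide power_divide y_def add_ac)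
      finally show ?case .
    qed
    have Pbd': "norm (P N) \<le> norm (z + of_nat N) ^ 2 * (E / norm z ^ 2)" for N
    proof -
      have "(\<Sum>k<N. K * (1 / (1 + real k ^ 2))) \<le> K * Z"
        unfolding sum_distrib_left[symmetric] Z_def using KR(1)
        by (intro mult_left_mono sum_le_suminf summable_inverse_squares_plus) (auto intro: add_nonneg_nonneg)
      hence "exp (\<Sum>k<N. K * (1 / (1 + real k ^ 2))) \<le> E" by (simp add: E_def)
      hence "norm (z + of_nat N) ^ 2 / norm z ^ 2 * exp (\<Sum>k<N. K * (1 / (1 + real k ^ 2))) \<le> norm (z + of_nat N) ^ 2 / norm z ^ 2 * E"
        by (intro mult_left_mono) auto
      with Pbd[of N] show ?thesis by simp
    qed
    define r where "r = norm (\<Prod>i\<in>I. rGamma (a i + z))"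
    have "(\<lambda>N. \<Prod>i\<in>I. pochhammer (b i + z) N * rGamma (a i + z + of_nat N) * npow (a i + z - (b i + z)) N) \<longlonglongrightarrow> (\<Prod>i\<in>I. rGamma (b i + z))"
      by (intro tendsto_prod pochhammer_rGamma_asymp)
    hence L: "(\<lambda>N. norm (\<Prod>i\<in>I. pochhammer (b i + z) N * rGamma (a i + z + of_nat N) * npow (a i + z - (b i + z)) N)) \<longlonglongrightarrow> norm (\<Prod>i\<in>I. rGamma (b i + z))"
      by (rule tendsto_norm)
    have "(\<lambda>N. norm ((z + of_nat N) / of_nat N) ^ 2 * (E / norm z ^ 2) * r) \<longlonglongrightarrow> norm (1::complex) ^ 2 * (E / norm z ^ 2) * r"
      by (intro tendsto_intros add_of_nat_over_of_nat_tendsto)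
    hence U: "(\<lambda>N. norm ((z + of_nat N) / of_nat N) ^ 2 * (E / norm z ^ 2) * r) \<longlonglongrightarrow> E / norm z ^ 2 * r" by simp
    have "norm (\<Prod>i\<in>I. rGamma (b i + z)) \<le> E / norm z ^ 2 * r"
    proof (rule LIMSEQ_le[OF L U], intro exI[of _ 1] allI impI)
      fix N :: nat assume N: "1 \<le> N"
      have np: "(\<Prod>i\<in>I. npow (a i + z - (b i + z)) N) = npow (- 2) N"
      proof -
        have "(\<Prod>i\<in>J. npow (a i + z - (b i + z)) N) = npow (- (\<Sum>i\<in>J. b i - a i)) N" if "finite J" for J
          using that by (induction J rule: finite_induct) (simp_all flip: npow_add)
        from this[OF I] show ?thesis by (simp add: s)
      qed
      have "(\<Prod>i\<in>I. pochhammer (b i + z) N * rGamma (a i + z + of_nat N)) = P N * (\<Prod>i\<in>I. rGamma (a i + z))"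
        unfolding P_def prod.distrib[symmetric]
      proof (rule prod.cong)
        fix i assume "i \<in> I"
        thus "pochhammer (b i + z) N * rGamma (a i + z + of_nat N) = pochhammer (b i + z) N / pochhammer (a i + z) N * rGamma (a i + z)"
          using pnz[of i N] by (simp add: pochhammer_rGamma[of "a i + z" N])
      qed simp
      hence "(\<Prod>i\<in>I. pochhammer (b i + z) N * rGamma (a i + z + of_nat N) * npow (a i + z - (b i + z)) N) =
         P N * (\<Prod>i\<in>I. rGamma (a i + z)) * npow (- 2) N"
        by (simp only: prod.distrib np)
      hence "norm (\<Prod>i\<in>I. pochhammer (b i + z) N * rGamma (a i + z + of_nat N) * npow (a i + z - (b i + z)) N) =
        norm (P N) * r * (1 / real N ^ 2)"
        using N by (simp add: norm_mult r_def norm_npow powr_minus divide_inverse)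
      also have "\<dots> \<le> norm (z + of_nat N) ^ 2 * (E / norm z ^ 2) * r * (1 / real N ^ 2)"
        using Pbd'[of N] by (intro mult_right_mono) (auto simp: r_def)
      also have "\<dots> = norm ((z + of_nat N) / of_nat N) ^ 2 * (E / norm z ^ 2) * r"
        by (simp add: norm_divide power_divide)
      finally show "norm (\<Prod>i\<in>I. pochhammer (b i + z) N * rGamma (a i + z + of_nat N) * npow (a i + z - (b i + z)) N) \<le>
         norm ((z + of_nat N) / of_nat N) ^ 2 * (E / norm z ^ 2) * r" .
    qed
    thus ?thesis by (simp add: r_def)
  qed
  moreover have "E \<ge> 0" by (simp add: E_def)
  ultimately show ?thesis using that KR(2) by blast
qed

subsection \<open>The bilateral sum over a Gamma quotient\<close>

definition Phi :: "(nat \<Rightarrow> complex) \<Rightarrow> (nat \<Rightarrow> complex) \<Rightarrow> complex \<Rightarrow> complex" where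
  "Phi a b s = (\<Prod>i<4. rGamma (b i + s) * rGamma (1 - a i - s))"

lemma norm_sinpi_le: "norm (sinpi z) \<le> exp (pi * \<bar>Im z\<bar>)"
  using cmod_sin_le_exp[of 1 "of_real pi * z"] by (simp add: sinpi_def abs_mult)

text \<open>Replacing all b by a gains a factor of order |z|^-2; the reflection formula then turns
  the product into four sines, each of order exp(pi |Im z|).\<close>

lemma Phi_bound_right:
  assumes s: "(\<Sum>i<4. b i - a i) = 2"
  obtains E R where "E \<ge> 0" "R \<ge> 1"
    "\<And>z. Re z \<ge> 0 \<Longrightarrow> norm z \<ge> R \<Longrightarrow> norm (Phi a b z) \<le> E * exp (4 * pi * \<bar>Im z\<bar>) / norm z ^ 2"
proof -
  obtain E R where ER: "E \<ge> 0" "R \<ge> 1"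
    "\<And>z. Re z \<ge> 0 \<Longrightarrow> norm z \<ge> R \<Longrightarrow> norm (\<Prod>i<4. rGamma (b i + z)) \<le> E / norm z ^ 2 * norm (\<Prod>i<4. rGamma (a i + z))"
    using rGamma_prod_bound[OF finite_lessThan s] by blast
  define C where "C = (\<Prod>i<(4::nat). exp (pi * \<bar>Im (a i)\<bar>) / pi)"
  have C: "C \<ge> 0" unfolding C_def by (intro prod_nonneg) auto
  have "norm (Phi a b z) \<le> (E * C) * exp (4 * pi * \<bar>Im z\<bar>) / norm z ^ 2" if z: "Re z \<ge> 0" "norm z \<ge> R" for z
  proof -
    have "norm (Phi a b z) = norm (\<Prod>i<4. rGamma (b i + z)) * norm (\<Prod>i<4. rGamma (1 - a i - z))"
      by (simp only: Phi_def prod.distrib norm_mult)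
    also have "\<dots> \<le> (E / norm z ^ 2 * norm (\<Prod>i<4. rGamma (a i + z))) * norm (\<Prod>i<4. rGamma (1 - a i - z))"
      using ER(3)[OF z] by (intro mult_right_mono) auto
    also have "\<dots> = E / norm z ^ 2 * norm (\<Prod>i<4. rGamma (a i + z) * rGamma (1 - a i - z))"
      by (simp only: prod.distrib norm_mult mult.assoc)
    also have "\<dots> = E / norm z ^ 2 * (\<Prod>i<4. norm (sinpi (a i + z)) / pi)"
    proof -
      have "rGamma (a i + z) * rGamma (1 - a i - z) = sinpi (a i + z) / of_real pi" for i
        by (intro rGamma_reflection_sinpi) simp
      thus ?thesis by (simp add: norm_divide prod_norm[symmetric])
    qed
    also have "\<dots> \<le> E / norm z ^ 2 * (\<Prod>i<4. exp (pi * \<bar>Im (a i)\<bar>) / pi * exp (pi * \<bar>Im z\<bar>))"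
    proof (intro mult_left_mono prod_mono conjI)
      fix i
      have "norm (sinpi (a i + z)) \<le> exp (pi * \<bar>Im (a i + z)\<bar>)" by (rule norm_sinpi_le)
      also have "\<dots> \<le> exp (pi * (\<bar>Im (a i)\<bar> + \<bar>Im z\<bar>))" by simp
      also have "\<dots> = exp (pi * \<bar>Im (a i)\<bar>) * exp (pi * \<bar>Im z\<bar>)" by (simp add: ring_distribs exp_add)
      finally show "norm (sinpi (a i + z)) / pi \<le> exp (pi * \<bar>Im (a i)\<bar>) / pi * exp (pi * \<bar>Im z\<bar>)"
        by (simp add: divide_right_mono)
    qed (use ER in auto)
    also have "(\<Prod>i<(4::nat). exp (pi * \<bar>Im (a i)\<bar>) / pi * exp (pi * \<bar>Im z\<bar>)) = C * exp (4 * pi * \<bar>Im z\<bar>)"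
    proof -
      have "exp (4 * pi * \<bar>Im z\<bar>) = exp (pi * \<bar>Im z\<bar>) ^ 4"
        using exp_of_nat_mult[of 4 "pi * \<bar>Im z\<bar>"] by (simp add: mult.assoc)
      thus ?thesis unfolding prod.distrib C_def by simp
    qed
    finally show ?thesis by (simp add: mult_ac)
  qed
  moreover have "E * C \<ge> 0" using ER C by simp
  ultimately show ?thesis using that ER(2) by blast
qed

lemma Phi_reflect: "Phi a b (- z) = Phi (\<lambda>i. 1 - b i) (\<lambda>i. 1 - a i) z"
  by (simp add: Phi_def mult.commute)

text \<open>Changing the sign of z exchanges the two families of Gammas and preserves the sum
  condition, which settles the left half-plane.\<close>

lemma Phi_bound:
  assumes s: "(\<Sum>i<4. b i - a i) = 2"
  obtains E R where "E \<ge> 0" "R \<ge> 1"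
    "\<And>z. norm z \<ge> R \<Longrightarrow> norm (Phi a b z) \<le> E * exp (4 * pi * \<bar>Im z\<bar>) / norm z ^ 2"
proof -
  obtain E1 R1 where 1: "E1 \<ge> 0" "R1 \<ge> 1"
    "\<And>z. Re z \<ge> 0 \<Longrightarrow> norm z \<ge> R1 \<Longrightarrow> norm (Phi a b z) \<le> E1 * exp (4 * pi * \<bar>Im z\<bar>) / norm z ^ 2"
    using Phi_bound_right[OF s] by blast
  have s': "(\<Sum>i<4. (1 - a i) - (1 - b i)) = 2" using s by simp
  obtain E2 R2 where 2: "E2 \<ge> 0" "R2 \<ge> 1"
    "\<And>z. Re z \<ge> 0 \<Longrightarrow> norm z \<ge> R2 \<Longrightarrow> norm (Phi (\<lambda>i. 1 - b i) (\<lambda>i. 1 - a i) z) \<le> E2 * exp (4 * pi * \<bar>Im z\<bar>) / norm z ^ 2"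
    using Phi_bound_right[OF s'] by blast
  have mono: "E * exp (4 * pi * \<bar>Im z\<bar>) / norm z ^ 2 \<le> (E1 + E2) * exp (4 * pi * \<bar>Im z\<bar>) / norm z ^ 2" if "E \<le> E1 + E2" for E z
    using that by (intro divide_right_mono mult_right_mono) auto
  have "norm (Phi a b z) \<le> (E1 + E2) * exp (4 * pi * \<bar>Im z\<bar>) / norm z ^ 2" if z: "norm z \<ge> max R1 R2" for z
  proof (cases "Re z \<ge> 0")
    case True
    show ?thesis using 1(3)[OF True] mono[of E1 z] z 2(1) by force
  next
    case False
    have "norm (Phi (\<lambda>i. 1 - b i) (\<lambda>i. 1 - a i) (- z)) \<le> E2 * exp (4 * pi * \<bar>Im z\<bar>) / norm z ^ 2"
      using 2(3)[of "- z"] False z by simp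
    thus ?thesis using Phi_reflect[of a b "- z"] mono[of E2 z] 1(1) by simp
  qed
  moreover have "E1 + E2 \<ge> 0" "max R1 R2 \<ge> 1" using 1 2 by auto
  ultimately show ?thesis using that by blast
qed

lemma holomorphic_Phi: "Phi a b holomorphic_on A"
  unfolding Phi_def by (intro holomorphic_intros)

text \<open>The sum of \<open>Phi a b (s + n)\<close> over all integers \<open>n\<close>.\<close>

definition Tsum :: "(nat \<Rightarrow> complex) \<Rightarrow> (nat \<Rightarrow> complex) \<Rightarrow> complex \<Rightarrow> complex" where
  "Tsum a b s = (\<Sum>n. Phi a b (s + of_nat n)) + (\<Sum>n. Phi a b (s - 1 - of_nat n))"

lemma Phi_uniform:
  assumes s: "(\<Sum>i<4. b i - a i) = 2"
  obtains M where "summable M"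
    "\<forall>\<^sub>F n in sequentially. \<forall>z\<in>cball 0 r. norm (Phi a b (z + of_nat n)) \<le> M n"
    "\<forall>\<^sub>F n in sequentially. \<forall>z\<in>cball 0 r. norm (Phi a b (z - 1 - of_nat n)) \<le> M n"
proof -
  obtain E R where ER: "E \<ge> 0" "R \<ge> 1"
    "\<And>z. norm z \<ge> R \<Longrightarrow> norm (Phi a b z) \<le> E * exp (4 * pi * \<bar>Im z\<bar>) / norm z ^ 2"
    using Phi_bound[OF s] by blast
  define M where "M n = E * exp (4 * pi * r) * 4 * (1 / real n ^ 2)" for n
  have sM: "summable M"
    unfolding M_def using inverse_power_summable[of 2, where 'a = real] by (intro summable_mult) (simp add: divide_inverse)
  have bd: "norm (Phi a b y) \<le> M n" if "norm y \<ge> real n / 2" "\<bar>Im y\<bar> \<le> r" "real n \<ge> 2 * R" for y n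
  proof -
    have n: "real n > 0" using that ER by linarith
    have "norm (Phi a b y) \<le> E * exp (4 * pi * \<bar>Im y\<bar>) / norm y ^ 2" using that by (intro ER) linarith
    also have "\<dots> \<le> E * exp (4 * pi * r) / (real n / 2) ^ 2"
      using that n ER(1) by (intro frac_le mult_left_mono power_mono) auto
    also have "\<dots> = M n" by (simp add: M_def power_divide)
    finally show ?thesis .
  qed
  obtain N :: nat where N: "real N > 2 * R + 2 * \<bar>r\<bar> + 2" using reals_Archimedean2 by blast
  have "\<forall>\<^sub>F n in sequentially. \<forall>z\<in>cball 0 r. norm (Phi a b (z + of_nat n)) \<le> M n"
  proof (rule eventually_mono[OF eventually_ge_at_top[of N]], intro ballI bd)
    fix n :: nat and z :: complex assume n: "N \<le> n" and "z \<in> cball 0 r"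
    hence z: "norm z \<le> r" by simp
    have rn: "real n > 2 * R + 2 * \<bar>r\<bar> + 2" "R \<ge> 1" using N n ER(2) by linarith+
    have "real n \<le> norm (z + of_nat n) + norm z" using norm_triangle_ineq4[of "z + of_nat n" z] by simp
    thus "real n / 2 \<le> norm (z + of_nat n)" using rn z by linarith
    show "\<bar>Im (z + of_nat n)\<bar> \<le> r" using abs_Im_le_cmod[of z] z by simp
    show "2 * R \<le> real n" using rn by linarith
  qed
  moreover have "\<forall>\<^sub>F n in sequentially. \<forall>z\<in>cball 0 r. norm (Phi a b (z - 1 - of_nat n)) \<le> M n"
  proof (rule eventually_mono[OF eventually_ge_at_top[of N]], intro ballI bd)
    fix n :: nat and z :: complex assume n: "N \<le> n" and "z \<in> cball 0 r"
    hence z: "norm z \<le> r" by simp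
    have rn: "real n > 2 * R + 2 * \<bar>r\<bar> + 2" "R \<ge> 1" using N n ER(2) by linarith+
    have "real n \<le> norm (z - 1 - of_nat n) + norm (z - 1)" using norm_triangle_ineq4[of "z - 1" "z - 1 - of_nat n"] by simp
    moreover have "norm (z - 1) \<le> norm z + 1" using norm_triangle_ineq4[of z 1] by simp
    ultimately show "real n / 2 \<le> norm (z - 1 - of_nat n)" using rn z by linarith
    show "\<bar>Im (z - 1 - of_nat n)\<bar> \<le> r" using abs_Im_le_cmod[of z] z by simp
    show "2 * R \<le> real n" using rn by linarith
  qed
  ultimately show ?thesis using that sM by blast
qed

lemma summable_Phi:
  assumes s: "(\<Sum>i<4. b i - a i) = 2"
  shows "summable (\<lambda>n. Phi a b (z + of_nat n))" "summable (\<lambda>n. Phi a b (z - 1 - of_nat n))"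
proof -
  obtain M where M: "summable M"
    "\<forall>\<^sub>F n in sequentially. \<forall>y\<in>cball 0 (norm z). norm (Phi a b (y + of_nat n)) \<le> M n"
    "\<forall>\<^sub>F n in sequentially. \<forall>y\<in>cball 0 (norm z). norm (Phi a b (y - 1 - of_nat n)) \<le> M n"
    using Phi_uniform[OF s, of "norm z"] by blast
  show "summable (\<lambda>n. Phi a b (z + of_nat n))"
    by (rule summable_comparison_test_ev[OF eventually_mono[OF M(2)] M(1)]) auto
  show "summable (\<lambda>n. Phi a b (z - 1 - of_nat n))"
    by (rule summable_comparison_test_ev[OF eventually_mono[OF M(3)] M(1)]) auto
qed

lemma holomorphic_Tsum:
  assumes s: "(\<Sum>i<4. b i - a i) = 2"
  shows "Tsum a b holomorphic_on UNIV"
proof -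
  let ?f = "\<lambda>N z. (\<Sum>n<N. Phi a b (z + of_nat n)) + (\<Sum>n<N. Phi a b (z - 1 - of_nat n))"
  show ?thesis
  proof (rule holomorphic_uniform_sequence[where f = ?f])
  have c: "(\<lambda>z. Phi a b (g z)) holomorphic_on UNIV" if "g holomorphic_on UNIV" for g
    using holomorphic_on_compose_gen[OF that holomorphic_Phi[of a b UNIV]] by (simp add: o_def)
  show "(\<lambda>z. (\<Sum>n<N. Phi a b (z + of_nat n)) + (\<Sum>n<N. Phi a b (z - 1 - of_nat n))) holomorphic_on UNIV" for N
    by (intro holomorphic_on_add holomorphic_on_sum c holomorphic_intros)
  fix x :: complex
  define r where "r = norm x + 1"
  obtain M where M: "summable M"
    "\<forall>\<^sub>F n in sequentially. \<forall>y\<in>cball 0 r. norm (Phi a b (y + of_nat n)) \<le> M n"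
    "\<forall>\<^sub>F n in sequentially. \<forall>y\<in>cball 0 r. norm (Phi a b (y - 1 - of_nat n)) \<le> M n"
    using Phi_uniform[OF s, of r] by blast
  have "uniform_limit (cball 0 r) ?f (Tsum a b) sequentially"
    unfolding Tsum_def by (intro uniform_limit_add Weierstrass_m_test_ev[OF _ M(1)] M)
  moreover have "cball x 1 \<subseteq> cball 0 r"
  proof
    fix y assume "y \<in> cball x 1"
    thus "y \<in> cball 0 r" using norm_triangle_ineq4[of x "x - y"] by (simp add: r_def dist_norm)
  qed
  ultimately have "uniform_limit (cball x 1) ?f (Tsum a b) sequentially"
    by (rule uniform_limit_on_subset)
  thus "\<exists>d>0. cball x d \<subseteq> UNIV \<and> uniform_limit (cball x d) ?f (Tsum a b) sequentially"
    by (intro exI[of _ 1]) auto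
  qed auto
qed

lemma Tsum_plus_1:
  assumes s: "(\<Sum>i<4. b i - a i) = 2"
  shows "Tsum a b (z + 1) = Tsum a b z"
proof -
  have "(\<Sum>n. Phi a b (z + of_nat (Suc n))) = (\<Sum>n. Phi a b (z + of_nat n)) - Phi a b (z + of_nat 0)"
    by (rule suminf_split_head) (rule summable_Phi[OF s])
  moreover have "(\<Sum>n. Phi a b (z - of_nat (Suc n))) = (\<Sum>n. Phi a b (z - of_nat n)) - Phi a b (z - of_nat 0)"
    by (rule suminf_split_head) (use summable_Phi(2)[OF s, of "z + 1"] in simp)
  moreover have "(\<lambda>n. Phi a b (z + 1 + of_nat n)) = (\<lambda>n. Phi a b (z + of_nat (Suc n)))"
    "(\<lambda>n. Phi a b (z - 1 - of_nat n)) = (\<lambda>n. Phi a b (z - of_nat (Suc n)))" by (simp_all add: algebra_simps)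
  ultimately show ?thesis
    unfolding Tsum_def by simp
qed

lemma Tsum_plus_int:
  assumes s: "(\<Sum>i<4. b i - a i) = 2"
  shows "Tsum a b (z + of_int n) = Tsum a b z"
proof -
  have nat: "Tsum a b (z + of_nat k) = Tsum a b z" for z k
  proof (induction k)
    case (Suc k)
    thus ?case using Tsum_plus_1[OF s, of "z + of_nat k"] by (simp add: add_ac)
  qed simp
  show ?thesis
  proof (cases "n \<ge> 0")
    case True
    thus ?thesis using nat[of z "nat n"] by simp
  next
    case False
    thus ?thesis using nat[of "z + of_int n" "nat (- n)"] by simp
  qed
qed

text \<open>The negative power of |Im z| is what later excludes exp(+-4 pi i z). It comes from
  bounding 1 / (n^2 + y^2) by a multiple of y^(-1/2) (1 + n)^(-3/2), which is still summable in
  n.\<close>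

lemma Tsum_growth:
  assumes s: "(\<Sum>i<4. b i - a i) = 2"
  obtains E R where "R \<ge> 1" "E \<ge> 0"
    "\<And>z. \<bar>Im z\<bar> \<ge> R \<Longrightarrow> norm (Tsum a b z) \<le> E * exp (4 * pi * \<bar>Im z\<bar>) * \<bar>Im z\<bar> powr (- 1 / 2)"
proof -
  obtain E R where ER: "E \<ge> 0" "R \<ge> 1"
    "\<And>z. norm z \<ge> R \<Longrightarrow> norm (Phi a b z) \<le> E * exp (4 * pi * \<bar>Im z\<bar>) / norm z ^ 2"
    using Phi_bound[OF s] by blast
  define C where "C = (\<Sum>n. (1 + real n) powr (- 3 / 2))"
  have sC: "summable (\<lambda>n. (1 + real n) powr (- 3 / 2))" by (intro summable_one_plus_powr) auto
  have half: "norm (suminf (\<lambda>n. Phi a b (f n))) \<le> 2 * E * C * exp (4 * pi * y) * y powr (- 1 / 2)"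
    if f: "\<And>n. \<bar>Im (f n)\<bar> = y" "\<And>n. \<bar>Re (f n)\<bar> \<ge> real n" and y: "y \<ge> R" for f y
  proof -
    have y1: "y \<ge> 1" using y ER by simp
    have bd: "norm (Phi a b (f n)) \<le> 2 * E * exp (4 * pi * y) * y powr (- 1 / 2) * (1 + real n) powr (- 3 / 2)" for n
    proof -
      have q: "norm (f n) ^ 2 = \<bar>Re (f n)\<bar> ^ 2 + y ^ 2" by (simp add: cmod_power2 f(1)[of n, symmetric])
      have "real n ^ 2 \<le> \<bar>Re (f n)\<bar> ^ 2" using f(2)[of n] by (intro power_mono) auto
      hence q2: "norm (f n) ^ 2 \<ge> real n ^ 2 + y ^ 2" by (simp add: q)
      have "norm (f n) \<ge> y" using abs_Im_le_cmod[of "f n"] f(1)[of n] by simp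
      hence nR: "norm (f n) \<ge> R" using y by simp
      have n0: "norm (f n) > 0" using nR ER by linarith
      have yy: "1 \<le> y ^ 2" using y1 by (simp add: one_le_power)
      have "(1 + real n) ^ 2 \<le> 2 * (1 + real n ^ 2)" using sum_squares_bound[of 1 "real n"] by (simp add: power2_eq_square algebra_simps)
      also have "\<dots> \<le> 2 * norm (f n) ^ 2" using yy by (intro mult_left_mono order_trans[OF _ q2]) auto
      finally have m: "(1 + real n) ^ 2 \<le> 2 * norm (f n) ^ 2" .
      \<comment> \<open>Both y^2 and (1 + n)^2 are at most Q; the two bounds are interpolated with
        weights 1/4 and 3/4.\<close>
      have "y powr (1 / 2) * (1 + real n) powr (3 / 2) \<le> 2 * norm (f n) ^ 2"
      proof -
        define Q where "Q = 2 * norm (f n) ^ 2"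
        have "Q = norm (f n) ^ 2 + norm (f n) ^ 2" "0 \<le> real n ^ 2" "norm (f n) ^ 2 > 0" using n0 by (simp_all add: Q_def)
        hence Q: "y ^ 2 \<le> Q" "(1 + real n) ^ 2 \<le> Q" "Q > 0" using q2 m by linarith+
        have pp: "x powr (2 * r) = (x ^ 2) powr r" if "x > 0" for x r :: real
          using that powr_powr[of x 2 r] by simp
        have "y powr (1 / 2) = (y ^ 2) powr (1 / 4)" using y1 pp[of y "1 / 4"] by simp
        also have "\<dots> \<le> Q powr (1 / 4)" using Q by (intro powr_mono2) auto
        finally have 1: "y powr (1 / 2) \<le> Q powr (1 / 4)" .
        have "(1 + real n) powr (3 / 2) = ((1 + real n) ^ 2) powr (3 / 4)" using pp[of "1 + real n" "3 / 4"] by simp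
        also have "\<dots> \<le> Q powr (3 / 4)" using Q by (intro powr_mono2) auto
        finally have "y powr (1 / 2) * (1 + real n) powr (3 / 2) \<le> Q powr (1 / 4) * Q powr (3 / 4)"
          using 1 by (intro mult_mono) auto
        also have "\<dots> = Q" using Q(3) by (simp flip: powr_add)
        finally show ?thesis by (simp add: Q_def)
      qed
      hence "1 / norm (f n) ^ 2 \<le> 2 * (y powr (- 1 / 2) * (1 + real n) powr (- 3 / 2))"
        using n0 y1 by (simp add: powr_minus divide_simps mult_ac)
      hence "E * exp (4 * pi * y) * (1 / norm (f n) ^ 2) \<le> E * exp (4 * pi * y) * (2 * (y powr (- 1 / 2) * (1 + real n) powr (- 3 / 2)))"
        using ER(1) by (intro mult_left_mono) auto
      thus ?thesis using ER(3)[OF nR] by (simp add: f(1) mult_ac)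
    qed
    have "norm (suminf (\<lambda>n. Phi a b (f n))) \<le> (\<Sum>n. 2 * E * exp (4 * pi * y) * y powr (- 1 / 2) * (1 + real n) powr (- 3 / 2))"
      by (intro norm_suminf_le bd summable_mult sC)
    also have "\<dots> = 2 * E * exp (4 * pi * y) * y powr (- 1 / 2) * C" unfolding C_def by (rule suminf_mult[OF sC])
    finally show ?thesis by (simp add: mult_ac)
  qed
  have "norm (Tsum a b z) \<le> (4 * E * C) * exp (4 * pi * \<bar>Im z\<bar>) * \<bar>Im z\<bar> powr (- 1 / 2)" if z: "\<bar>Im z\<bar> \<ge> R" for z
  proof -
    \<comment> \<open>In the strip 0 \<le> Re z' < 1 the nth argument in either half has real part
      at least n in absolute value, as \<open>half\<close> requires.\<close>
    define z' where "z' = z + of_int (- \<lfloor>Re z\<rfloor>)"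
    have r: "0 \<le> Re z'" "Re z' < 1" by (auto simp: z'_def) linarith+
    have i: "Im z' = Im z" by (simp add: z'_def)
    have "Tsum a b z = Tsum a b z'" unfolding z'_def by (rule Tsum_plus_int[OF s, symmetric])
    also have "norm \<dots> \<le> norm (\<Sum>n. Phi a b (z' + of_nat n)) + norm (\<Sum>n. Phi a b (z' - 1 - of_nat n))"
      unfolding Tsum_def by (rule norm_triangle_ineq)
    also have "\<dots> \<le> 2 * E * C * exp (4 * pi * \<bar>Im z\<bar>) * \<bar>Im z\<bar> powr (- 1 / 2) + 2 * E * C * exp (4 * pi * \<bar>Im z\<bar>) * \<bar>Im z\<bar> powr (- 1 / 2)"
      using r z by (intro add_mono half) (auto simp: i)
    also have "\<dots> = (4 * E * C) * exp (4 * pi * \<bar>Im z\<bar>) * \<bar>Im z\<bar> powr (- 1 / 2)" by simp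
    finally show ?thesis .
  qed
  moreover have "4 * E * C \<ge> 0" unfolding C_def using ER(1) sC by (intro mult_nonneg_nonneg suminf_nonneg) auto
  ultimately show ?thesis using that ER(2) by blast
qed

text \<open>In the variable w = exp(2 pi i z) the function w^2 T is holomorphic off 0, tends to 0 at
  0 and is o(|w|^4) at infinity. So it is a polynomial without the terms w^0 and w^4, and division
  by w^2 leaves three exponentials.\<close>

theorem Tsum_trig_polynomial:
  assumes s: "(\<Sum>i<4. b i - a i) = 2"
  obtains c1 c2 c3 where "\<And>z. Tsum a b z = c1 * exp (- (2 * of_real pi * \<i> * z)) + c2 + c3 * exp (2 * of_real pi * \<i> * z)"
proof -
  define k :: complex where "k = 2 * of_real pi * \<i>"
  have k0: "k \<noteq> 0" by (simp add: k_def)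
  define g where "g w = (if w = 0 then 0 else w ^ 2 * Tsum a b (Ln w / k))" for w
  have T_exp: "Tsum a b (u / k) = Tsum a b (v / k)" if "exp u = exp v" for u v
  proof -
    have "\<exists>n::int. u = v + (of_int (2 * n) * pi) * \<i>" using that by (simp only: exp_eq)
    then obtain n :: int where "u = v + (of_int (2 * n) * pi) * \<i>" by blast
    hence "u / k = v / k + of_int n" using k0 by (simp add: k_def field_simps)
    thus ?thesis by (simp add: Tsum_plus_int[OF s])
  qed
  have T_g: "g (exp (k * z)) = exp (k * z) ^ 2 * Tsum a b z" for z
  proof -
    have "Tsum a b (Ln (exp (k * z)) / k) = Tsum a b (k * z / k)" by (rule T_exp) simp
    thus ?thesis using k0 by (simp only: g_def exp_not_eq_zero if_False nonzero_mult_div_cancel_left not_False_eq_True)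
  qed
  obtain E R where ER: "R \<ge> 1" "E \<ge> 0"
    "\<And>z. \<bar>Im z\<bar> \<ge> R \<Longrightarrow> norm (Tsum a b z) \<le> E * exp (4 * pi * \<bar>Im z\<bar>) * \<bar>Im z\<bar> powr (- 1 / 2)"
    by (rule Tsum_growth[OF s]) (rule that)
  have gb: "norm (g w) \<le> norm w ^ 2 * (E * exp (2 * \<bar>ln (norm w)\<bar>) * (\<bar>ln (norm w)\<bar> / (2 * pi)) powr (- 1 / 2))"
    if w: "w \<noteq> 0" "\<bar>ln (norm w)\<bar> \<ge> 2 * pi * R" for w
  proof -
    have im: "Im (Ln w / k) = - ln (norm w) / (2 * pi)"
    proof -
      have "Ln w / k = (- \<i> / (2 * of_real pi)) * Ln w" by (simp add: k_def field_simps)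
      also have "\<dots> = Complex (Im (Ln w) / (2 * pi)) (- Re (Ln w) / (2 * pi))"
        by (simp add: complex_eq_iff Re_divide Im_divide power2_eq_square)
      finally show ?thesis using w by simp
    qed
    hence im': "\<bar>Im (Ln w / k)\<bar> = \<bar>ln (norm w)\<bar> / (2 * pi)" by simp
    have "norm (Tsum a b (Ln w / k)) \<le> E * exp (4 * pi * \<bar>Im (Ln w / k)\<bar>) * \<bar>Im (Ln w / k)\<bar> powr (- 1 / 2)"
      by (rule ER(3)) (use w in \<open>simp add: im' field_simps\<close>)
    also have "4 * pi * \<bar>Im (Ln w / k)\<bar> = 2 * \<bar>ln (norm w)\<bar>" unfolding im' by simp
    finally show ?thesis
      using w unfolding im' by (simp add: g_def norm_mult norm_power mult_left_mono)
  qed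
  have hol: "g holomorphic_on UNIV - {0}"
  proof -
    have "g field_differentiable (at w0)" if w0: "w0 \<noteq> 0" for w0
    proof -
      \<comment> \<open>The principal \<open>Ln\<close> jumps across the negative axis, whereas
        \<open>Ln (w / w0) + Ln w0\<close> is holomorphic on the disc about w0; periodicity makes T
        insensitive to the choice of branch.\<close>
      define h where "h w = w ^ 2 * Tsum a b ((Ln (w / w0) + Ln w0) / k)" for w
      have pos: "w \<noteq> 0 \<and> w / w0 \<notin> \<real>\<^sub>\<le>\<^sub>0" if "w \<in> ball w0 (norm w0)" for w
      proof -
        have "w / w0 - 1 = (w - w0) / w0" using w0 by (simp add: diff_divide_distrib)
        hence "norm (w / w0 - 1) = norm (w - w0) / norm w0" by (simp only: norm_divide)
        also have "\<dots> < 1" using that w0 by (simp add: dist_norm norm_minus_commute)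
        finally have "norm (w / w0 - 1) < 1" .
        hence "Re (w / w0) > 0" using abs_Re_le_cmod[of "w / w0 - 1"] by simp
        thus ?thesis using w0 by (auto simp: complex_nonpos_Reals_iff)
      qed
      have "(\<lambda>w. Tsum a b ((Ln (w / w0) + Ln w0) / k)) holomorphic_on ball w0 (norm w0)"
      proof -
        have "(\<lambda>w. (Ln (w / w0) + Ln w0) / k) holomorphic_on ball w0 (norm w0)"
          using pos w0 k0 by (intro holomorphic_intros) auto
        from holomorphic_on_compose_gen[OF this holomorphic_Tsum[OF s]] show ?thesis by (simp add: o_def)
      qed
      hence "h holomorphic_on ball w0 (norm w0)"
        unfolding h_def by (intro holomorphic_intros)
      moreover have "h w = g w" if "w \<in> ball w0 (norm w0)" for w
      proof -
        have "w \<noteq> 0" using pos[OF that] by simp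
        moreover from this have "exp (Ln (w / w0) + Ln w0) = exp (Ln w)" using w0 by (simp add: exp_add)
        ultimately show ?thesis using T_exp by (simp add: h_def g_def)
      qed
      ultimately have "g holomorphic_on ball w0 (norm w0)" by (rule holomorphic_transform)
      thus ?thesis by (rule holomorphic_on_imp_differentiable_at) (use w0 in auto)
    qed
    thus ?thesis by (auto simp: holomorphic_on_def intro: field_differentiable_at_within)
  qed
  have ln0: "filterlim (\<lambda>w. ln (norm w)) at_bot (at (0::complex))"
  proof (rule filterlim_compose[OF ln_at_0])
    show "filterlim norm (at_right 0) (at (0::complex))"
      unfolding filterlim_at eventually_at_filter by (auto intro!: tendsto_norm_zero tendsto_ident_at)
  qed
  \<comment> \<open>For small w the factor |w|^2 exactly offsets exp(2 |ln |w||), and the negative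
    power of the logarithm remains.\<close>
  have "(g \<longlongrightarrow> 0) (at 0)"
  proof (rule Lim_null_comparison)
    show "\<forall>\<^sub>F w in at 0. norm (g w) \<le> E * ((- ln (norm w)) / (2 * pi)) powr (- 1 / 2)"
      using ln0[unfolded filterlim_at_bot, rule_format, of "- 2 * pi * R"] eventually_neq_at_within[of 0 0 UNIV]
    proof eventually_elim
      case (elim w)
      have "2 * pi * R > 0" using ER by simp
      hence l: "ln (norm w) < 0" using elim by linarith
      have "exp (2 * \<bar>ln (norm w)\<bar>) = inverse (exp (ln (norm w)) ^ 2)"
        using l by (simp add: exp_minus[symmetric] flip: exp_of_nat_mult)
      hence "norm w ^ 2 * exp (2 * \<bar>ln (norm w)\<bar>) = 1" using elim by simp
      moreover have "norm (g w) \<le> (norm w ^ 2 * exp (2 * \<bar>ln (norm w)\<bar>)) * (E * (\<bar>ln (norm w)\<bar> / (2 * pi)) powr (- 1 / 2))"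
        using gb[of w] elim l by (simp add: mult_ac)
      ultimately show ?case using l by simp
    qed
    have "filterlim (\<lambda>w. (1 / (2 * pi)) * (- ln (norm w))) at_top (at (0::complex))"
      using ln0 by (intro filterlim_tendsto_pos_mult_at_top[OF tendsto_const]) (auto simp: filterlim_uminus_at_top)
    hence "((\<lambda>w. E * ((- ln (norm w)) / (2 * pi)) powr (- 1 / 2)) \<longlongrightarrow> E * 0) (at (0::complex))"
      by (intro tendsto_mult tendsto_const tendsto_neg_powr) auto
    thus "((\<lambda>w. E * ((- ln (norm w)) / (2 * pi)) powr (- 1 / 2)) \<longlongrightarrow> 0) (at (0::complex))" by simp
  qed
  hence hol': "g holomorphic_on UNIV"
    by (intro no_isolated_singularity'[OF _ hol]) (auto simp: g_def)
  have big: "norm (g w) \<le> E * (ln (norm w) / (2 * pi)) powr (- 1 / 2) * norm w ^ 4" if w: "norm w \<ge> exp (2 * pi * R)" for w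
  proof -
    have w0: "w \<noteq> 0" using w by auto
    have l: "ln (norm w) \<ge> 2 * pi * R" using w w0 by (subst ln_ge_iff) auto
    have "2 * pi * R > 0" using ER by simp
    hence lp: "ln (norm w) > 0" using l by linarith
    have "exp (2 * \<bar>ln (norm w)\<bar>) = exp (ln (norm w)) ^ 2"
      using lp by (simp flip: exp_of_nat_mult)
    hence e: "exp (2 * \<bar>ln (norm w)\<bar>) = norm w ^ 2" using w0 by simp
    show ?thesis using gb[OF w0] l lp unfolding e by (simp add: mult_ac power4_eq_xxxx power2_eq_square)
  qed
  have "norm (g w) \<le> E * norm w ^ 4" if w: "exp (2 * pi * R) \<le> norm w" for w
  proof -
    have "ln (norm w) \<ge> 2 * pi * R" using w less_le_trans[OF exp_gt_zero w] by (subst ln_ge_iff)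
    moreover have "2 * pi * 1 \<le> 2 * pi * R" using ER(1) by (intro mult_left_mono) auto
    ultimately have "2 * pi \<le> ln (norm w)" by linarith
    hence "ln (norm w) / (2 * pi) \<ge> 1" by simp
    hence "(ln (norm w) / (2 * pi)) powr (- 1 / 2) \<le> 1" using powr_mono2'[of "- 1 / 2" 1 "ln (norm w) / (2 * pi)"] by simp
    hence "E * (ln (norm w) / (2 * pi)) powr (- 1 / 2) * norm w ^ 4 \<le> E * 1 * norm w ^ 4"
      using ER by (intro mult_left_mono mult_right_mono) auto
    with big[OF w] show ?thesis by simp
  qed
  note poly = Liouville_polynomial[OF hol' this]
  define c where "c j = (deriv ^^ j) g 0 / fact j" for j
  have c0: "c 0 = 0" by (simp add: c_def g_def)
  have gp: "g w = c 1 * w + c 2 * w ^ 2 + c 3 * w ^ 3 + c 4 * w ^ 4" for w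
    using poly[where \<xi> = w] c0 by (simp add: c_def eval_nat_numeral)
  \<comment> \<open>The sequence g(n) / n^4 tends to 0 by the growth bound and to c 4 by the
    polynomial form.\<close>
  have "c 4 = 0"
  proof -
    have "(\<lambda>n. g (of_nat n) / of_nat n ^ 4) \<longlonglongrightarrow> 0"
    proof (rule Lim_null_comparison)
      obtain N where N: "real N \<ge> exp (2 * pi * R)" using real_arch_simple by blast
      show "\<forall>\<^sub>F n in sequentially. norm (g (of_nat n) / of_nat n ^ 4) \<le> E * (ln (real n) / (2 * pi)) powr (- 1 / 2)"
      proof (rule eventually_mono[OF eventually_ge_at_top[of N]])
        fix n assume "N \<le> n"
        hence n: "exp (2 * pi * R) \<le> norm (of_nat n :: complex)" using N by simp
        hence "exp (2 * pi * R) \<le> real n" by simp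
        hence "real n > 0" by (rule less_le_trans[OF exp_gt_zero])
        thus "norm (g (of_nat n) / of_nat n ^ 4) \<le> E * (ln (real n) / (2 * pi)) powr (- 1 / 2)"
          using big[OF n] by (simp add: norm_divide norm_power divide_le_eq)
      qed
      have "filterlim (\<lambda>n. (1 / (2 * pi)) * ln (real n)) at_top sequentially"
        by (intro filterlim_tendsto_pos_mult_at_top[OF tendsto_const] filterlim_compose[OF ln_at_top] filterlim_real_sequentially) auto
      hence "(\<lambda>n. E * (ln (real n) / (2 * pi)) powr (- 1 / 2)) \<longlonglongrightarrow> E * 0"
        by (intro tendsto_mult tendsto_const tendsto_neg_powr) auto
      thus "(\<lambda>n. E * (ln (real n) / (2 * pi)) powr (- 1 / 2)) \<longlonglongrightarrow> 0" by simp
    qed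
    moreover have "(\<lambda>n. g (of_nat n) / of_nat n ^ 4) \<longlonglongrightarrow> c 4"
    proof -
      have i: "(\<lambda>n. 1 / of_nat n :: complex) \<longlonglongrightarrow> 0" by (rule lim_1_over_n)
      have "(\<lambda>n. c 1 * (1 / of_nat n) ^ 3 + c 2 * (1 / of_nat n) ^ 2 + c 3 * (1 / of_nat n) + c 4) \<longlonglongrightarrow>
        c 1 * 0 ^ 3 + c 2 * 0 ^ 2 + c 3 * 0 + c 4"
        by (intro tendsto_intros i)
      hence L: "(\<lambda>n. c 1 * (1 / of_nat n) ^ 3 + c 2 * (1 / of_nat n) ^ 2 + c 3 * (1 / of_nat n) + c 4) \<longlonglongrightarrow> c 4" by simp
      show ?thesis
      proof (rule Lim_transform_eventually[OF L], rule eventually_mono[OF eventually_gt_at_top[of 0]])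
        fix n :: nat assume "0 < n"
        thus "c 1 * (1 / of_nat n) ^ 3 + c 2 * (1 / of_nat n) ^ 2 + c 3 * (1 / of_nat n) + c 4 = g (of_nat n) / of_nat n ^ 4"
          unfolding gp by (simp add: divide_simps) (simp add: algebra_simps eval_nat_numeral)
      qed
    qed
    ultimately show ?thesis by (rule LIMSEQ_unique[symmetric])
  qed
  have "Tsum a b z = c 1 * exp (- (k * z)) + c 2 + c 3 * exp (k * z)" for z
  proof -
    define q where "q = exp (k * z)"
    have q0: "q \<noteq> 0" by (simp add: q_def)
    have "q ^ 2 * Tsum a b z = c 1 * q + c 2 * q ^ 2 + c 3 * q ^ 3"
      using T_g[of z] gp[of q] \<open>c 4 = 0\<close> by (simp add: q_def)
    hence "q ^ 2 * Tsum a b z = q ^ 2 * (c 1 * (1 / q) + c 2 + c 3 * q)"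
      using q0 by (simp add: field_simps eval_nat_numeral)
    hence "Tsum a b z = c 1 * (1 / q) + c 2 + c 3 * q" using q0 by simp
    thus ?thesis by (simp add: q_def exp_minus divide_inverse)
  qed
  thus ?thesis using that unfolding k_def by blast
qed

subsection \<open>Three-term relations between values of the bilateral sum\<close>

lemma Phi_list:
  "Phi ((!) [a, b, c, d]) ((!) [p, q, r, t]) s =
     (rGamma (p + s) * rGamma (q + s) * rGamma (r + s) * rGamma (t + s)) *
     (rGamma (1 - a - s) * rGamma (1 - b - s) * rGamma (1 - c - s) * rGamma (1 - d - s))"
  by (simp add: Phi_def eval_nat_numeral lessThan_Suc mult_ac)

lemma Tsum_cong: "Phi a b = Phi a' b' \<Longrightarrow> Tsum a b = Tsum a' b'"
  by (rule ext) (simp add: Tsum_def)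

lemma rGamma_diff_of_nat: "rGamma (x - of_nat n) = (-1) ^ n * pochhammer (1 - x) n * rGamma x" for x :: complex
  using pochhammer_rGamma[of "x - of_nat n" n] by (simp add: pochhammer_reflect)

lemma rGamma_one_plus_of_nat: "rGamma (1 + of_nat n) = 1 / (fact n :: complex)"
  using Gamma_fact[of n, where 'a = complex] by (simp add: rGamma_inverse_Gamma divide_inverse)

lemma rGamma_minus_of_nat: "rGamma (- of_nat n) = (0 :: complex)"
  by (simp add: rGamma_eq_zero_iff)

text \<open>At s = 1 - p the factor \<open>rGamma (p + s + n)\<close> vanishes for n < 0 and equals
  1 / n! otherwise, so the bilateral series becomes one-sided. The sign (-1)^n arises from each of
  the four upper parameters and cancels.\<close>

lemma Tsum_at_upper:
  "Tsum ((!) [a, b, c, d]) ((!) [p, q, r, t]) (1 - p) =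
     (rGamma (p - a) * rGamma (p - b) * rGamma (p - c) * rGamma (p - d)) *
     F43 (1 + a - p) (1 + b - p) (1 + c - p) (1 + d - p) (1 + q - p) (1 + r - p) (1 + t - p)"
  if s: "p + q + r + t = a + b + c + d + 2"
proof -
  let ?P = "Phi ((!) [a, b, c, d]) ((!) [p, q, r, t])"
  define C where "C = rGamma (p - a) * rGamma (p - b) * rGamma (p - c) * rGamma (p - d)"
  have 1: "?P (1 - p - 1 - of_nat n) = 0" for n
    unfolding Phi_list by (simp add: rGamma_minus_of_nat)
  have 2: "?P (1 - p + of_nat n) =
     C * hyp_term (1 + a - p) (1 + b - p) (1 + c - p) (1 + d - p) (1 + q - p) (1 + r - p) (1 + t - p) n" for n
  proof -
    have r: "rGamma (1 - x - (1 - p + of_nat n)) = (-1) ^ n * pochhammer (1 + x - p) n * rGamma (p - x)" for x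
      using rGamma_diff_of_nat[of "p - x" n] by (simp add: algebra_simps)
    have o: "rGamma (p + (1 - p + of_nat n)) = 1 / fact n" using rGamma_one_plus_of_nat[of n] by simp
    have e: "x + (1 - p + of_nat n) = 1 + x - p + of_nat n" for x by simp
    have sg: "(-1) ^ n * (-1) ^ n = (1 :: complex)" by (simp flip: power_mult_distrib)
    have "?P (1 - p + of_nat n) = ((-1) ^ n * (-1) ^ n) * ((-1) ^ n * (-1) ^ n) * (C * hyp_term (1 + a - p) (1 + b - p) (1 + c - p) (1 + d - p) (1 + q - p) (1 + r - p) (1 + t - p) n)"
      unfolding Phi_list r o unfolding e hyp_term_def C_def by (simp add: mult_ac)
    thus ?thesis by (simp add: sg)
  qed
  have "summable (hyp_term (1 + a - p) (1 + b - p) (1 + c - p) (1 + d - p) (1 + q - p) (1 + r - p) (1 + t - p))"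
  proof (rule summable_hyp_term)
    show "1 + q - p + (1 + r - p) + (1 + t - p) = 1 + a - p + (1 + b - p) + (1 + c - p) + (1 + d - p) + 1"
      using s by algebra
  qed
  thus ?thesis unfolding Tsum_def 1 2 F43_def C_def[symmetric] by (simp add: suminf_mult)
qed

text \<open>Here \<open>rGamma (1 - a - s - n)\<close> vanishes for n > 0, so the series extends to
  the left.\<close>

lemma Tsum_at_lower:
  "Tsum ((!) [a, b, c, d]) ((!) [p, q, r, t]) (- a) =
     (rGamma (p - a) * rGamma (q - a) * rGamma (r - a) * rGamma (t - a)) *
     F43 (1 + a - p) (1 + a - q) (1 + a - r) (1 + a - t) (1 + a - b) (1 + a - c) (1 + a - d)"
  if s: "p + q + r + t = a + b + c + d + 2"
proof -
  let ?P = "Phi ((!) [a, b, c, d]) ((!) [p, q, r, t])"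
  define C where "C = rGamma (p - a) * rGamma (q - a) * rGamma (r - a) * rGamma (t - a)"
  define h where "h = hyp_term (1 + a - p) (1 + a - q) (1 + a - r) (1 + a - t) (1 + a - b) (1 + a - c) (1 + a - d)"
  have 1: "?P (- a + of_nat (Suc n)) = 0" for n
    unfolding Phi_list using rGamma_minus_of_nat[of n] by simp
  have 2: "?P (- a - of_nat n) = C * h n" for n
  proof -
    have r: "rGamma (x + (- a - of_nat n)) = (-1) ^ n * pochhammer (1 + a - x) n * rGamma (x - a)" for x
      using rGamma_diff_of_nat[of "x - a" n] by (simp add: algebra_simps)
    have o: "rGamma (1 - a - (- a - of_nat n)) = 1 / fact n" using rGamma_one_plus_of_nat[of n] by simp
    have e: "1 - x - (- a - of_nat n) = 1 + a - x + of_nat n" for x by simp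
    have sg: "(-1) ^ n * (-1) ^ n = (1 :: complex)" by (simp flip: power_mult_distrib)
    have "?P (- a - of_nat n) = ((-1) ^ n * (-1) ^ n) * ((-1) ^ n * (-1) ^ n) * (C * h n)"
      unfolding Phi_list r o unfolding e hyp_term_def C_def h_def by (simp add: mult_ac)
    thus ?thesis by (simp add: sg)
  qed
  have "summable h"
    unfolding h_def
  proof (rule summable_hyp_term)
    show "1 + a - b + (1 + a - c) + (1 + a - d) = 1 + a - p + (1 + a - q) + (1 + a - r) + (1 + a - t) + 1"
      using s by algebra
  qed
  hence S: "(\<lambda>n. C * h n) sums (C * suminf h)" by (intro sums_mult summable_sums)
  \<comment> \<open>The index 0 belongs to the nonnegative half of \<open>Tsum\<close>, so this half
    contributes the first term and the other half the tail.\<close>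
  have "(\<Sum>n. ?P (- a + of_nat n)) = C * h 0"
  proof (rule sums_unique[symmetric])
    have "?P (- a + of_nat n) = (if n = 0 then C * h 0 else 0)" for n
      using 1[of "n - 1"] 2[of 0] by (cases n) simp_all
    moreover have "(\<lambda>n::nat. if n = 0 then C * h 0 else 0) sums (C * h 0)" by (rule sums_single)
    ultimately show "(\<lambda>n. ?P (- a + of_nat n)) sums (C * h 0)" by simp
  qed
  moreover have "(\<Sum>n. ?P (- a - 1 - of_nat n)) = C * suminf h - C * h 0"
  proof -
    have "- a - 1 - of_nat n = - a - of_nat (Suc n)" for n by simp
    hence "(\<lambda>n. ?P (- a - 1 - of_nat n)) = (\<lambda>n. C * h (Suc n))" by (simp only: 2)
    moreover have "(\<lambda>n. C * h (Suc n)) sums (C * suminf h - C * h 0)"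
      using S sums_Suc_iff[of "\<lambda>n. C * h n" "C * suminf h - C * h 0"] by simp
    ultimately show ?thesis by (simp add: sums_iff)
  qed
  ultimately have "Tsum ((!) [a, b, c, d]) ((!) [p, q, r, t]) (- a) = C * suminf h" by (simp add: Tsum_def)
  thus ?thesis unfolding C_def h_def F43_def .
qed

text \<open>T lies in a three-dimensional space, so its values at 0, -a, -b interpolate it; the
  coefficients are quotients of sines, stated with denominators cleared.\<close>

lemma trig_interpolation:
  assumes T: "\<And>z. T z = c1 * exp (- (2 * of_real pi * \<i> * z)) + c2 + c3 * exp (2 * of_real pi * \<i> * z)"
  shows "T z * (sinpi a * sinpi b * sinpi (b - a)) =
     T 0 * (sinpi (z + a) * sinpi (z + b) * sinpi (b - a)) - T (- a) * (sinpi z * sinpi (z + b) * sinpi b) +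
     T (- b) * (sinpi z * sinpi (z + a) * sinpi a)"
proof -
  define S where "S x = sin (of_real pi * x)" for x :: complex
  define C where "C x = cos (of_real pi * x)" for x :: complex
  have SC: "S x * S x + C x * C x = 1" for x
    using sin_cos_squared_add[of "of_real pi * x"] by (simp add: S_def C_def power2_eq_square)
  have ex: "exp (2 * of_real pi * \<i> * x) = (C x + \<i> * S x) * (C x + \<i> * S x)" for x
  proof -
    have "exp (2 * of_real pi * \<i> * x) = exp (\<i> * (of_real pi * x)) * exp (\<i> * (of_real pi * x))"
      by (simp flip: exp_add) (simp add: mult_ac)
    thus ?thesis by (simp add: exp_Euler S_def C_def)
  qed
  have ex': "exp (- (2 * of_real pi * \<i> * x)) = (C x - \<i> * S x) * (C x - \<i> * S x)" for x
    using ex[of "- x"] by (simp add: S_def C_def)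
  have ii: "\<i> * \<i> = -1" by simp
  define \<alpha> \<beta> \<gamma> where "\<alpha> = c1 + c2 + c3" "\<beta> = - 2 * (c1 + c3)" "\<gamma> = 2 * \<i> * (c3 - c1)"
  have T': "T x = \<alpha> + \<beta> * (S x * S x) + \<gamma> * (S x * C x)" for x
    unfolding T ex ex' \<alpha>_\<beta>_\<gamma>_def using SC[of x] ii by algebra
  have T0: "T 0 = \<alpha>" by (simp add: T' S_def)
  have S': "sinpi x = S x" for x by (simp add: S_def sinpi_def)
  have add: "S (x + y) = S x * C y + C x * S y" "S (x - y) = S x * C y - C x * S y" for x y
    by (simp_all add: S_def C_def ring_distribs sin_add sin_diff)
  have neg: "S (- x) = - S x" "C (- x) = C x" for x by (simp_all add: S_def C_def)
  show ?thesis
    unfolding S' T0 T'[of z] T'[of "- a"] T'[of "- b"] add neg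
    using SC[of a] SC[of b] SC[of z] by algebra
qed

lemma sinpi_one_minus: "sinpi (1 - x) = sinpi x"
  using sinpi_add_of_nat[of "- x" 1] by (simp add: sinpi_minus)

lemma sinpi_exchange: "sinpi f * sinpi (g - a) - sinpi g * sinpi (f - a) = sinpi a * sinpi (g - f)"
  unfolding sinpi_def right_diff_distrib sin_diff by algebra

lemma sinpi_product_diff:
  "sinpi (g - c) * sinpi (g - d) - sinpi (f - c) * sinpi (f - d) = sinpi (g - f) * sinpi (f + g - c - d)"
proof -
  have "g + f - c - d - (f - d) = g - c" "g + f - c - d - (f - c) = g - d" "g + f - c - d - (f - d) - (f - c) = g - f"
    by simp_all
  with sinpi_diff_diff[of "g + f - c - d" "f - d" "f - c"] show ?thesis by (simp add: mult_ac add.commute)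
qed

text \<open>On V, f + g - a - c - d = 1 - (e - b), so the bracket on the right is S(a,c,d) +
  S(e-b,f,g). This is the origin of the bracket in \<open>B4\<close>.\<close>

lemma sinpi_triple:
  "sinpi f * (sinpi (g - a) * sinpi (g - c) * sinpi (g - d)) - sinpi g * (sinpi (f - a) * sinpi (f - c) * sinpi (f - d)) =
     sinpi (g - f) * (sinpi a * sinpi c * sinpi d + sinpi f * sinpi g * sinpi (f + g - a - c - d))"
proof -
  have 1: "sinpi (x - c) * sinpi (x - d) = sinpi c * sinpi d + sinpi x * sinpi (x - c - d)" for x
    using sinpi_diff_diff[of x c d] by (simp add: algebra_simps)
  have e: "sinpi (x - (c + d)) = sinpi (x - c - d)" "sinpi (f + g - a - (c + d)) = sinpi (f + g - a - c - d)" for x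
    by (simp_all add: diff_diff_eq add.assoc)
  show ?thesis
    using 1[of g] 1[of f] sinpi_exchange[of f g a] sinpi_product_diff[of g a "c + d" f] unfolding e by algebra
qed

text \<open>Interpolation expresses T(1-f) and T(1-g) through T(0), T(-a), T(-b). The coefficients
  of T(-a) and T(-b) then vanish by \<open>sinpi_triple\<close>, that of T(0) by
  \<open>sinpi_product_diff\<close>.\<close>

lemma trig_three_term:
  assumes e: "e + f + g = a + b + c + d + 1"
    and T: "\<And>z. T z = c1 * exp (- (2 * of_real pi * \<i> * z)) + c2 + c3 * exp (2 * of_real pi * \<i> * z)"
    and n: "a \<notin> \<int>" "b \<notin> \<int>" "a - b \<notin> \<int>"
  defines "S \<equiv> sinpi"
  shows "S (g - f) * (S (f - b) * S (g - b) * (S a * S c * S d + S (e - b) * S f * S g) *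
            (S (e - a) * S (f - a) * S (g - a) * T 0 + S b * S c * S d * T (- a)) -
          S (f - a) * S (g - a) * (S b * S c * S d + S (e - a) * S f * S g) *
            (S (e - b) * S (f - b) * S (g - b) * T 0 + S a * S c * S d * T (- b))) +
       S (b - a) * (S a * S b * S c * S d) *
         ((S (g - a) * S (g - b) * S (g - c) * S (g - d)) * T (1 - f) -
          (S (f - a) * S (f - b) * S (f - c) * S (f - d)) * T (1 - g)) = 0" (is "?R = 0")
proof -
  define P where "P = S a * S b * S (b - a)"
  have itp: "P * T (1 - f) = T 0 * (S (f - a) * S (f - b) * S (b - a)) - T (- a) * (S f * S (f - b) * S b) + T (- b) * (S f * S (f - a) * S a)" for f
  proof -
    have "S (1 - f) = S f" "S (1 - f + a) = S (f - a)" "S (1 - f + b) = S (f - b)"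
      unfolding S_def using sinpi_one_minus[of f] sinpi_one_minus[of "f - a"] sinpi_one_minus[of "f - b"] by (simp_all add: algebra_simps)
    thus ?thesis using trig_interpolation[of T c1 c2 c3 "1 - f" a b, OF T] by (simp add: P_def S_def mult_ac)
  qed
  have e1: "S (f + g - a - c - d) = S (e - b)" "S (f + g - b - c - d) = S (e - a)" "S (f + g - c - d) = S (e - a - b)"
  proof -
    have "f + g - a - c - d = 1 - (e - b)" "f + g - b - c - d = 1 - (e - a)" "f + g - c - d = 1 - (e - a - b)"
      using e by algebra+
    thus "S (f + g - a - c - d) = S (e - b)" "S (f + g - b - c - d) = S (e - a)" "S (f + g - c - d) = S (e - a - b)"
      by (simp_all only: S_def sinpi_one_minus)
  qed
  have I1: "S f * (S (g - a) * S (g - c) * S (g - d)) - S g * (S (f - a) * S (f - c) * S (f - d)) =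
     S (g - f) * (S a * S c * S d + S f * S g * S (e - b))"
    using sinpi_triple[of f g a c d] e1 by (simp add: S_def)
  have I2: "S f * (S (g - b) * S (g - c) * S (g - d)) - S g * (S (f - b) * S (f - c) * S (f - d)) =
     S (g - f) * (S b * S c * S d + S f * S g * S (e - a))"
    using sinpi_triple[of f g b c d] e1 by (simp add: S_def)
  have J1: "S (g - c) * S (g - d) - S (f - c) * S (f - d) = S (g - f) * S (e - a - b)"
    using sinpi_product_diff[of g c d f] e1 by (simp add: S_def)
  have J2: "S a * S (e - a) - S b * S (e - b) = - S (b - a) * S (e - a - b)"
  proof -
    have m: "S (x - y) = - S (y - x)" for x y unfolding S_def using sinpi_minus[of "y - x"] by simp
    have "S a * S (a - e) - S b * S (b - e) = S (a - b) * S (a + b - e)"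
      using sinpi_product_diff[of a 0 e b] by (simp add: S_def add.commute)
    moreover have "S (a + b - e) = - S (e - a - b)" using m[of "a + b" e] by (simp add: diff_diff_eq)
    ultimately show ?thesis using m[of a e] m[of b e] m[of a b] by algebra
  qed
  \<comment> \<open>P is the interpolation denominator; it is nonzero because a, b and a - b are not
    integers.\<close>
  have "P * ?R =
      P * (S (g - f) * (S (f - b) * S (g - b) * (S a * S c * S d + S (e - b) * S f * S g) *
            (S (e - a) * S (f - a) * S (g - a) * T 0 + S b * S c * S d * T (- a)) -
          S (f - a) * S (g - a) * (S b * S c * S d + S (e - a) * S f * S g) *
            (S (e - b) * S (f - b) * S (g - b) * T 0 + S a * S c * S d * T (- b)))) +
       S (b - a) * (S a * S b * S c * S d) *
         ((S (g - a) * S (g - b) * S (g - c) * S (g - d)) * (P * T (1 - f)) -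
          (S (f - a) * S (f - b) * S (f - c) * S (f - d)) * (P * T (1 - g)))"
    by (simp add: algebra_simps)
  also have "\<dots> = P * (
      S b * S c * S d * T (- a) * (S (f - b) * S (g - b)) *
        (S (g - f) * (S a * S c * S d + S f * S g * S (e - b)) -
         (S f * (S (g - a) * S (g - c) * S (g - d)) - S g * (S (f - a) * S (f - c) * S (f - d)))) -
      S a * S c * S d * T (- b) * (S (f - a) * S (g - a)) *
        (S (g - f) * (S b * S c * S d + S f * S g * S (e - a)) -
         (S f * (S (g - b) * S (g - c) * S (g - d)) - S g * (S (f - b) * S (f - c) * S (f - d)))) +
      T 0 * (S (f - a) * S (f - b) * S (g - a) * S (g - b)) * (S c * S d) *
        (S (g - f) * (S a * S (e - a) - S b * S (e - b)) + S (b - a) * (S (g - c) * S (g - d) - S (f - c) * S (f - d))))"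
    unfolding itp unfolding P_def by algebra
  also have "\<dots> = 0" unfolding I1 I2 J1 J2 by algebra
  finally have "P * ?R = 0" .
  moreover have "P \<noteq> 0"
    using n not_Ints_flip[OF n(3), of 0] by (simp add: P_def S_def sinpi_eq_0_iff)
  ultimately show ?thesis by simp
qed

subsection \<open>The generic case\<close>

definition K_pair where
  "K_pair a b c d e f g =
     F43 a b c d e f g * (rGamma a * rGamma (1 + a - e) * rGamma (1 + a - f) * rGamma (1 + a - g)) +
     F43 a (1 + a - e) (1 + a - f) (1 + a - g) (1 + a - b) (1 + a - c) (1 + a - d) *
       (rGamma a * rGamma b * rGamma c * rGamma d)"

text \<open>The left-hand side of the theorem, multiplied by the sines in the denominators of K and L.\<close>

definition entire_relation where
  "entire_relation a b c d e f g =
     A_prod (1 - a) (e - a) (f - a) (g - a) * B4 (b, a, c, d, e, f, g) * K_pair a b c d e f g * sinpi b * sinpi (2 - e) -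
     A_prod (1 - b) (e - b) (f - b) (g - b) * B4 (a, b, c, d, e, f, g) * K_pair b c d a e f g * sinpi a * sinpi (2 - e) -
     sinpi a * sinpi b * sinpi (b - a) * A_prod (f - a) (f - b) (f - c) (f - d) * A_prod (g - a) (g - b) (g - c) (g - d) *
       A_prod a b c d * L_pair (1 - a) (1 - b) (1 - c) (1 - d) (2 - e) (2 - f) (2 - g)"

text \<open>The two A-products are the prefactors of T(-a) and T(0). Multiplying by both leaves
  complementary pairs of reciprocal Gammas, which reflect to sines.\<close>

lemma K_pair_eq_Tsum:
  fixes a b c d e f g :: complex
  assumes s: "e + f + g = a + b + c + d + 1"
  defines "T \<equiv> Tsum ((!) [a, b, c, d]) ((!) [1, e, f, g])"
  shows "A_prod (1 - a) (e - a) (f - a) (g - a) * A_prod (1 - a) (1 - b) (1 - c) (1 - d) * K_pair a b c d e f g =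
     sinpi a * (sinpi (e - a) * sinpi (f - a) * sinpi (g - a) * T 0 + sinpi b * sinpi c * sinpi d * T (- a)) / of_real pi ^ 4"
proof -
  have s': "1 + e + f + g = a + b + c + d + 2" using s by algebra
  have T0: "T 0 = A_prod (1 - a) (1 - b) (1 - c) (1 - d) * F43 a b c d e f g"
    using Tsum_at_upper[OF s'] by (simp add: T_def A_prod_def)
  have Ta: "T (- a) = A_prod (1 - a) (e - a) (f - a) (g - a) * F43 a (1 + a - e) (1 + a - f) (1 + a - g) (1 + a - b) (1 + a - c) (1 + a - d)"
    using Tsum_at_lower[OF s'] by (simp add: T_def A_prod_def)
  have R1: "rGamma x * rGamma (1 - x) = sinpi x / of_real pi" for x by (rule rGamma_reflection_sinpi) simp
  have R2: "rGamma (1 + a - x) * rGamma (x - a) = sinpi (x - a) / of_real pi" for x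
    using rGamma_reflection_sinpi[of "x - a" "1 + a - x"] by (simp add: mult.commute)
  have "A_prod (1 - a) (e - a) (f - a) (g - a) * A_prod (1 - a) (1 - b) (1 - c) (1 - d) * K_pair a b c d e f g =
    T 0 * ((rGamma a * rGamma (1 - a)) * (rGamma (1 + a - e) * rGamma (e - a)) * (rGamma (1 + a - f) * rGamma (f - a)) * (rGamma (1 + a - g) * rGamma (g - a))) +
    T (- a) * ((rGamma a * rGamma (1 - a)) * (rGamma b * rGamma (1 - b)) * (rGamma c * rGamma (1 - c)) * (rGamma d * rGamma (1 - d)))"
    unfolding T0 Ta K_pair_def A_prod_def by algebra
  also have "\<dots> = sinpi a * (sinpi (e - a) * sinpi (f - a) * sinpi (g - a) * T 0 + sinpi b * sinpi c * sinpi d * T (- a)) / of_real pi ^ 4"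
    unfolding R1 R2 by (simp add: add_divide_distrib eval_nat_numeral algebra_simps)
  finally show ?thesis .
qed

text \<open>The corresponding statement at the points 1 - f and 1 - g. To evaluate T there, f or g
  is listed first among the lower parameters, in which T is symmetric.\<close>

lemma L_pair_eq_Tsum:
  fixes a b c d e f g :: complex
  assumes s: "e + f + g = a + b + c + d + 1"
  defines "T \<equiv> Tsum ((!) [a, b, c, d]) ((!) [1, e, f, g])"
  shows "A_prod (f - a) (f - b) (f - c) (f - d) * A_prod (g - a) (g - b) (g - c) (g - d) *
       L_pair (1 + a - f) (1 + b - f) (1 + c - f) (1 + d - f) (1 + g - f) (1 + e - f) (2 - f) =
     ((sinpi (g - a) * sinpi (g - b) * sinpi (g - c) * sinpi (g - d)) * T (1 - f) -
      (sinpi (f - a) * sinpi (f - b) * sinpi (f - c) * sinpi (f - d)) * T (1 - g)) / of_real pi ^ 4"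
proof -
  have s1: "f + 1 + e + g = a + b + c + d + 2" and s2: "g + 1 + e + f = a + b + c + d + 2" using s by algebra+
  have "Phi ((!) [a, b, c, d]) ((!) [1, e, f, g]) = Phi ((!) [a, b, c, d]) ((!) [f, 1, e, g])"
    "Phi ((!) [a, b, c, d]) ((!) [1, e, f, g]) = Phi ((!) [a, b, c, d]) ((!) [g, 1, e, f])"
    by (rule ext, simp add: Phi_list mult_ac)+
  hence T: "T = Tsum ((!) [a, b, c, d]) ((!) [f, 1, e, g])" "T = Tsum ((!) [a, b, c, d]) ((!) [g, 1, e, f])"
    unfolding T_def by (auto intro: Tsum_cong)
  have Tf: "T (1 - f) = A_prod (f - a) (f - b) (f - c) (f - d) * F43 (1 + a - f) (1 + b - f) (1 + c - f) (1 + d - f) (1 + g - f) (1 + e - f) (2 - f)"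
    unfolding T(1) Tsum_at_upper[OF s1] by (simp add: A_prod_def F43_def hyp_term_def[abs_def] mult_ac)
  have Tg: "T (1 - g) = A_prod (g - a) (g - b) (g - c) (g - d) * F43 (1 + a - g) (1 + b - g) (1 + c - g) (1 + d - g) (1 + f - g) (1 + e - g) (2 - g)"
    unfolding T(2) Tsum_at_upper[OF s2] by (simp add: A_prod_def F43_def hyp_term_def[abs_def] mult_ac)
  have eqs: "1 + (1 + x - f) - (1 + g - f) = 1 + x - g" "2 - (1 + g - f) = 1 + f - g" "1 + (2 - f) - (1 + g - f) = 2 - g" for x
    by simp_all
  have R: "rGamma (1 + x - y) * rGamma (y - x) = sinpi (y - x) / of_real pi" for x y
    using rGamma_reflection_sinpi[of "y - x" "1 + x - y"] by (simp add: mult.commute)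
  have "A_prod (f - a) (f - b) (f - c) (f - d) * A_prod (g - a) (g - b) (g - c) (g - d) *
       L_pair (1 + a - f) (1 + b - f) (1 + c - f) (1 + d - f) (1 + g - f) (1 + e - f) (2 - f) =
    T (1 - f) * ((rGamma (1 + a - g) * rGamma (g - a)) * (rGamma (1 + b - g) * rGamma (g - b)) * (rGamma (1 + c - g) * rGamma (g - c)) * (rGamma (1 + d - g) * rGamma (g - d))) -
    T (1 - g) * ((rGamma (1 + a - f) * rGamma (f - a)) * (rGamma (1 + b - f) * rGamma (f - b)) * (rGamma (1 + c - f) * rGamma (f - c)) * (rGamma (1 + d - f) * rGamma (f - d)))"
    unfolding Tf Tg L_pair_def eqs A_prod_def by algebra
  also have "\<dots> = ((sinpi (g - a) * sinpi (g - b) * sinpi (g - c) * sinpi (g - d)) * T (1 - f) -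
      (sinpi (f - a) * sinpi (f - b) * sinpi (f - c) * sinpi (f - d)) * T (1 - g)) / of_real pi ^ 4"
    unfolding R by (simp add: diff_divide_distrib eval_nat_numeral algebra_simps)
  finally show ?thesis .
qed

text \<open>The relation is obtained multiplied by pi^8 N sin pi(g - f) with N = A(1-a,1-b,1-c,1-d).
  Genericity makes this factor nonzero and permits the chain of two-term relations.\<close>

lemma entire_relation_generic:
  fixes a b c d e f g :: complex
  assumes g: "g = 1 + a + b + c + d - e - f"
    and gen: "a \<notin> \<int>"
      "b \<notin> \<int>"
      "c \<notin> \<int>"
      "d \<notin> \<int>"
      "a - e \<notin> \<int>"
      "b - e \<notin> \<int>"
      "c - e \<notin> \<int>"
      "d - e \<notin> \<int>"
      "a - f \<notin> \<int>"
      "b - f \<notin> \<int>"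
      "a + b + d - e - f \<notin> \<int>"
      "a + b + c - e - f \<notin> \<int>"
      "e \<notin> \<int>"
      "a + b - f \<notin> \<int>"
      "a + b - e - f \<notin> \<int>"
      "d - f \<notin> \<int>"
      "c - f \<notin> \<int>"
      "a + c + d - e - f \<notin> \<int>"
      "b + c + d - e - f \<notin> \<int>"
      "c + d - e - f \<notin> \<int>"
      "a + b + c + d - e - 2 * f \<notin> \<int>"
      "a - b \<notin> \<int>"
    and re: "Re (a + b - f) \<noteq> 0" "Re e \<noteq> 1" "Re (e + f - c - d) \<noteq> 1"
  shows "entire_relation a b c d e f g = 0"
proof -
  define S where "S = sinpi"
  define T where "T = Tsum ((!) [a, b, c, d]) ((!) [1, e, f, g])"
  define \<pi> :: complex where "\<pi> = of_real pi"
  define N where "N = A_prod (1 - a) (1 - b) (1 - c) (1 - d)"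
  define LL where "LL = L_pair (1 - a) (1 - b) (1 - c) (1 - d) (2 - e) (2 - f) (2 - g)"
  define M where "M = L_pair (1 + a - f) (1 + b - f) (1 + c - f) (1 + d - f) (1 + g - f) (1 + e - f) (2 - f)"
  have pi: "\<pi> \<noteq> 0" by (simp add: \<pi>_def)
  have s: "e + f + g = a + b + c + d + 1" using g by algebra
  have sb: "e + f + g = b + c + d + a + 1" using g by algebra
  have "(\<Sum>i<4. ((!) [1, e, f, g]) i - ((!) [a, b, c, d]) i) = 2"
    by (simp add: eval_nat_numeral lessThan_Suc g)
  then obtain c1 c2 c3 where T: "\<And>z. T z = c1 * exp (- (2 * of_real pi * \<i> * z)) + c2 + c3 * exp (2 * of_real pi * \<i> * z)"
    by (rule Tsum_trig_polynomial) (rule that[unfolded T_def])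
  have Tb: "T = Tsum ((!) [b, c, d, a]) ((!) [1, e, f, g])"
    unfolding T_def by (rule Tsum_cong) (rule ext, simp add: Phi_list mult_ac)
  have H1: "\<pi> ^ 4 * (A_prod (1 - a) (e - a) (f - a) (g - a) * N * K_pair a b c d e f g) =
     S a * (S (e - a) * S (f - a) * S (g - a) * T 0 + S b * S c * S d * T (- a))"
    using K_pair_eq_Tsum[OF s] pi by (simp add: S_def T_def N_def \<pi>_def)
  have "A_prod (1 - b) (1 - c) (1 - d) (1 - a) = N" by (simp add: N_def A_prod_def mult_ac)
  hence H2: "\<pi> ^ 4 * (A_prod (1 - b) (e - b) (f - b) (g - b) * N * K_pair b c d a e f g) =
     S b * (S (e - b) * S (f - b) * S (g - b) * T 0 + S a * S c * S d * T (- b))"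
    using K_pair_eq_Tsum[OF sb] pi by (simp add: S_def Tb \<pi>_def mult_ac)
  have H3: "\<pi> ^ 4 * (A_prod (f - a) (f - b) (f - c) (f - d) * A_prod (g - a) (g - b) (g - c) (g - d) * M) =
     (S (g - a) * S (g - b) * S (g - c) * S (g - d)) * T (1 - f) - (S (f - a) * S (f - b) * S (f - c) * S (f - d)) * T (1 - g)"
    using L_pair_eq_Tsum[OF s] pi by (simp add: S_def T_def M_def \<pi>_def)
  have H4: "\<pi> ^ 4 * (A_prod a b c d * N) = S a * S b * S c * S d"
  proof -
    have R1: "rGamma x * rGamma (1 - x) = S x / \<pi>" for x unfolding S_def \<pi>_def by (rule rGamma_reflection_sinpi) simp
    have "A_prod a b c d * N = (rGamma a * rGamma (1 - a)) * (rGamma b * rGamma (1 - b)) * (rGamma c * rGamma (1 - c)) * (rGamma d * rGamma (1 - d))"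
      by (simp add: A_prod_def N_def mult_ac)
    thus ?thesis unfolding R1 using pi by (simp add: eval_nat_numeral)
  qed
  have "sinpi (1 + g - f) * LL = S (2 - e) * M"
    unfolding LL_def M_def S_def by (rule L_pair_chain[OF g gen re])
  moreover have "sinpi (1 + g - f) = - S (g - f)"
    using sinpi_add_of_nat[of "g - f" 1] by (simp add: S_def algebra_simps)
  ultimately have H5: "- S (g - f) * LL = S (2 - e) * M" by simp
  have Bb: "\<pi> ^ 4 * B4 (b, a, c, d, e, f, g) = S (f - b) * S (g - b) * (S a * S c * S d + S (e - b) * S f * S g)"
    and Ba: "\<pi> ^ 4 * B4 (a, b, c, d, e, f, g) = S (f - a) * S (g - a) * (S b * S c * S d + S (e - a) * S f * S g)"
    using pi by (simp_all add: S_prod_def S_def \<pi>_def mult_ac)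
  have "a - b \<notin> \<int>" by (rule gen)
  from trig_three_term[OF s T gen(1) gen(2) this]
  have R: "S (g - f) * (S (f - b) * S (g - b) * (S a * S c * S d + S (e - b) * S f * S g) *
            (S (e - a) * S (f - a) * S (g - a) * T 0 + S b * S c * S d * T (- a)) -
          S (f - a) * S (g - a) * (S b * S c * S d + S (e - a) * S f * S g) *
            (S (e - b) * S (f - b) * S (g - b) * T 0 + S a * S c * S d * T (- b))) +
       S (b - a) * (S a * S b * S c * S d) *
         ((S (g - a) * S (g - b) * S (g - c) * S (g - d)) * T (1 - f) -
          (S (f - a) * S (f - b) * S (f - c) * S (f - d)) * T (1 - g)) = 0"
    unfolding S_def .
  have alg: "p * p * N * sgf * (Aa * Bb * Ka * sb * s2e - Ab * Ba * Kb * sa * s2e - sa * sb * sba * Af * Ag * Aabcd * LL) = 0"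
    if "p * (Aa * N * Ka) = sa * X" "p * (Ab * N * Kb) = sb * Y" "p * (Af * Ag * M) = Z" "p * (Aabcd * N) = Q"
      "- sgf * LL = s2e * M" "p * Bb = U" "p * Ba = V" "sgf * (U * X - V * Y) + sba * Q * Z = 0"
    for p N sgf Aa Bb Ka sb s2e Ab Ba Kb sa sba Af Ag Aabcd LL X Y M Z Q U V :: complex
  proof -
    have "p * p * N * sgf * (Aa * Bb * Ka * sb * s2e - Ab * Ba * Kb * sa * s2e - sa * sb * sba * Af * Ag * Aabcd * LL) =
      sgf * ((p * Bb) * (p * (Aa * N * Ka)) * sb * s2e - (p * Ba) * (p * (Ab * N * Kb)) * sa * s2e) +
      sa * sb * sba * (p * (Aabcd * N)) * (p * Af * Ag) * (- sgf * LL)"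
      by algebra
    also have "\<dots> = sgf * (U * (sa * X) * sb * s2e - V * (sb * Y) * sa * s2e) + sa * sb * sba * Q * (p * Af * Ag) * (s2e * M)"
      unfolding that(1,2,4,5,6,7) ..
    also have "\<dots> = sa * sb * s2e * (sgf * (U * X - V * Y) + sba * Q * (p * (Af * Ag * M)))" by algebra
    also have "\<dots> = 0" unfolding that(3,8) by simp
    finally show ?thesis .
  qed
  have "\<pi> ^ 4 * \<pi> ^ 4 * N * S (g - f) * entire_relation a b c d e f g = 0"
    unfolding entire_relation_def LL_def[symmetric] S_def[symmetric]
    by (rule alg[OF H1 H2 H3 H4 H5 Bb Ba R])
  moreover have "N \<noteq> 0"
  proof -
    have "rGamma (1 - x) \<noteq> 0" if "x \<notin> \<int>" for x :: complex
      using not_Ints_nonpos[OF not_Ints_flip[OF that, of 1]] by (simp add: rGamma_eq_zero_iff)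
    thus ?thesis using gen(1,2,3,4) by (simp add: N_def A_prod_def)
  qed
  moreover have "S (g - f) \<noteq> 0"
  proof -
    have "g - f \<notin> \<int>" by (rule not_Ints_eq[OF gen(21), where k = 1]) (simp add: g)
    thus ?thesis by (simp add: S_def sinpi_eq_0_iff)
  qed
  ultimately show ?thesis using pi by simp
qed

subsection \<open>Removing the genericity assumptions\<close>

lemma hyp_term_Suc:
  "hyp_term a b c d e f g (Suc n) * ((1 + of_nat n) * (e + of_nat n) * (f + of_nat n) * (g + of_nat n)) =
     hyp_term a b c d e f g n * ((a + of_nat n) * (b + of_nat n) * (c + of_nat n) * (d + of_nat n))"
proof -
  have r: "rGamma (x + of_nat n) = (x + of_nat n) * rGamma (x + of_nat (Suc n))" for x :: complex
    using rGamma_plus1[of "x + of_nat n"] by (simp add: add_ac)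
  have nz: "1 + of_nat n \<noteq> (0 :: complex)" by (metis of_nat_Suc of_nat_neq_0)
  show ?thesis
    unfolding hyp_term_def r[of e] r[of f] r[of g] pochhammer_Suc fact_Suc using nz
    by (simp add: divide_simps)
qed

lemma isCont_pochhammer:
  "isCont h x \<Longrightarrow> isCont (\<lambda>t. pochhammer (h t) n) x" for h :: "real \<Rightarrow> complex"
  by (induction n) (simp_all add: pochhammer_Suc)

lemma isCont_hyp_term:
  fixes a b c d e f g :: "real \<Rightarrow> complex"
  assumes "isCont a x" "isCont b x" "isCont c x" "isCont d x" "isCont e x" "isCont f x" "isCont g x"
  shows "isCont (\<lambda>x. hyp_term (a x) (b x) (c x) (d x) (e x) (f x) (g x) n) x"
  unfolding hyp_term_def
  by (intro isCont_mult isCont_divide isCont_pochhammer isCont_rGamma isCont_add assms continuous_const) simp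

text \<open>Continuity of the single terms does not pass to the sum without one summable majorant
  near t = 0. The ratio of consecutive terms is 1 - 2/n + O(1/n^2) uniformly there, since excess 1
  fixes the coefficient -2; comparison with (n / (n + 1))^2 yields decay n^-2.\<close>

lemma hyp_term_uniform_bound:
  fixes a b c d e f g :: "real \<Rightarrow> complex"
  assumes cont: "isCont a 0" "isCont b 0" "isCont c 0" "isCont d 0" "isCont e 0" "isCont f 0" "isCont g 0"
    and s: "\<And>x. e x + f x + g x = a x + b x + c x + d x + 1"
  obtains M where "summable M"
    "\<forall>\<^sub>F (n, x) in sequentially \<times>\<^sub>F at 0. norm (hyp_term (a x) (b x) (c x) (d x) (e x) (f x) (g x) n) \<le> M n"
proof -
  define F where "F = (sequentially :: nat filter) \<times>\<^sub>F at (0 :: real)"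
  define w where "w = (\<lambda>(n::nat, x::real). 1 / of_nat n :: complex)"
  have w: "(w \<longlongrightarrow> 0) F"
    unfolding w_def F_def case_prod_unfold
    by (rule filterlim_compose[OF lim_1_over_n filterlim_fst])
  define A where "A i = (\<lambda>(n::nat, x::real). [1, e x, f x, g x] ! i)" for i
  define B where "B i = (\<lambda>(n::nat, x::real). [a x, b x, c x, d x] ! i)" for i
  have bdd: "(\<lambda>(n::nat, x). h x) \<in> O[F](\<lambda>_. 1)" if "isCont h 0" for h :: "real \<Rightarrow> complex"
  proof (rule bigoI_tendsto[of _ _ "h 0"])
    have "(h \<longlongrightarrow> h 0) (at 0)" using that by (simp add: isCont_def)
    hence "((\<lambda>y. h (snd y)) \<longlongrightarrow> h 0) F" unfolding F_def by (rule filterlim_compose[OF _ filterlim_snd])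
    thus "((\<lambda>y. (case y of (n, x) \<Rightarrow> h x) / 1) \<longlongrightarrow> h 0) F" by (simp add: case_prod_unfold)
  qed auto
  have i4: "i \<in> {..<4} \<Longrightarrow> i = 0 \<or> i = 1 \<or> i = 2 \<or> i = 3" for i :: nat by auto
  have AO: "A i \<in> O[F](\<lambda>_. 1)" if "i \<in> {..<4}" for i
    using i4[OF that] bdd[OF cont(5)] bdd[OF cont(6)] bdd[OF cont(7)] bdd[of "\<lambda>_. 1"] unfolding A_def by (elim disjE) (simp_all add: case_prod_unfold)
  have BO: "B i \<in> O[F](\<lambda>_. 1)" if "i \<in> {..<4}" for i
    using i4[OF that] bdd[OF cont(1)] bdd[OF cont(2)] bdd[OF cont(3)] bdd[OF cont(4)] unfolding B_def by (elim disjE) (simp_all add: case_prod_unfold)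
  define \<rho> where "\<rho> = (\<lambda>y. \<Prod>i<4. (1 + B i y * w y) * inverse (1 + A i y * w y))"
  have "lin_asymp F w \<rho> (\<lambda>y. \<Sum>i<4. B i y - A i y)"
    unfolding \<rho>_def by (intro lin_asymp_ratio AO BO w) auto
  also have "(\<lambda>y. \<Sum>i<4. B i y - A i y) = (\<lambda>_. - 2)"
  proof
    fix y :: "nat \<times> real"
    show "(\<Sum>i<4. B i y - A i y) = - 2"
      using s[of "snd y"] by (simp add: A_def B_def case_prod_unfold eval_nat_numeral lessThan_Suc) (simp add: algebra_simps)
  qed
  finally have \<rho>: "lin_asymp F w \<rho> (\<lambda>_. - 2)" .
  have "lin_asymp F w (\<lambda>y. \<rho> y * ((1 + 1 * w y) * (1 + 1 * w y))) (\<lambda>_. - 2 + (1 + 1))"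
    by (intro lin_asymp_mult[OF _ _ w] \<rho> lin_asymp_affine) auto
  hence "(\<lambda>y. \<rho> y * ((1 + w y) * (1 + w y)) - 1) \<in> O[F](\<lambda>y. (w y)\<^sup>2)" by (simp add: lin_asymp_def)
  then obtain K where K: "K > 0" "\<forall>\<^sub>F y in F. norm (\<rho> y * ((1 + w y) * (1 + w y)) - 1) \<le> K * norm ((w y)\<^sup>2)"
    by (elim landau_o.bigE)
  define h where "h x n = hyp_term (a x) (b x) (c x) (d x) (e x) (f x) (g x) n" for x n
  obtain P Q where PQ: "eventually P sequentially" "eventually Q (at 0)"
    "\<And>n x. P n \<Longrightarrow> Q x \<Longrightarrow> norm (\<rho> (n, x) * ((1 + w (n, x)) * (1 + w (n, x))) - 1) \<le> K * norm ((w (n, x))\<^sup>2)"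
    using K(2) unfolding F_def eventually_prod_filter by auto
  obtain n1 where n1: "\<And>n. n \<ge> n1 \<Longrightarrow> P n" using PQ(1) unfolding eventually_sequentially by blast
  have ev_bd: "\<exists>R. \<forall>\<^sub>F x in at 0. norm (h x) < R" if "isCont h 0" for h :: "real \<Rightarrow> complex"
  proof -
    have "((\<lambda>x. norm (h x)) \<longlongrightarrow> norm (h 0)) (at 0)" using that by (intro tendsto_norm) (simp add: isCont_def)
    hence "\<forall>\<^sub>F x in at 0. norm (h x) < norm (h 0) + 1" by (rule order_tendstoD) simp
    thus ?thesis by blast
  qed
  obtain Be Bf Bg where R: "\<forall>\<^sub>F x in at 0. norm (e x) < Be" "\<forall>\<^sub>F x in at 0. norm (f x) < Bf" "\<forall>\<^sub>F x in at 0. norm (g x) < Bg"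
    using ev_bd[OF cont(5)] ev_bd[OF cont(6)] ev_bd[OF cont(7)] by blast
  \<comment> \<open>From N on the lower parameters cannot meet -k and the ratio estimate holds. The
    term at N is bounded by continuity and starts the induction.\<close>
  obtain N :: nat where N: "real N \<ge> max (max Be Bf) (max Bg (real n1 + 1))" using real_arch_simple by blast
  have "isCont (\<lambda>x. h x N) 0"
    unfolding h_def by (rule isCont_hyp_term[OF cont])
  then obtain D where D: "\<forall>\<^sub>F x in at 0. norm (h x N) < D" using ev_bd by blast
  define Z where "Z = (\<Sum>k. 1 / (1 + real k ^ 2))"
  \<comment> \<open>The 2 in the exponential pays for replacing 1 / k^2 by 1 / (1 + k^2), which is
    finite at k = 0.\<close>
  define M where "M n = D * real N ^ 2 * exp (2 * K * Z) * (1 / real n ^ 2)" for n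
  have "summable M"
    unfolding M_def using inverse_power_summable[of 2, where 'a = real] by (intro summable_mult) (simp add: divide_inverse)
  moreover have "\<forall>\<^sub>F (n, x) in F. norm (h x n) \<le> M n"
    unfolding F_def eventually_prod_filter
  proof (intro exI conjI allI impI)
    show "eventually (\<lambda>n. n \<ge> N) sequentially" by (rule eventually_ge_at_top)
    show "\<forall>\<^sub>F x in at 0. Q x \<and> norm (e x) < Be \<and> norm (f x) < Bf \<and> norm (g x) < Bg \<and> norm (h x N) < D"
      using PQ(2) R D by eventually_elim auto
    fix n x assume n: "n \<ge> N" and x: "Q x \<and> norm (e x) < Be \<and> norm (f x) < Bf \<and> norm (g x) < Bg \<and> norm (h x N) < D"
    have N1: "N \<ge> 1" "N \<ge> n1" using N by auto
    have ind: "norm (h x (N + m)) \<le> D * real N ^ 2 * exp (\<Sum>k<N + m. 2 * K * (1 / (1 + real k ^ 2))) * (1 / real (N + m) ^ 2)" for m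
    proof (induction m)
      case 0
      have "0 \<le> norm (h x N)" by simp
      hence D0: "D \<ge> 0" using x by linarith
      have "0 \<le> (\<Sum>k<N. 2 * K * (1 / (1 + real k ^ 2)))"
        using K(1) by (intro sum_nonneg) (auto intro!: mult_nonneg_nonneg divide_nonneg_nonneg add_nonneg_nonneg)
      hence "D * 1 \<le> D * exp (\<Sum>k<N. 2 * K * (1 / (1 + real k ^ 2)))" using D0 by (intro mult_left_mono) auto
      thus ?case using x N1 by simp
    next
      case (Suc m)
      define k where "k = N + m"
      have k: "k \<ge> N" "k \<ge> 1" "k \<ge> n1" using N1 by (auto simp: k_def)
      define K' :: complex where "K' = of_nat k"
      have K'0: "K' \<noteq> 0" using k by (simp add: K'_def)
      have nz: "y + K' \<noteq> 0" if "norm y < real k" for y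
      proof
        assume "y + K' = 0"
        hence "y = - K'" by (simp add: eq_neg_iff_add_eq_0)
        hence "norm y = real k" by (simp add: K'_def)
        thus False using that by simp
      qed
      have nz4: "1 + K' \<noteq> 0" "e x + K' \<noteq> 0" "f x + K' \<noteq> 0" "g x + K' \<noteq> 0"
        using x N k nz[of "e x"] nz[of "f x"] nz[of "g x"] by (auto simp: K'_def) (metis of_nat_Suc of_nat_neq_0 add.commute)
      have wk: "w (k, x) = 1 / K'" by (simp add: w_def K'_def)
      have rho: "\<rho> (k, x) = ((a x + K') * (b x + K') * (c x + K') * (d x + K')) / ((1 + K') * (e x + K') * (f x + K') * (g x + K'))"
      proof -
        have q: "(1 + u / K') * inverse (1 + v / K') = (u + K') / (v + K')" for u v
        proof -
          have "1 + y / K' = (y + K') / K'" for y using K'0 by (simp add: field_simps)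
          thus ?thesis using K'0 by simp
        qed
        show ?thesis
          unfolding \<rho>_def wk by (simp add: A_def B_def eval_nat_numeral lessThan_Suc q) (simp add: mult_ac)
      qed
      have "h x (Suc k) = h x k * \<rho> (k, x)"
      proof -
        have q: "u = v * (p / r)" if "u * r = v * p" "r \<noteq> 0" for u v p r :: complex
          using that by (simp add: eq_divide_eq)
        have "(1 + K') * (e x + K') * (f x + K') * (g x + K') \<noteq> 0" using nz4 by simp
        from q[OF hyp_term_Suc[of "a x" "b x" "c x" "d x" "e x" "f x" "g x" k, folded K'_def] this]
        show ?thesis unfolding rho h_def .
      qed
      hence step: "norm (h x (Suc k)) = norm (h x k) * norm (\<rho> (k, x))" by (simp add: norm_mult)
      have "norm (\<rho> (k, x)) \<le> (real k / real (Suc k)) ^ 2 * (1 + K / real k ^ 2)"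
      proof -
        have ww: "1 + w (k, x) = (1 + K') / K'" unfolding wk using K'0 by (simp add: field_simps)
        define u where "u = \<rho> (k, x) * ((1 + w (k, x)) * (1 + w (k, x)))"
        have "norm (u - 1) \<le> K * norm ((w (k, x))\<^sup>2)" unfolding u_def by (rule PQ(3)[OF n1]) (use k x in auto)
        hence "norm (u - 1) \<le> K / real k ^ 2" by (simp add: wk K'_def norm_divide norm_power power_divide)
        hence u1: "norm u \<le> 1 + K / real k ^ 2" using norm_triangle_ineq[of 1 "u - 1"] by simp
        have "\<rho> (k, x) = (K' / (1 + K')) ^ 2 * u" unfolding u_def ww using K'0 nz4 by (simp add: power2_eq_square)
        hence "norm (\<rho> (k, x)) = norm (K' / (1 + K')) ^ 2 * norm u" by (simp add: norm_mult norm_power)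
        also have "norm (K' / (1 + K')) = real k / real (Suc k)"
        proof -
          have "1 + K' = of_nat (Suc k)" by (simp add: K'_def)
          thus ?thesis by (simp only: norm_divide K'_def norm_of_nat)
        qed
        finally show ?thesis using u1 by (simp add: mult_left_mono)
      qed
      also have "\<dots> \<le> (real k / real (Suc k)) ^ 2 * exp (2 * K * (1 / (1 + real k ^ 2)))"
      proof (intro mult_left_mono)
        have "1 \<le> real k ^ 2" using k by (simp add: one_le_power)
        hence "K / real k ^ 2 \<le> 2 * K * (1 / (1 + real k ^ 2))" using K(1) by (simp add: divide_simps add_pos_nonneg)
        thus "1 + K / real k ^ 2 \<le> exp (2 * K * (1 / (1 + real k ^ 2)))"
          using exp_ge_add_one_self[of "2 * K * (1 / (1 + real k ^ 2))"] by linarith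
      qed auto
      finally have rb: "norm (\<rho> (k, x)) \<le> (real k / real (Suc k)) ^ 2 * exp (2 * K * (1 / (1 + real k ^ 2)))" .
      have "norm (h x (Suc k)) \<le> (D * real N ^ 2 * exp (\<Sum>k<k. 2 * K * (1 / (1 + real k ^ 2))) * (1 / real k ^ 2)) *
         ((real k / real (Suc k)) ^ 2 * exp (2 * K * (1 / (1 + real k ^ 2))))"
        unfolding step using Suc rb unfolding k_def[symmetric]
        by (intro mult_mono) (auto intro: order_trans[OF norm_ge_zero])
      also have "\<dots> = D * real N ^ 2 * exp (\<Sum>k<Suc k. 2 * K * (1 / (1 + real k ^ 2))) * (1 / real (Suc k) ^ 2)"
        using k by (simp add: exp_add power_divide del: of_nat_Suc)
      finally show ?case by (simp add: k_def)
    qed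
    have "0 \<le> norm (h x N)" by simp
    hence D0: "D \<ge> 0" using x by linarith
    have "(\<Sum>k<n. 2 * K * (1 / (1 + real k ^ 2))) \<le> 2 * K * Z"
      unfolding sum_distrib_left[symmetric] Z_def using K(1)
      by (intro mult_left_mono sum_le_suminf summable_inverse_squares_plus) (auto intro: add_nonneg_nonneg)
    hence "D * real N ^ 2 * exp (\<Sum>k<n. 2 * K * (1 / (1 + real k ^ 2))) * (1 / real n ^ 2) \<le> M n"
      unfolding M_def using D0 by (intro mult_right_mono mult_left_mono) auto
    moreover have "norm (h x n) \<le> D * real N ^ 2 * exp (\<Sum>k<n. 2 * K * (1 / (1 + real k ^ 2))) * (1 / real n ^ 2)"
      using ind[of "n - N"] n by simp
    ultimately show "case (n, x) of (n, x) \<Rightarrow> norm (h x n) \<le> M n" by simp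
  qed
  ultimately show ?thesis using that unfolding F_def h_def by blast
qed

lemma isCont_F43:
  fixes a b c d e f g :: "real \<Rightarrow> complex"
  assumes cont: "isCont a 0" "isCont b 0" "isCont c 0" "isCont d 0" "isCont e 0" "isCont f 0" "isCont g 0"
    and s: "\<And>x. e x + f x + g x = a x + b x + c x + d x + 1"
  shows "isCont (\<lambda>x. F43 (a x) (b x) (c x) (d x) (e x) (f x) (g x)) 0"
proof -
  define h where "h n x = hyp_term (a x) (b x) (c x) (d x) (e x) (f x) (g x) n" for n x
  obtain M where M: "summable M" "\<forall>\<^sub>F (n, x) in sequentially \<times>\<^sub>F at 0. norm (h n x) \<le> M n"
    using hyp_term_uniform_bound[OF cont s] unfolding h_def by blast
  have "isCont (h n) 0" for n
    unfolding h_def[abs_def] by (rule isCont_hyp_term[OF cont])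
  hence lim: "(h n \<longlongrightarrow> h n 0) (at 0)" for n by (simp add: isCont_def)
  from tannerys_theorem[OF lim M(2,1)]
  have "((\<lambda>x. suminf (\<lambda>n. h n x)) \<longlongrightarrow> suminf (\<lambda>n. h n 0)) (at 0)" by simp
  thus ?thesis by (simp add: isCont_def F43_def h_def)
qed

text \<open>The integers are closed, which settles z off the integers; if z is an integer, a
  displacement with 0 < |t k| < 1 leaves them.\<close>

lemma eventually_not_Ints:
  fixes h :: "real \<Rightarrow> complex"
  assumes k: "k \<noteq> 0" and h: "\<And>t. h t = z + of_real (t * k)"
  shows "\<forall>\<^sub>F t in at 0. h t \<notin> \<int>"
proof (cases "z \<in> \<int>")
  case False
  have "isCont h 0" unfolding h by (intro continuous_intros)
  hence "(h \<longlongrightarrow> z) (at 0)" by (simp add: isCont_def h)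
  moreover have "open (- (\<int> :: complex set))" by (simp add: closed_Ints open_Compl)
  ultimately have "\<forall>\<^sub>F t in at 0. h t \<in> - \<int>" using False by (intro topological_tendstoD) auto
  thus ?thesis by eventually_elim simp
next
  case True
  have "((\<lambda>t. \<bar>t * k\<bar>) \<longlongrightarrow> \<bar>0 * k\<bar>) (at 0)" by (intro tendsto_intros)
  hence "\<forall>\<^sub>F t in at 0. \<bar>t * k\<bar> < 1" by (rule order_tendstoD) simp
  moreover have "\<forall>\<^sub>F t in at 0. t \<noteq> (0 :: real)" by (rule eventually_neq_at_within)
  ultimately show ?thesis
  proof eventually_elim
    case (elim t)
    show ?case
    proof
      assume "h t \<in> \<int>"
      hence "complex_of_real (t * k) \<in> \<int>" using True Ints_diff[of "h t" z] by (simp add: h)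
      then obtain n :: int where "complex_of_real (t * k) = of_int n" by (auto elim: Ints_cases)
      hence "Re (complex_of_real (t * k)) = Re (of_int n)" by (rule arg_cong)
      hence n: "t * k = of_int n" by simp
      hence "\<bar>real_of_int n\<bar> < 1" using elim(1) by simp
      hence "n = 0" by linarith
      thus False using n elim(2) k by simp
    qed
  qed
qed

lemma eventually_Re_neq:
  fixes h :: "real \<Rightarrow> complex"
  assumes k: "k \<noteq> 0" and h: "\<And>t. h t = z + of_real (t * k)"
  shows "\<forall>\<^sub>F t in at 0. Re (h t) \<noteq> r"
proof -
  have "\<forall>\<^sub>F t in at 0. t \<noteq> (r - Re z) / k" by (rule eventually_neq_at_within)
  thus ?thesis by eventually_elim (use k in \<open>auto simp: h field_simps\<close>)
qed

lemma isCont_sinpi: "isCont h x \<Longrightarrow> isCont (\<lambda>t. sinpi (h t)) x" for h :: "real \<Rightarrow> complex"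
  unfolding sinpi_def by (intro continuous_intros)

text \<open>The direction \<open>(1, 3, 1, 3, 2, 0, 6)\<close> is tangent to V and lies in none of the hyperplanes excluded in
  \<open>entire_relation_generic\<close>, so every point is a limit of generic points.\<close>

lemma entire_relation_zero:
  fixes a b c d e f g :: complex
  assumes g: "g = 1 + a + b + c + d - e - f"
  shows "entire_relation a b c d e f g = 0"
proof -
  define aa where "aa t = a + of_real t" for t
  define bb where "bb t = b + 3 * of_real t" for t
  define cc where "cc t = c + of_real t" for t
  define dd where "dd t = d + 3 * of_real t" for t
  define ee where "ee t = e + 2 * of_real t" for t
  define ff where "ff = (\<lambda>t::real. f)"
  define gg where "gg t = g + 6 * of_real t" for t
  note path_defs = aa_def bb_def cc_def dd_def ee_def ff_def gg_def
  define W where "W t = entire_relation (aa t) (bb t) (cc t) (dd t) (ee t) (ff t) (gg t)" for t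
  have gg: "gg t = 1 + aa t + bb t + cc t + dd t - ee t - ff t" for t by (simp add: path_defs g)
  \<comment> \<open>In each of the following conditions \<open>k\<close> is the rate of change of
    the linear form along the path, and it has to be nonzero.\<close>
  have ev1: "\<forall>\<^sub>F t in at 0. aa t \<notin> \<int>"
    by (rule eventually_not_Ints[where k = "1" and z = "a"]) (simp_all add: path_defs algebra_simps)
  have ev2: "\<forall>\<^sub>F t in at 0. bb t \<notin> \<int>"
    by (rule eventually_not_Ints[where k = "3" and z = "b"]) (simp_all add: path_defs algebra_simps)
  have ev3: "\<forall>\<^sub>F t in at 0. cc t \<notin> \<int>"
    by (rule eventually_not_Ints[where k = "1" and z = "c"]) (simp_all add: path_defs algebra_simps)
  have ev4: "\<forall>\<^sub>F t in at 0. dd t \<notin> \<int>"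
    by (rule eventually_not_Ints[where k = "3" and z = "d"]) (simp_all add: path_defs algebra_simps)
  have ev5: "\<forall>\<^sub>F t in at 0. aa t - ee t \<notin> \<int>"
    by (rule eventually_not_Ints[where k = "-1" and z = "a - e"]) (simp_all add: path_defs algebra_simps)
  have ev6: "\<forall>\<^sub>F t in at 0. bb t - ee t \<notin> \<int>"
    by (rule eventually_not_Ints[where k = "1" and z = "b - e"]) (simp_all add: path_defs algebra_simps)
  have ev7: "\<forall>\<^sub>F t in at 0. cc t - ee t \<notin> \<int>"
    by (rule eventually_not_Ints[where k = "-1" and z = "c - e"]) (simp_all add: path_defs algebra_simps)
  have ev8: "\<forall>\<^sub>F t in at 0. dd t - ee t \<notin> \<int>"
    by (rule eventually_not_Ints[where k = "1" and z = "d - e"]) (simp_all add: path_defs algebra_simps)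
  have ev9: "\<forall>\<^sub>F t in at 0. aa t - ff t \<notin> \<int>"
    by (rule eventually_not_Ints[where k = "1" and z = "a - f"]) (simp_all add: path_defs algebra_simps)
  have ev10: "\<forall>\<^sub>F t in at 0. bb t - ff t \<notin> \<int>"
    by (rule eventually_not_Ints[where k = "3" and z = "b - f"]) (simp_all add: path_defs algebra_simps)
  have ev11: "\<forall>\<^sub>F t in at 0. aa t + bb t + dd t - ee t - ff t \<notin> \<int>"
    by (rule eventually_not_Ints[where k = "5" and z = "a + b + d - e - f"]) (simp_all add: path_defs algebra_simps)
  have ev12: "\<forall>\<^sub>F t in at 0. aa t + bb t + cc t - ee t - ff t \<notin> \<int>"
    by (rule eventually_not_Ints[where k = "3" and z = "a + b + c - e - f"]) (simp_all add: path_defs algebra_simps)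
  have ev13: "\<forall>\<^sub>F t in at 0. ee t \<notin> \<int>"
    by (rule eventually_not_Ints[where k = "2" and z = "e"]) (simp_all add: path_defs algebra_simps)
  have ev14: "\<forall>\<^sub>F t in at 0. aa t + bb t - ff t \<notin> \<int>"
    by (rule eventually_not_Ints[where k = "4" and z = "a + b - f"]) (simp_all add: path_defs algebra_simps)
  have ev15: "\<forall>\<^sub>F t in at 0. aa t + bb t - ee t - ff t \<notin> \<int>"
    by (rule eventually_not_Ints[where k = "2" and z = "a + b - e - f"]) (simp_all add: path_defs algebra_simps)
  have ev16: "\<forall>\<^sub>F t in at 0. dd t - ff t \<notin> \<int>"
    by (rule eventually_not_Ints[where k = "3" and z = "d - f"]) (simp_all add: path_defs algebra_simps)
  have ev17: "\<forall>\<^sub>F t in at 0. cc t - ff t \<notin> \<int>"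
    by (rule eventually_not_Ints[where k = "1" and z = "c - f"]) (simp_all add: path_defs algebra_simps)
  have ev18: "\<forall>\<^sub>F t in at 0. aa t + cc t + dd t - ee t - ff t \<notin> \<int>"
    by (rule eventually_not_Ints[where k = "3" and z = "a + c + d - e - f"]) (simp_all add: path_defs algebra_simps)
  have ev19: "\<forall>\<^sub>F t in at 0. bb t + cc t + dd t - ee t - ff t \<notin> \<int>"
    by (rule eventually_not_Ints[where k = "5" and z = "b + c + d - e - f"]) (simp_all add: path_defs algebra_simps)
  have ev20: "\<forall>\<^sub>F t in at 0. cc t + dd t - ee t - ff t \<notin> \<int>"
    by (rule eventually_not_Ints[where k = "2" and z = "c + d - e - f"]) (simp_all add: path_defs algebra_simps)
  have ev21: "\<forall>\<^sub>F t in at 0. aa t + bb t + cc t + dd t - ee t - 2 * ff t \<notin> \<int>"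
    by (rule eventually_not_Ints[where k = "6" and z = "a + b + c + d - e - 2 * f"]) (simp_all add: path_defs algebra_simps)
  have ev22: "\<forall>\<^sub>F t in at 0. aa t - bb t \<notin> \<int>"
    by (rule eventually_not_Ints[where k = "-2" and z = "a - b"]) (simp_all add: path_defs algebra_simps)
  have re1: "\<forall>\<^sub>F t in at 0. Re (aa t + bb t - ff t) \<noteq> 0"
    by (rule eventually_Re_neq[where k = 4 and z = "a + b - f"]) (simp_all add: path_defs)
  have re2: "\<forall>\<^sub>F t in at 0. Re (ee t) \<noteq> 1"
    by (rule eventually_Re_neq[where k = 2 and z = e]) (simp_all add: path_defs)
  have re3: "\<forall>\<^sub>F t in at 0. Re (ee t + ff t - cc t - dd t) \<noteq> 1"
    by (rule eventually_Re_neq[where k = "-2" and z = "e + f - c - d"]) (simp_all add: path_defs)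
  have "\<forall>\<^sub>F t in at 0. W t = 0"
    using ev1 ev2 ev3 ev4 ev5 ev6 ev7 ev8 ev9 ev10 ev11 ev12 ev13 ev14 ev15 ev16 ev17 ev18 ev19 ev20 ev21 ev22 re1 re2 re3
  proof eventually_elim
    case (elim t)
    show ?case unfolding W_def by (rule entire_relation_generic[OF gg]) (use elim in simp_all)
  qed
  moreover have "isCont W 0"
  proof -
    have cont: "isCont aa 0" "isCont bb 0" "isCont cc 0" "isCont dd 0" "isCont ee 0" "isCont ff 0" "isCont gg 0"
      unfolding path_defs by (intro continuous_intros)+
    note ci = isCont_F43 isCont_sinpi isCont_rGamma isCont_add isCont_diff isCont_mult isCont_minus isCont_divide isCont_power cont continuous_const
    show ?thesis
      unfolding W_def[abs_def] entire_relation_def K_pair_def L_pair_def A_prod_def B4.simps S_prod_def list.map prod_list.Cons prod_list.Nil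
      by (intro ci) (simp_all add: gg)
  qed
  ultimately have "W 0 = 0"
    unfolding isCont_def by (intro tendsto_unique[OF _ _ tendsto_eventually, of "at 0" W]) simp_all
  thus ?thesis by (simp add: W_def path_defs)
qed

section \<open>Return to the functions K and L\<close>

lemma hyp4F3_eq_F43:
  assumes s: "e + f + g = a + b + c + d + 1" and n: "e \<notin> \<int>\<^sub>\<le>\<^sub>0" "f \<notin> \<int>\<^sub>\<le>\<^sub>0" "g \<notin> \<int>\<^sub>\<le>\<^sub>0"
  shows "hyp4F3 a b c d e f g * (rGamma e * rGamma f * rGamma g) = F43 a b c d e f g"
proof -
  define R where "R = rGamma e * rGamma f * rGamma g"
  have R0: "R \<noteq> 0" using n by (simp add: R_def rGamma_eq_zero_iff)
  have r: "rGamma (x + of_nat k) = rGamma x / pochhammer x k" if "x \<notin> \<int>\<^sub>\<le>\<^sub>0" for x :: complex and k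
  proof -
    have "pochhammer x k \<noteq> 0" using that pochhammer_eq_0_imp_nonpos_Int by blast
    thus ?thesis using pochhammer_rGamma[of x k] by simp
  qed
  have t: "hyp_term a b c d e f g = (\<lambda>n. R * ((pochhammer a n * pochhammer b n * pochhammer c n * pochhammer d n) /
          (fact n * pochhammer e n * pochhammer f n * pochhammer g n)))"
    by (rule ext) (simp add: hyp_term_def r[OF n(1)] r[OF n(2)] r[OF n(3)] R_def mult_ac)
  have "summable (\<lambda>n. inverse R * hyp_term a b c d e f g n)" by (intro summable_mult summable_hyp_term s)
  hence "summable (\<lambda>n. (pochhammer a n * pochhammer b n * pochhammer c n * pochhammer d n) /
          (fact n * pochhammer e n * pochhammer f n * pochhammer g n))"
    using R0 by (simp add: t mult.assoc[symmetric])
  hence "F43 a b c d e f g = R * hyp4F3 a b c d e f g"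
    unfolding F43_def t hyp4F3_def by (rule suminf_mult)
  thus ?thesis by (simp add: R_def mult_ac)
qed

lemma K_fun_eq_K_pair:
  assumes s: "e + f + g = a + b + c + d + 1" and K: "K_defined a b c d e f g"
  shows "K_fun a b c d e f g * sinpi a = K_pair a b c d e f g"
proof -
  have n: "sinpi a \<noteq> 0" "e \<notin> \<int>\<^sub>\<le>\<^sub>0" "f \<notin> \<int>\<^sub>\<le>\<^sub>0" "g \<notin> \<int>\<^sub>\<le>\<^sub>0" "1 + a - b \<notin> \<int>\<^sub>\<le>\<^sub>0" "1 + a - c \<notin> \<int>\<^sub>\<le>\<^sub>0" "1 + a - d \<notin> \<int>\<^sub>\<le>\<^sub>0"
    using K by (auto simp: K_defined_def)
  have s2: "1 + a - b + (1 + a - c) + (1 + a - d) = a + (1 + a - e) + (1 + a - f) + (1 + a - g) + 1" using s by algebra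
  show ?thesis
    unfolding K_fun_def K_pair_def hyp4F3_eq_F43[OF s n(2-4), symmetric] hyp4F3_eq_F43[OF s2 n(5-7), symmetric]
    using n(1) by (simp add: field_simps)
qed

lemma L_fun_eq_L_pair:
  assumes s: "e + f + g = a + b + c + d + 1" and L: "L_defined a b c d e f g"
  shows "L_fun a b c d e f g * sinpi e = L_pair a b c d e f g"
proof -
  have n: "sinpi e \<noteq> 0" "e \<notin> \<int>\<^sub>\<le>\<^sub>0" "f \<notin> \<int>\<^sub>\<le>\<^sub>0" "g \<notin> \<int>\<^sub>\<le>\<^sub>0" "2 - e \<notin> \<int>\<^sub>\<le>\<^sub>0" "1 + f - e \<notin> \<int>\<^sub>\<le>\<^sub>0" "1 + g - e \<notin> \<int>\<^sub>\<le>\<^sub>0"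
    using L by (auto simp: L_defined_def)
  have s2: "2 - e + (1 + f - e) + (1 + g - e) = 1 + a - e + (1 + b - e) + (1 + c - e) + (1 + d - e) + 1" using s by algebra
  show ?thesis
    unfolding L_fun_def L_pair_def hyp4F3_eq_F43[OF s n(2-4), symmetric] hyp4F3_eq_F43[OF s2 n(5-7), symmetric]
    using n(1) by (simp add: field_simps)
qed

theorem proposition6p12:
  fixes a b c d e f g :: complex and x :: complex7
  assumes x: "x = (a, b, c, d, e, f, g)"
    and "x \<in> V_set"
    and "K_p0_defined x" and "K_p1_defined x" and "L_6bar_defined x"
  shows "A_prod (1 - a) (e - a) (f - a) (g - a) * B4 (b, a, c, d, e, f, g) * K_p0 x
       - A_prod (1 - b) (e - b) (f - b) (g - b) * B4 x * K_p1 x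
       - S_prod [b - a] * A_prod (f - a) (f - b) (f - c) (f - d)
           * A_prod (g - a) (g - b) (g - c) (g - d) * A_prod a b c d * L_6bar x = 0"
proof -
  have V: "e + f + g - a - b - c - d = 1" using assms(2) by (simp add: x V_set_def)
  have g: "g = 1 + a + b + c + d - e - f" using V by algebra
  have s: "e + f + g = a + b + c + d + 1" "e + f + g = b + c + d + a + 1"
    "2 - e + (2 - f) + (2 - g) = 1 - a + (1 - b) + (1 - c) + (1 - d) + 1" using V by algebra+
  have K0: "K_defined a b c d e f g" and K1: "K_defined b c d a e f g"
    and L: "L_defined (1 - a) (1 - b) (1 - c) (1 - d) (2 - e) (2 - f) (2 - g)"
    using assms(3-5) by (simp_all add: x)
  have nz: "sinpi a \<noteq> 0" "sinpi b \<noteq> 0" "sinpi (2 - e) \<noteq> 0"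
    using K0 K1 L by (simp_all add: K_defined_def L_defined_def)
  have "entire_relation a b c d e f g = 0" by (rule entire_relation_zero[OF g])
  \<comment> \<open>The three sines are the denominators of the K and L functions that occur; they
    are nonzero by definedness and cancel at the end.\<close>
  hence "sinpi a * sinpi b * sinpi (2 - e) *
      (A_prod (1 - a) (e - a) (f - a) (g - a) * B4 (b, a, c, d, e, f, g) * K_p0 x
       - A_prod (1 - b) (e - b) (f - b) (g - b) * B4 x * K_p1 x
       - S_prod [b - a] * A_prod (f - a) (f - b) (f - c) (f - d)
           * A_prod (g - a) (g - b) (g - c) (g - d) * A_prod a b c d * L_6bar x) = 0"
    unfolding entire_relation_def K_fun_eq_K_pair[OF s(1) K0, symmetric] K_fun_eq_K_pair[OF s(2) K1, symmetric]
      L_fun_eq_L_pair[OF s(3) L, symmetric]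
    by (simp add: x S_prod_def algebra_simps del: B4.simps)
  thus ?thesis using nz by simp
qed

end
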